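(* Let $n\ge2$, $\sigma\in S_n$ and $1\le a\le n-1$, and let $s_{a,a+1}\in S_n$ be the transposition of $a$ and $a+1$. For $\sigma',\sigma\in S_n$ let $\mathcal R_{\sigma',\sigma}=\mathrm{Stab}_{\sigma'}^{-1}\circ\mathrm{Stab}_\sigma\in\mathrm{End}\big((\mathbb C^2)^{\otimes n}\otimes\mathcal L_{\lambda,\boldsymbol z,y}\big)$. Then $$\mathcal R_{\sigma s_{a,a+1},\sigma}=R^{(\sigma(a+1),\sigma(a))}\Big(\lambda-y\sum_{i=a+2}^nh^{(\sigma(i))},\ z_{\sigma(a+1)}-z_{\sigma(a)},\ y\Big).$$
   Context: **Notation.** $[n]=\{1,\dots,n\}$; $\mathcal I_k$ is the set of $k$-element subsets of $[n]$; $\bar I=[n]\setminus I$; $\boldsymbol z=(z_1,\dots,z_n)$; $\lambda,y$ are further variables; for $\sigma\in S_n$, $\sigma(I)=\{\sigma(i):i\in I\}$. **Rings.** $\mathcal L_{\boldsymbol z,y}$: rational functions $f(\boldsymbol z,y)/\big(\prod_{i\ne j}(z_i-z_j)^{k_{ij}}\prod_{i,j}(z_i-z_j-y)^{l_{ij}}\big)$, $f$ a polynomial, $k_{ij},l_{ij}\in\mathbb Z_{\ge0}$. $\mathcal L_{\lambda,y}$: rational functions $f/g$, $f\in\mathbb C[\lambda,y]$, $g$ a finite product of factors $\lambda+ly$, $l\in\mathbb Z$. $\mathcal L_{\lambda,\boldsymbol z,y}=\mathcal L_{\lambda,y}\otimes_{\mathbb C[y]}\mathcal L_{\boldsymbol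 z,y}$. **Cohomology.** $T=(\mathbb C^\times)^n\times\mathbb C^\times$; the diagonal torus acts on $T^*\mathrm{Gr}_k(\mathbb C^n)$ via $\mathbb C^n$, the extra $\mathbb C^\times$ scales the fibers. $H^*_T(T^*\mathrm{Gr}_k(\mathbb C^n))=\mathbb C[\gamma_{1,1},\dots,\gamma_{1,k},\gamma_{2,1},\dots,\gamma_{2,n-k},\boldsymbol z,y]^{S_k\times S_{n-k}}$ modulo the coefficients in $u$ of $\prod_i(u-\gamma_{1,i})\prod_i(u-\gamma_{2,i})-\prod_i(u-z_i)$. Restriction to the fixed point $x_I$ ($I\in\mathcal I_k$) is the substitution $\{\gamma_{1,*}\}\mapsto\{z_a\}_{a\in I}$, $\{\gamma_{2,*}\}\mapsto\{z_a\}_{a\in\bar I}$; after tensoring over $\mathbb C[\boldsymbol z,y]$ with $\mathcal L_{\lambda,\boldsymbol z,y}$ the map to the direct sum over all fixed points is an isomorphism. $\mathcal X_n=\coprod_{k=0}^nT^*\mathrm{Gr}_k(\mathbb C^n)$. **Weight functions.** For $i\in I$ put $w(i,I)=\#\{j>i:j\in I\}-\#\{j>i:j\in\bar I\}$ ($j\in[n]$). For $I=\{i_1<\dots<i_k\}$ let $l_I(r,a)=t_r-z_a+y$ if $a<i_r$; $=\lambda+t_r-z_a-w(i_r,I)y$ if $a=i_r$; $=t_r-z_a$ if $a>i_r$. Let $W_I(\lambda,\boldsymbol t,\boldsymbol z,y)=y^k\sum_{\pi\in S_k}\Big(\prod_{r=1}^k\prod_{a=1}^n l_I(r,a)\prod_{1\le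 a<b\le k}\frac{t_a-t_b+y}{t_a-t_b}\Big)\Big|_{t_i\to t_{\pi(i)}}$ and $W_{\sigma,I}(\lambda,\boldsymbol t,\boldsymbol z,y)=W_{\sigma^{-1}(I)}(\lambda,\boldsymbol t,z_{\sigma(1)},\dots,z_{\sigma(n)},y)$. Let $e_k=\prod_{a,b=1}^k(t_a-t_b+y)$, $C^{(r)}_{\sigma,I}=\prod_{i\in I}\big(\lambda-(w(\sigma^{-1}(i),\sigma^{-1}(I))+r)y\big)$, $\tilde W^+_{\sigma,I}=W_{\sigma,I}/(C^{(0)}_{\sigma,I}C^{(1)}_{\sigma,I}e_k)$. **Stable envelope maps.** $\kappa_{\sigma,I}\in H^*_T(T^*\mathrm{Gr}_k(\mathbb C^n))\otimes\mathcal L_{\lambda,\boldsymbol z,y}$ is the class with $\kappa_{\sigma,I}|_{x_J}=\tilde W^+_{\sigma,I}(\lambda,\boldsymbol z_J,\boldsymbol z,y)$ for all $J\in\mathcal I_k$, where $\boldsymbol z_J$ means that $t_1,\dots,t_k$ are replaced by $\{z_j\}_{j\in J}$. $\mathbb C^2$ has basis $v_1,v_2$; $v_I=v_{i_1}\otimes\dots\otimes v_{i_n}$ with $i_j=1$ if $j\in I$, $i_j=2$ otherwise. $\mathrm{Stab}_\sigma:(\mathbb C^2)^{\otimes n}\otimes\mathcal L_{\lambda,\boldsymbol z,y}\to H^*_T(\mathcal X_n)\otimes\mathcal L_{\lambda,\boldsymbol z,y}$ is the $\mathcal L_{\lambda,\boldsymbol z,y}$-linear isomorphism $v_I\mapsto\kappa_{\sigma,I}$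 (for all $I\in\mathcal I_k$, $0\le k\le n$). **Dynamical R-matrix.** In the basis $v_1\otimes v_1,v_1\otimes v_2,v_2\otimes v_1,v_2\otimes v_2$ (columns are images of basis vectors) $$R(\lambda,z,y)=\begin{pmatrix}1&0&0&0\\0&\frac{(\lambda+y)z}{\lambda(z-y)}&-\frac{(\lambda+z)y}{\lambda(z-y)}&0\\0&-\frac{(\lambda-z)y}{\lambda(z-y)}&\frac{(\lambda-y)z}{\lambda(z-y)}&0\\0&0&0&1\end{pmatrix}.$$ $R^{(i,j)}$ (ordered pair $(i,j)$) acts on $(\mathbb C^2)^{\otimes n}$ by $R$ with its first factor being the $i$-th and its second factor the $j$-th tensor factor. $h^{(j)}$ acts on the $j$-th factor by $v_1\mapsto v_1$, $v_2\mapsto-v_2$; the argument $\lambda-y\sum h^{(j)}$ means that on a basis vector on which $\sum h^{(j)}$ acts as $\mu$ one substitutes $\lambda-y\mu$. *)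

theory Defs
  imports
    "HOL-Algebra.QuotRing"
    "HOL-Algebra.Module"
    "HOL-Algebra.Generated_Groups"
    "HOL-Algebra.Free_Abelian_Groups"
    "HOL-Library.Poly_Mapping"
    "HOL-Computational_Algebra.Polynomial"
    "HOL-Computational_Algebra.Fraction_Field"
    "HOL-Combinatorics.Permutations"
begin

section \<open>Polynomials and rational functions\<close>

text \<open>
  The variables \<open>y\<close>, \<open>\<lambda>\<close>, \<open>z\<^sub>i\<close>, \<open>\<gamma>\<^sub>1\<^sub>,\<^sub>i\<close>, \<open>\<gamma>\<^sub>2\<^sub>,\<^sub>i\<close>.  The linear order on them has no mathematical
  meaning; it is there because the library proves that polynomials form an integral domain only
  for linearly ordered monomials.
\<close>

datatype var = Y | Lam | Z nat | Gam1 nat | Gam2 nat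

fun var_code :: "var \<Rightarrow> nat" where
  "var_code Y = 0"
| "var_code Lam = 1"
| "var_code (Z i) = 3 * i + 2"
| "var_code (Gam1 i) = 3 * i + 3"
| "var_code (Gam2 i) = 3 * i + 4"

lemma var_code_inject: "var_code v = var_code w \<Longrightarrow> v = w"
  by (cases v; cases w; simp; presburger)

instantiation var :: linorder
begin

definition less_eq_var :: "var \<Rightarrow> var \<Rightarrow> bool" where "v \<le> w \<longleftrightarrow> var_code v \<le> var_code w"
definition less_var :: "var \<Rightarrow> var \<Rightarrow> bool" where "v < w \<longleftrightarrow> var_code v < var_code w"

instance
  by standard (auto simp: less_eq_var_def less_var_def intro: var_code_inject)

end

type_synonym cpoly = "(var \<Rightarrow>\<^sub>0 nat) \<Rightarrow>\<^sub>0 complex"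
type_synonym ratfun = "cpoly fract"

definition pconst :: "complex \<Rightarrow> cpoly" where
  "pconst c = Poly_Mapping.single 0 c"

definition pvar :: "var \<Rightarrow> cpoly" where
  "pvar x = Poly_Mapping.single (Poly_Mapping.single x 1) 1"

text \<open>The polynomials in the variables from \<open>S\<close>, i.e. \<open>\<complex>[S]\<close>.\<close>

definition polys_in :: "var set \<Rightarrow> cpoly set" where
  "polys_in S = {p. \<forall>m \<in> Poly_Mapping.keys p. Poly_Mapping.keys m \<subseteq> S}"

text \<open>Substitution of \<open>g x\<close> for every variable \<open>x\<close>, where \<open>c\<close> is the structure map \<open>\<complex> \<rightarrow> 'r\<close>.\<close>

definition psubst :: "(complex \<Rightarrow> 'r) \<Rightarrow> (var \<Rightarrow> 'r) \<Rightarrow> cpoly \<Rightarrow> 'r :: comm_ring_1" where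
  "psubst c g p =
     (\<Sum>m \<in> Poly_Mapping.keys p. c (Poly_Mapping.lookup p m) *
        (\<Prod>x \<in> Poly_Mapping.keys m. g x ^ Poly_Mapping.lookup m x))"

definition rf :: "cpoly \<Rightarrow> ratfun" where
  "rf p = Fract p 1"

definition rf_y :: ratfun where "rf_y = rf (pvar Y)"
definition rf_lam :: ratfun where "rf_lam = rf (pvar Lam)"
definition rf_z :: "nat \<Rightarrow> ratfun" where "rf_z i = rf (pvar (Z i))"


section \<open>The coefficient rings\<close>

definition zy_vars :: "nat \<Rightarrow> var set" where
  "zy_vars n = Z ` {1..n} \<union> {Y}"

definition Czy :: "nat \<Rightarrow> cpoly ring" where
  "Czy n = \<lparr>carrier = polys_in (zy_vars n), monoid.mult = (*), one = 1, ring.zero = 0, add = (+)\<rparr>"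

definition Lzy :: "nat \<Rightarrow> ratfun set" where
  "Lzy n = {rf f / ((\<Prod>(i, j) \<in> {(i, j). i \<in> {1..n} \<and> j \<in> {1..n} \<and> i \<noteq> j}.
                        (rf_z i - rf_z j) ^ k i j) *
                    (\<Prod>(i, j) \<in> {1..n} \<times> {1..n}. (rf_z i - rf_z j - rf_y) ^ l i j))
            | f (k :: nat \<Rightarrow> nat \<Rightarrow> nat) (l :: nat \<Rightarrow> nat \<Rightarrow> nat). f \<in> polys_in (zy_vars n)}"

definition Lly :: "ratfun set" where
  "Lly = {rf f / (\<Prod>l\<leftarrow>ls. rf_lam + of_int l * rf_y)
          | f (ls :: int list). f \<in> polys_in {Lam, Y}}"

text \<open>
  \<open>\<L>\<^sub>\<lambda>\<^sub>,\<^sub>z\<^sub>,\<^sub>y = \<L>\<^sub>\<lambda>\<^sub>,\<^sub>y \<otimes> \<L>\<^sub>z\<^sub>,\<^sub>y\<close> over \<open>\<complex>[y]\<close> is realised inside the field of rational functions: the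
  elements are the finite sums of products.  Both factors are localisations of polynomial rings
  over \<open>\<complex>[y]\<close> at non-zero polynomials, so the multiplication map from the tensor product to the
  field is injective.
\<close>

definition Llzy :: "nat \<Rightarrow> ratfun set" where
  "Llzy n = {(\<Sum>i<m. f i * g i) | (m :: nat) f g. (\<forall>i<m. f i \<in> Lly \<and> g i \<in> Lzy n)}"

definition Lring :: "nat \<Rightarrow> (cpoly, ratfun) module" where
  "Lring n = \<lparr>carrier = Llzy n, monoid.mult = (*), one = 1, ring.zero = 0, add = (+),
              module.smult = (\<lambda>f l. rf f * l)\<rparr>"


section \<open>Extension of scalars\<close>

definition tensor_rels ::
  "('r, 'x) ring_scheme \<Rightarrow> ('r, 'm, 'y) module_scheme \<Rightarrow> ('r, 'b, 'w) module_scheme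
     \<Rightarrow> ('m \<times> 'b \<Rightarrow>\<^sub>0 int) set" where
  "tensor_rels R M B =
     {frag_of (m \<oplus>\<^bsub>M\<^esub> m', b) - frag_of (m, b) - frag_of (m', b)
        | m m' b. m \<in> carrier M \<and> m' \<in> carrier M \<and> b \<in> carrier B} \<union>
     {frag_of (m, b \<oplus>\<^bsub>B\<^esub> b') - frag_of (m, b) - frag_of (m, b')
        | m b b'. m \<in> carrier M \<and> b \<in> carrier B \<and> b' \<in> carrier B} \<union>
     {frag_of (r \<odot>\<^bsub>M\<^esub> m, b) - frag_of (m, r \<odot>\<^bsub>B\<^esub> b)
        | r m b. r \<in> carrier R \<and> m \<in> carrier M \<and> b \<in> carrier B}"

text \<open>
  \<open>M \<otimes>\<^sub>R B\<close> as a \<open>B\<close>-module, for an \<open>R\<close>-module \<open>M\<close> and a commutative \<open>R\<close>-algebra \<open>B\<close>: the free abelian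
  group on \<open>M \<times> B\<close> modulo the subgroup \<open>N\<close> generated by the bilinearity relations, with
  \<open>b (m \<otimes> b') = m \<otimes> b b'\<close>.  Only the module structure is used, so the multiplicative fields of
  the record are left unspecified.
\<close>

definition ext_scalars ::
  "('r, 'x) ring_scheme \<Rightarrow> ('r, 'm, 'y) module_scheme \<Rightarrow> ('r, 'b, 'w) module_scheme
     \<Rightarrow> ('b, ('m \<times> 'b \<Rightarrow>\<^sub>0 int) set) module" where
  "ext_scalars R M B =
     (let F = free_Abelian_group (carrier M \<times> carrier B);
          N = generate F (tensor_rels R M B);
          Q = F Mod N
      in \<lparr>carrier = carrier Q, monoid.mult = undefined, one = undefined,
          ring.zero = \<one>\<^bsub>Q\<^esub>, add = monoid.mult Q,
          module.smult = (\<lambda>b X. \<Union>c\<in>X. N #>\<^bsub>F\<^esub> frag_extend (\<lambda>(m, b'). frag_of (m, b \<otimes>\<^bsub>B\<^esub> b')) c)\<rparr>)"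


section \<open>Equivariant cohomology of the cotangent bundles of Grassmannians\<close>

fun rename_gam :: "(nat \<Rightarrow> nat) \<Rightarrow> (nat \<Rightarrow> nat) \<Rightarrow> var \<Rightarrow> var" where
  "rename_gam \<pi>1 \<pi>2 (Gam1 i) = Gam1 (\<pi>1 i)"
| "rename_gam \<pi>1 \<pi>2 (Gam2 i) = Gam2 (\<pi>2 i)"
| "rename_gam \<pi>1 \<pi>2 v = v"

definition gam_inv_ring :: "nat \<Rightarrow> nat \<Rightarrow> cpoly ring" where
  "gam_inv_ring n k =
     \<lparr>carrier = {p \<in> polys_in (Gam1 ` {1..k} \<union> Gam2 ` {1..n-k} \<union> zy_vars n).
                  \<forall>\<pi>1 \<pi>2. \<pi>1 permutes {1..k} \<longrightarrow> \<pi>2 permutes {1..n-k} \<longrightarrow>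
                    psubst pconst (pvar \<circ> rename_gam \<pi>1 \<pi>2) p = p},
      monoid.mult = (*), one = 1, ring.zero = 0, add = (+)\<rparr>"

definition coh_rel_poly :: "nat \<Rightarrow> nat \<Rightarrow> cpoly poly" where
  "coh_rel_poly n k =
     (\<Prod>i\<in>{1..k}. [:- pvar (Gam1 i), 1:]) * (\<Prod>i\<in>{1..n-k}. [:- pvar (Gam2 i), 1:])
     - (\<Prod>i\<in>{1..n}. [:- pvar (Z i), 1:])"

definition coh_ideal :: "nat \<Rightarrow> nat \<Rightarrow> cpoly set" where
  "coh_ideal n k = genideal (gam_inv_ring n k) (range (poly.coeff (coh_rel_poly n k)))"

text \<open>\<open>H\<^sub>T(T\<^sup>*Gr\<^sub>k(\<complex>\<^sup>n))\<close> with its \<open>\<complex>[z,y]\<close>-module structure.\<close>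

definition HT :: "nat \<Rightarrow> nat \<Rightarrow> (cpoly, cpoly set) module" where
  "HT n k =
     (let A = gam_inv_ring n k; I = coh_ideal n k; Q = A Quot I
      in \<lparr>carrier = carrier Q, monoid.mult = monoid.mult Q, one = \<one>\<^bsub>Q\<^esub>, ring.zero = \<zero>\<^bsub>Q\<^esub>,
          add = add Q, module.smult = (\<lambda>f X. (I +>\<^bsub>A\<^esub> f) \<otimes>\<^bsub>Q\<^esub> X)\<rparr>)"

type_synonym loc_class = "(cpoly set \<times> ratfun \<Rightarrow>\<^sub>0 int) set"

definition HTL :: "nat \<Rightarrow> nat \<Rightarrow> (ratfun, loc_class) module" where
  "HTL n k = ext_scalars (Czy n) (HT n k) (Lring n)"

text \<open>\<open>kth I r\<close> is the \<open>r\<close>-th smallest element of \<open>I\<close>, counting from 1.\<close>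

definition kth :: "nat set \<Rightarrow> nat \<Rightarrow> nat" where
  "kth I r = sorted_list_of_set I ! (r - 1)"

definition ksubsets :: "nat \<Rightarrow> nat \<Rightarrow> nat set set" where
  "ksubsets n k = {I. I \<subseteq> {1..n} \<and> card I = k}"

fun fixpt_val :: "nat \<Rightarrow> nat set \<Rightarrow> var \<Rightarrow> ratfun" where
  "fixpt_val n J (Gam1 i) = rf_z (kth J i)"
| "fixpt_val n J (Gam2 i) = rf_z (kth ({1..n} - J) i)"
| "fixpt_val n J v = rf (pvar v)"

text \<open>
  Restriction to the fixed point \<open>x\<^sub>J\<close>, on \<open>H\<^sub>T\<close> and then on \<open>H\<^sub>T \<otimes> \<L>\<close>, where it sends \<open>h \<otimes> l\<close> to \<open>h|\<^sub>J l\<close>.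
  Classes are cosets on which the substituted value is constant.
\<close>

definition restr_HT :: "nat \<Rightarrow> nat set \<Rightarrow> cpoly set \<Rightarrow> ratfun" where
  "restr_HT n J h = the_elem (psubst (rf \<circ> pconst) (fixpt_val n J) ` h)"

definition restr_HTL :: "nat \<Rightarrow> nat set \<Rightarrow> loc_class \<Rightarrow> ratfun" where
  "restr_HTL n J X =
     the_elem ((\<lambda>c. \<Sum>(h, l) \<in> Poly_Mapping.keys c.
                  of_int (Poly_Mapping.lookup c (h, l)) * (restr_HT n J h * l)) ` X)"


section \<open>Weight functions\<close>

definition wt_w :: "nat \<Rightarrow> nat \<Rightarrow> nat set \<Rightarrow> int" where
  "wt_w n i I = int (card {j \<in> {1..n}. j > i \<and> j \<in> I}) - int (card {j \<in> {1..n}. j > i \<and> j \<notin> I})"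

definition wt_l ::
  "nat \<Rightarrow> nat set \<Rightarrow> 'f::field \<Rightarrow> (nat \<Rightarrow> 'f) \<Rightarrow> (nat \<Rightarrow> 'f) \<Rightarrow> 'f \<Rightarrow> nat \<Rightarrow> nat \<Rightarrow> 'f" where
  "wt_l n I lam t z y r a =
     (if a < kth I r then t r - z a + y
      else if a = kth I r then lam + t r - z a - of_int (wt_w n (kth I r) I) * y
      else t r - z a)"

text \<open>
  \<open>W\<^sub>I\<close> is used at pairwise distinct values of \<open>t\<^sub>1, \<dots>, t\<^sub>k\<close>, so it may be evaluated term by term.
\<close>

definition wt_W ::
  "nat \<Rightarrow> nat set \<Rightarrow> 'f::field \<Rightarrow> (nat \<Rightarrow> 'f) \<Rightarrow> (nat \<Rightarrow> 'f) \<Rightarrow> 'f \<Rightarrow> 'f" where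
  "wt_W n I lam t z y =
     (let k = card I;
          summand = (\<lambda>t. (\<Prod>r\<in>{1..k}. \<Prod>a\<in>{1..n}. wt_l n I lam t z y r a) *
                      (\<Prod>(a, b) \<in> {(a, b). 1 \<le> a \<and> a < b \<and> b \<le> k}. (t a - t b + y) / (t a - t b)))
      in y ^ k * (\<Sum>\<pi> \<in> {\<pi>. \<pi> permutes {1..k}}. summand (t \<circ> \<pi>)))"

definition wt_Wsig ::
  "nat \<Rightarrow> (nat \<Rightarrow> nat) \<Rightarrow> nat set \<Rightarrow> 'f::field \<Rightarrow> (nat \<Rightarrow> 'f) \<Rightarrow> (nat \<Rightarrow> 'f) \<Rightarrow> 'f \<Rightarrow> 'f" where
  "wt_Wsig n \<sigma> I lam t z y = wt_W n (inv_into UNIV \<sigma> ` I) lam t (z \<circ> \<sigma>) y"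

definition wt_e :: "nat \<Rightarrow> (nat \<Rightarrow> 'f::field) \<Rightarrow> 'f \<Rightarrow> 'f" where
  "wt_e k t y = (\<Prod>a\<in>{1..k}. \<Prod>b\<in>{1..k}. t a - t b + y)"

definition wt_C :: "nat \<Rightarrow> int \<Rightarrow> (nat \<Rightarrow> nat) \<Rightarrow> nat set \<Rightarrow> 'f::field \<Rightarrow> 'f \<Rightarrow> 'f" where
  "wt_C n r \<sigma> I lam y = (\<Prod>i\<in>I. lam - of_int (wt_w n (inv_into UNIV \<sigma> i) (inv_into UNIV \<sigma> ` I) + r) * y)"

definition wt_Wtilde ::
  "nat \<Rightarrow> (nat \<Rightarrow> nat) \<Rightarrow> nat set \<Rightarrow> 'f::field \<Rightarrow> (nat \<Rightarrow> 'f) \<Rightarrow> (nat \<Rightarrow> 'f) \<Rightarrow> 'f \<Rightarrow> 'f" where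
  "wt_Wtilde n \<sigma> I lam t z y =
     wt_Wsig n \<sigma> I lam t z y / (wt_C n 0 \<sigma> I lam y * wt_C n 1 \<sigma> I lam y * wt_e (card I) t y)"


section \<open>Stable envelope maps\<close>

definition kappa :: "nat \<Rightarrow> (nat \<Rightarrow> nat) \<Rightarrow> nat set \<Rightarrow> loc_class" where
  "kappa n \<sigma> I = (THE x. x \<in> carrier (HTL n (card I)) \<and>
     (\<forall>J \<in> ksubsets n (card I).
        restr_HTL n J x = wt_Wtilde n \<sigma> I rf_lam (\<lambda>r. rf_z (kth J r)) rf_z rf_y))"

text \<open>
  An element \<open>\<Sum>\<^sub>I f\<^sub>I v\<^sub>I\<close> of \<open>(\<complex>\<^sup>2)\<^sup>\<otimes>\<^sup>n \<otimes> \<L>\<close> is represented by its coordinate function \<open>f\<close>, extended by 0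
  outside the subsets of \<open>[n]\<close>; an element of \<open>H\<^sub>T(\<X>\<^sub>n) \<otimes> \<L> = \<Oplus>\<^sub>k H\<^sub>T(T\<^sup>*Gr\<^sub>k(\<complex>\<^sup>n)) \<otimes> \<L>\<close> by the family of
  its components.
\<close>

definition tensor_space :: "nat \<Rightarrow> (nat set \<Rightarrow> ratfun) set" where
  "tensor_space n = {f. (\<forall>I. f I \<in> Llzy n) \<and> (\<forall>I. \<not> I \<subseteq> {1..n} \<longrightarrow> f I = 0)}"

definition Stab :: "nat \<Rightarrow> (nat \<Rightarrow> nat) \<Rightarrow> (nat set \<Rightarrow> ratfun) \<Rightarrow> (nat \<Rightarrow> loc_class)" where
  "Stab n \<sigma> f =
     (\<lambda>k\<in>{0..n}. finsum (HTL n k) (\<lambda>I. f I \<odot>\<^bsub>HTL n k\<^esub> kappa n \<sigma> I) (ksubsets n k))"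

definition geom_R ::
  "nat \<Rightarrow> (nat \<Rightarrow> nat) \<Rightarrow> (nat \<Rightarrow> nat) \<Rightarrow> (nat set \<Rightarrow> ratfun) \<Rightarrow> (nat set \<Rightarrow> ratfun)" where
  "geom_R n \<sigma>' \<sigma> = inv_into (tensor_space n) (Stab n \<sigma>') \<circ> Stab n \<sigma>"


section \<open>The dynamical R-matrix\<close>

definition Rmat :: "'f::field \<Rightarrow> 'f \<Rightarrow> 'f \<Rightarrow> 'f list list" where
  "Rmat lam z y =
     [[1, 0, 0, 0],
      [0, (lam + y) * z / (lam * (z - y)), - ((lam + z) * y / (lam * (z - y))), 0],
      [0, - ((lam - z) * y / (lam * (z - y))), (lam - y) * z / (lam * (z - y)), 0],
      [0, 0, 0, 1]]"

text \<open>
  The position (from 0) of the \<open>i\<close>-th tensor factor times the \<open>j\<close>-th tensor factor of \<open>v\<^sub>I\<close> in the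
  basis \<open>v\<^sub>1 \<otimes> v\<^sub>1, v\<^sub>1 \<otimes> v\<^sub>2, v\<^sub>2 \<otimes> v\<^sub>1, v\<^sub>2 \<otimes> v\<^sub>2\<close>.
\<close>

definition basis_pos :: "nat \<Rightarrow> nat \<Rightarrow> nat set \<Rightarrow> nat" where
  "basis_pos i j I = 2 * (if i \<in> I then 0 else 1) + (if j \<in> I then 0 else 1)"

definition h_eigenval :: "nat \<Rightarrow> nat set \<Rightarrow> int" where
  "h_eigenval j I = (if j \<in> I then 1 else -1)"

text \<open>
  \<open>R\<^sup>(\<^sup>i\<^sup>,\<^sup>j\<^sup>)(\<lambda> - y \<mu>, \<zeta>, y)\<close> on coordinate functions, where \<open>\<mu> I'\<close> is the eigenvalue on \<open>v\<^bsub>I'\<^esub>\<close> of the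
  diagonal operator substituted for \<open>\<mu>\<close>.  The vectors \<open>v\<^bsub>I'\<^esub>\<close> whose image involves \<open>v\<^sub>I\<close> agree with
  it in all tensor factors other than \<open>i\<close> and \<open>j\<close>.
\<close>

definition dyn_R ::
  "nat \<Rightarrow> nat \<Rightarrow> nat \<Rightarrow> (nat set \<Rightarrow> int) \<Rightarrow> ratfun \<Rightarrow> (nat set \<Rightarrow> ratfun) \<Rightarrow> (nat set \<Rightarrow> ratfun)" where
  "dyn_R n i j \<mu> \<zeta> f =
     (\<lambda>I. \<Sum>I' \<in> {I'. I' \<subseteq> {1..n} \<and> I' - {i, j} = I - {i, j}}.
        Rmat (rf_lam - rf_y * of_int (\<mu> I')) \<zeta> rf_y ! basis_pos i j I ! basis_pos i j I' * f I')"

end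

theory Submission
  imports Defs
begin

text \<open>
  Restriction to the fixed points embeds the localised cohomology into the functions on the
  \<open>k\<close>-subsets, because the relation \<open>\<Prod>(u - \<gamma>\<^sub>i) = \<Prod>(u - z\<^sub>i)\<close> makes the \<open>\<gamma>\<close>'s a permutation of the \<open>z\<close>'s as
  soon as the differences \<open>z\<^sub>i - z\<^sub>j\<close> are invertible.  Hence stable envelopes may be compared fixed point
  by fixed point, where they are values of weight functions.  Exchanging \<open>z\<^bsub>\<sigma>(a)\<^esub>\<close> and \<open>z\<^bsub>\<sigma>(a+1)\<^esub>\<close> in a
  weight function affects at most two of its rows; if exactly one of \<open>a, a + 1\<close> belongs to the index
  set, this gives, summand by summand, a linear relation between three quadratic polynomials in one
  variable whose coefficients are the entries of the R-matrix, and otherwise the weight function is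
  invariant.  Stable envelopes are linearly independent because their matrix of restrictions is
  triangular with respect to the sum of the elements of the index set.
\<close>

section \<open>Polynomial substitution\<close>

text \<open>Two obstacles shape the cohomological part. Identifying the \<gamma>'s with a
  permutation of the z's means giving them values one at a time, which destroys the symmetry,
  whereas the ideal of relations lives in the ring of invariants. So the argument runs in the ideal
  that the relations generate among all polynomials, and averaging over S_k x S_(n-k) leads back. It
  yields membership only up to a power of the discriminant; in the tensor product this power moves
  to the second factor, where it is a unit. The parameter of the R-matrix is \<Lambda> = \<lambda> -
  w y with w the weight of position a + 1. This weight counts the positions to the right of a + 1
  with signs, which is the origin of the dynamical shift. The products \<open>wt_C\<close> convert
  the coefficients of the relation between unnormalised weight functions into the entries of R.
  Since \<open>kappa\<close> is a definite description and \<open>geom_R\<close> a chosen inverse,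
  the theorem amounts to existence and uniqueness of classes with given restrictions, injectivity of
  Stab for the new permutation, and the equality of its value at R v with Stab of v for the old
  one.\<close>

lemma poly_mapping_expand:
  "(\<Sum>m\<in>Poly_Mapping.keys p. Poly_Mapping.single m (Poly_Mapping.lookup p m)) = p"
proof (rule poly_mapping_eqI)
  fix k
  have "Poly_Mapping.lookup (\<Sum>m\<in>Poly_Mapping.keys p. Poly_Mapping.single m (Poly_Mapping.lookup p m)) k
      = (\<Sum>m\<in>Poly_Mapping.keys p. if m = k then Poly_Mapping.lookup p m else 0)"
    by (simp add: lookup_sum lookup_single when_def)
  also have "\<dots> = Poly_Mapping.lookup p k"
    by (simp add: sum.delta' in_keys_iff)
  finally show "Poly_Mapping.lookup (\<Sum>m\<in>Poly_Mapping.keys p.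
      Poly_Mapping.single m (Poly_Mapping.lookup p m)) k = Poly_Mapping.lookup p k" .
qed

lemma pvar_power: "pvar x ^ k = Poly_Mapping.single (Poly_Mapping.single x k) 1"
  by (induction k) (auto simp: pvar_def mult_single simp flip: single_add)

lemma single_sum_eq_prod:
  "finite A \<Longrightarrow> Poly_Mapping.single (\<Sum>x\<in>A. f x) (1::complex) = (\<Prod>x\<in>A. Poly_Mapping.single (f x) 1)"
proof (induction A rule: finite_induct)
  case (insert x A)
  have "Poly_Mapping.single (f x + sum f A) (1::complex)
      = Poly_Mapping.single (f x) 1 * Poly_Mapping.single (sum f A) 1"
    by (simp add: mult_single)
  with insert show ?case by simp
qed simp

lemma single_eq_prod_pvar:
  "Poly_Mapping.single m c = pconst c * (\<Prod>x\<in>Poly_Mapping.keys m. pvar x ^ Poly_Mapping.lookup m x)"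
proof -
  have "Poly_Mapping.single m (1::complex)
      = (\<Prod>x\<in>Poly_Mapping.keys m. pvar x ^ Poly_Mapping.lookup m x)"
    by (subst (1) poly_mapping_expand [of m, symmetric]) (simp add: single_sum_eq_prod pvar_power)
  moreover have "Poly_Mapping.single m c = pconst c * Poly_Mapping.single m 1"
    by (simp add: pconst_def mult_single)
  ultimately show ?thesis by simp
qed

text \<open>Expansion into monomials shows that \<complex>[S] is generated as an algebra by the
  constants and the variables from S. Statements about substitutions can therefore be checked on
  generators instead of coefficients.\<close>

lemma polys_in_induct [consumes 1, case_names const var add mult]:
  assumes "p \<in> polys_in S"
    and const: "\<And>c. P (pconst c)"
    and var: "\<And>x. x \<in> S \<Longrightarrow> P (pvar x)"
    and add: "\<And>p q. P p \<Longrightarrow> P q \<Longrightarrow> P (p + q)"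
    and mult: "\<And>p q. P p \<Longrightarrow> P q \<Longrightarrow> P (p * q)"
  shows "P p"
proof -
  have one: "P 1" and zero: "P 0"
    using const [of 1] const [of 0] by (simp_all add: pconst_def)
  have pow: "P (q ^ k)" if "P q" for q k
    using that by (induction k) (auto intro: mult one)
  have prod: "P (\<Prod>x\<in>A. f x)" if "\<And>x. x \<in> A \<Longrightarrow> P (f x)" for A and f :: "var \<Rightarrow> cpoly"
    using that by (induction A rule: infinite_finite_induct) (auto intro: mult one)
  have sum: "P (\<Sum>x\<in>A. f x)" if "\<And>x. x \<in> A \<Longrightarrow> P (f x)" for A and f :: "(var \<Rightarrow>\<^sub>0 nat) \<Rightarrow> cpoly"
    using that by (induction A rule: infinite_finite_induct) (auto intro: add zero)
  have "P (\<Sum>m\<in>Poly_Mapping.keys p. Poly_Mapping.single m (Poly_Mapping.lookup p m))"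
    using assms(1)
    by (auto simp: single_eq_prod_pvar polys_in_def intro!: sum mult const prod pow var)
  then show ?thesis by (simp add: poly_mapping_expand)
qed

lemma polys_in_UNIV [simp]: "p \<in> polys_in UNIV"
  by (simp add: polys_in_def)

lemma pconst_in_polys [simp]: "pconst c \<in> polys_in S"
  by (simp add: polys_in_def pconst_def)

lemma pvar_in_polys [simp]: "x \<in> S \<Longrightarrow> pvar x \<in> polys_in S"
  by (simp add: polys_in_def pvar_def)

lemma zero_in_polys [simp]: "0 \<in> polys_in S" and one_in_polys [simp]: "1 \<in> polys_in S"
  by (simp_all add: polys_in_def)

lemma add_in_polys: "p \<in> polys_in S \<Longrightarrow> q \<in> polys_in S \<Longrightarrow> p + q \<in> polys_in S"
  unfolding polys_in_def using keys_add [of p q] by blast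

lemma uminus_in_polys: "p \<in> polys_in S \<Longrightarrow> - p \<in> polys_in S"
  by (simp add: polys_in_def in_keys_iff)

lemma diff_in_polys: "p \<in> polys_in S \<Longrightarrow> q \<in> polys_in S \<Longrightarrow> p - q \<in> polys_in S"
  using add_in_polys [of p S "- q"] by (simp add: uminus_in_polys)

lemma mult_in_polys: "p \<in> polys_in S \<Longrightarrow> q \<in> polys_in S \<Longrightarrow> p * q \<in> polys_in S"
  unfolding polys_in_def
proof clarsimp
  fix m x
  assume *: "\<forall>m\<in>Poly_Mapping.keys p. Poly_Mapping.keys m \<subseteq> S"
    "\<forall>m\<in>Poly_Mapping.keys q. Poly_Mapping.keys m \<subseteq> S"
    and m: "m \<in> Poly_Mapping.keys (p * q)" and x: "x \<in> Poly_Mapping.keys m"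
  obtain a b where "a \<in> Poly_Mapping.keys p" "b \<in> Poly_Mapping.keys q" "m = a + b"
    using m keys_mult [of p q] by blast
  then show "x \<in> S" using * x keys_add [of a b] by blast
qed

lemma prod_in_polys: "(\<And>i. i \<in> A \<Longrightarrow> f i \<in> polys_in S) \<Longrightarrow> prod f A \<in> polys_in S"
  by (induction A rule: infinite_finite_induct) (auto intro: mult_in_polys)

lemma sum_in_polys: "(\<And>i. i \<in> A \<Longrightarrow> f i \<in> polys_in S) \<Longrightarrow> sum f A \<in> polys_in S"
  by (induction A rule: infinite_finite_induct) (auto intro: add_in_polys)

lemma power_in_polys: "p \<in> polys_in S \<Longrightarrow> p ^ k \<in> polys_in S"
  by (induction k) (auto intro: mult_in_polys)

lemma polys_in_mono: "p \<in> polys_in S \<Longrightarrow> S \<subseteq> T \<Longrightarrow> p \<in> polys_in T"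
  unfolding polys_in_def by blast

lemmas polys_in_intros = add_in_polys uminus_in_polys diff_in_polys mult_in_polys prod_in_polys
  sum_in_polys power_in_polys

text \<open>\<open>psubst\<close> accepts any function as structure map; only for a ring
  homomorphism is it an evaluation homomorphism. The instances below are polynomials
  (\<open>pconst\<close>), rational functions (\<open>rf\<close> after \<open>pconst\<close>) and
  numbers (\<open>id\<close>).\<close>

locale complex_algebra =
  fixes c :: "complex \<Rightarrow> 'r :: comm_ring_1"
  assumes c_add: "c (a + b) = c a + c b"
    and c_mult: "c (a * b) = c a * c b"
    and c_one: "c 1 = 1"
begin

lemma c_zero [simp]: "c 0 = 0"
  using c_add [of 0 0] by simp

definition mono_val :: "(var \<Rightarrow> 'r) \<Rightarrow> (var \<Rightarrow>\<^sub>0 nat) \<Rightarrow> 'r" where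
  "mono_val g m = (\<Prod>x\<in>Poly_Mapping.keys m. g x ^ Poly_Mapping.lookup m x)"

lemma mono_val_superset:
  assumes "finite A" "Poly_Mapping.keys m \<subseteq> A"
  shows "mono_val g m = (\<Prod>x\<in>A. g x ^ Poly_Mapping.lookup m x)"
  unfolding mono_val_def using assms
  by (intro prod.mono_neutral_left) (auto simp: in_keys_iff)

lemma mono_val_add: "mono_val g (m + m') = mono_val g m * mono_val g m'"
proof -
  let ?A = "Poly_Mapping.keys m \<union> Poly_Mapping.keys m'"
  have "mono_val g (m + m') = (\<Prod>x\<in>?A. g x ^ Poly_Mapping.lookup (m + m') x)"
    using keys_add [of m m'] by (intro mono_val_superset) auto
  also have "\<dots> = mono_val g m * mono_val g m'"
    by (subst (1 2) mono_val_superset [of ?A])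
      (auto simp: lookup_add power_add prod.distrib)
  finally show ?thesis .
qed

lemma psubst_superset:
  assumes "finite A" "Poly_Mapping.keys p \<subseteq> A"
  shows "psubst c g p = (\<Sum>m\<in>A. c (Poly_Mapping.lookup p m) * mono_val g m)"
  unfolding psubst_def mono_val_def [symmetric] using assms
  by (intro sum.mono_neutral_left) (auto simp: in_keys_iff)

lemma psubst_add [simp]: "psubst c g (p + q) = psubst c g p + psubst c g q"
proof -
  let ?A = "Poly_Mapping.keys p \<union> Poly_Mapping.keys q"
  have "psubst c g (p + q) = (\<Sum>m\<in>?A. c (Poly_Mapping.lookup (p + q) m) * mono_val g m)"
    using keys_add [of p q] by (intro psubst_superset) auto
  also have "\<dots> = psubst c g p + psubst c g q"
    by (subst (1 2) psubst_superset [of ?A])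
      (auto simp: lookup_add c_add ring_distribs sum.distrib)
  finally show ?thesis .
qed

lemma psubst_zero [simp]: "psubst c g 0 = 0"
  by (simp add: psubst_def)

lemma psubst_uminus [simp]: "psubst c g (- p) = - psubst c g p"
  using psubst_add [of g p "- p"] by (simp add: eq_neg_iff_add_eq_0 add.commute del: psubst_add)

lemma psubst_diff [simp]: "psubst c g (p - q) = psubst c g p - psubst c g q"
  using psubst_add [of g p "- q"] by (simp del: psubst_add)

lemma psubst_sum [simp]: "psubst c g (sum f A) = (\<Sum>i\<in>A. psubst c g (f i))"
  by (induction A rule: infinite_finite_induct) auto

lemma psubst_single: "psubst c g (Poly_Mapping.single m a) = c a * mono_val g m"
  by (cases "a = 0") (auto simp: psubst_def mono_val_def)

lemma psubst_mult [simp]: "psubst c g (p * q) = psubst c g p * psubst c g q"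
proof -
  let ?s = Poly_Mapping.single and ?l = Poly_Mapping.lookup and ?k = Poly_Mapping.keys
  have "psubst c g (p * q)
      = psubst c g ((\<Sum>m\<in>?k p. ?s m (?l p m)) * (\<Sum>m\<in>?k q. ?s m (?l q m)))"
    by (simp only: poly_mapping_expand)
  also have "\<dots> = (\<Sum>m\<in>?k p. \<Sum>m'\<in>?k q. c (?l p m) * mono_val g m * (c (?l q m') * mono_val g m'))"
    by (simp add: sum_product psubst_single mult_single c_mult mono_val_add mult_ac)
  also have "\<dots> = psubst c g p * psubst c g q"
    by (simp add: sum_product psubst_def mono_val_def)
  finally show ?thesis .
qed

lemma psubst_pconst [simp]: "psubst c g (pconst a) = c a"
  by (simp add: pconst_def psubst_single mono_val_def)

lemma psubst_pvar [simp]: "psubst c g (pvar x) = g x"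
  by (simp add: pvar_def psubst_single mono_val_def c_one)

lemma psubst_one [simp]: "psubst c g 1 = 1"
  using psubst_pconst [of g 1] by (simp add: pconst_def c_one)

lemma psubst_prod [simp]: "psubst c g (prod f A) = (\<Prod>i\<in>A. psubst c g (f i))"
  by (induction A rule: infinite_finite_induct) auto

lemma psubst_power [simp]: "psubst c g (p ^ k) = psubst c g p ^ k"
  by (induction k) auto

lemma psubst_of_nat [simp]: "psubst c g (of_nat k) = of_nat k"
  by (induction k) auto

lemma psubst_of_int [simp]: "psubst c g (of_int k) = of_int k"
  by (cases k) auto

lemma psubst_cong:
  "p \<in> polys_in S \<Longrightarrow> (\<And>x. x \<in> S \<Longrightarrow> g x = g' x) \<Longrightarrow> psubst c g p = psubst c g' p"
  by (induction p rule: polys_in_induct) auto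

end

lemma pconst_zero: "pconst 0 = 0" and pconst_one: "pconst 1 = 1"
  by (simp_all add: pconst_def)

interpretation pconst: complex_algebra pconst
  by standard (auto simp: pconst_def single_add mult_single)

lemma psubst_psubst:
  assumes "complex_algebra c"
  shows "psubst c g (psubst pconst g' p) = psubst c (\<lambda>x. psubst c g (g' x)) p"
proof -
  interpret complex_algebra c by fact
  have "p \<in> polys_in UNIV" by simp
  then show ?thesis by (induction p rule: polys_in_induct) auto
qed

lemma psubst_pvar_id: "p \<in> polys_in S \<Longrightarrow> (\<And>x. x \<in> S \<Longrightarrow> g x = pvar x) \<Longrightarrow> psubst pconst g p = p"
  by (induction p rule: polys_in_induct) auto

lemma psubst_in_polys:
  "p \<in> polys_in S \<Longrightarrow> (\<And>x. x \<in> S \<Longrightarrow> g x \<in> polys_in T) \<Longrightarrow> psubst pconst g p \<in> polys_in T"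
  by (induction p rule: polys_in_induct) (auto intro: polys_in_intros)

section \<open>Rational functions and their nonvanishing\<close>

lemma rf_zero [simp]: "rf 0 = 0" and rf_one [simp]: "rf 1 = 1"
  by (simp_all add: rf_def fract_collapse)

lemma rf_add [simp]: "rf (p + q) = rf p + rf q"
  by (simp add: rf_def)

lemma rf_mult [simp]: "rf (p * q) = rf p * rf q"
  by (simp add: rf_def)

lemma rf_uminus [simp]: "rf (- p) = - rf p"
  by (simp add: rf_def)

lemma rf_diff [simp]: "rf (p - q) = rf p - rf q"
  by (simp add: rf_def)

lemma rf_prod [simp]: "rf (prod f A) = (\<Prod>i\<in>A. rf (f i))"
  by (induction A rule: infinite_finite_induct) auto

lemma rf_power [simp]: "rf (p ^ k) = rf p ^ k"
  by (induction k) auto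

lemma rf_of_nat [simp]: "rf (of_nat k) = of_nat k"
  by (induction k) auto

lemma rf_of_int [simp]: "rf (of_int k) = of_int k"
  by (cases k) auto

lemma rf_eq_0_iff [simp]: "rf p = 0 \<longleftrightarrow> p = 0"
  by (simp add: rf_def Zero_fract_def eq_fract)

lemma rf_eq_iff [simp]: "rf p = rf q \<longleftrightarrow> p = q"
  by (simp add: rf_def eq_fract)

interpretation rf_pconst: complex_algebra "\<lambda>a. rf (pconst a)"
  by standard (auto simp: pconst.c_add pconst.c_mult pconst_one)

lemma psubst_rf: "psubst (\<lambda>a. rf (pconst a)) (\<lambda>x. rf (g x)) p = rf (psubst pconst g p)"
proof -
  have "p \<in> polys_in UNIV" by simp
  then show ?thesis by (induction p rule: polys_in_induct) simp_all
qed

interpretation complex_id: complex_algebra "id :: complex \<Rightarrow> complex"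
  by standard auto

text \<open>One complex point with nonzero value suffices; the nonvanishing of the denominators goes
  back to such points.\<close>

lemma nonzero_by_eval: "psubst id g p \<noteq> (0::complex) \<Longrightarrow> p \<noteq> 0"
  by auto

lemma rf_z_eq_iff: "rf_z i = rf_z j \<longleftrightarrow> i = j"
proof
  assume "rf_z i = rf_z j"
  then have "psubst id (\<lambda>x. if x = Z i then 1 else 0) (pvar (Z i) - pvar (Z j)) = (0::complex)"
    unfolding rf_z_def rf_eq_iff by simp
  then show "i = j" by (auto split: if_splits)
qed auto

text \<open>At y = 1 with all other variables 0 the value is k. So i = j is allowed, and that case
  yields \<open>rf_y_nonzero\<close>.\<close>

lemma rf_z_diff_plus_y_nonzero: "rf_z i - rf_z j + of_int k * rf_y \<noteq> 0" if "k \<noteq> 0"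
proof -
  have "pvar (Z i) - pvar (Z j) + of_int k * pvar Y \<noteq> 0"
    using that by (intro nonzero_by_eval [where g = "\<lambda>x. if x = Y then 1 else 0"]) auto
  then show ?thesis by (simp add: rf_z_def rf_y_def flip: rf_diff rf_add rf_mult rf_of_int)
qed

lemma rf_lam_plus_y_nonzero: "rf_lam + of_int k * rf_y \<noteq> 0"
proof -
  have "pvar Lam + of_int k * pvar Y \<noteq> 0"
    by (intro nonzero_by_eval [where g = "\<lambda>x. if x = Lam then 1 else 0"]) auto
  then show ?thesis by (simp add: rf_lam_def rf_y_def flip: rf_add rf_mult rf_of_int)
qed

lemma rf_y_nonzero: "rf_y \<noteq> 0"
  using rf_z_diff_plus_y_nonzero [of 1 0 0] by simp

lemma rf_two_nonzero: "(2 :: ratfun) \<noteq> 0"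
proof -
  have "(2::cpoly) \<noteq> 0" by simp
  then have "rf (of_nat 2) \<noteq> 0" unfolding rf_eq_0_iff by simp
  then show ?thesis by (simp only: rf_of_nat) simp
qed

section \<open>Interpolation modulo an ideal\<close>

text \<open>Ideals of a whole ring type, for computations among all polynomials where no symmetry is
  imposed. By contrast, \<open>coh_ideal\<close> is an ideal of the carrier of invariants.\<close>

locale cideal =
  fixes I :: "'r :: comm_ring_1 set"
  assumes zero_mem: "0 \<in> I"
    and add_mem: "p \<in> I \<Longrightarrow> q \<in> I \<Longrightarrow> p + q \<in> I"
    and mult_mem: "p \<in> I \<Longrightarrow> q * p \<in> I"
begin

lemma uminus_mem: "p \<in> I \<Longrightarrow> - p \<in> I"
  using mult_mem [of p "-1"] by simp

lemma diff_mem: "p \<in> I \<Longrightarrow> q \<in> I \<Longrightarrow> p - q \<in> I"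
  using add_mem [of p "- q"] uminus_mem by simp

text \<open>Telescoping: replacing one factor at a time changes the product by a multiple of x_i -
  y_i.\<close>

lemma diff_prod_mem:
  "(\<And>i. i \<in> A \<Longrightarrow> (x i - y i) * q \<in> I) \<Longrightarrow> (prod x A - prod y A) * q \<in> I"
proof (induction A rule: infinite_finite_induct)
  case (insert i A)
  have "prod x A * ((x i - y i) * q) + y i * ((prod x A - prod y A) * q) \<in> I"
    using insert by (intro add_mem mult_mem [of "(x i - y i) * q"] mult_mem [of "(prod x A - prod y A) * q"]) auto
  then show ?case using insert by (simp add: algebra_simps)
qed (auto simp: zero_mem)

text \<open>The colon ideal (I : h). It contains 1 exactly if h lies in I, which is how
  \<open>interpolation_mem\<close> reaches its conclusion.\<close>

lemma quotient_cideal: "cideal {q. q * h \<in> I}"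
  using add_mem mult_mem [of "_ * h"] by unfold_locales (auto simp: zero_mem ring_distribs mult.assoc)

text \<open>Lagrange interpolation writes 1 as the sum over b of the products of (g - z_c) / (z_b -
  z_c) over c \<noteq> b. To avoid division, the induction subtracts two hypotheses, which trades a
  factor containing g for the cancellable difference z_b - z_c.\<close>

lemma lagrange_mem:
  assumes "finite B" "B \<noteq> {}"
    and "\<And>b c p. b \<in> B \<Longrightarrow> c \<in> B \<Longrightarrow> b \<noteq> c \<Longrightarrow> (z b - z c) * p \<in> I \<Longrightarrow> p \<in> I"
    and "\<And>b. b \<in> B \<Longrightarrow> (\<Prod>c\<in>B - {b}. g - z c) * p \<in> I"
  shows "p \<in> I"
  using assms
proof (induction B arbitrary: p rule: finite_ne_induct)
  case (singleton b)
  then show ?case by simp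
next
  case (insert b B)
  let ?P = "\<lambda>A. \<Prod>c\<in>A. g - z c"
  have split: "?P (insert b B - {c}) = (g - z b) * ?P (B - {c})" if "c \<in> B" for c
  proof -
    have "insert b B - {c} = insert b (B - {c})" using insert.hyps that by auto
    then show ?thesis using insert.hyps by simp
  qed
  show ?case
  proof (rule insert.IH)
    fix c assume c: "c \<in> B"
    have "?P (insert b B - {b}) = ?P B" using insert.hyps by simp
    also have "\<dots> = (g - z c) * ?P (B - {c})"
      using c insert.hyps by (simp add: prod.remove)
    finally have 1: "(g - z c) * ?P (B - {c}) * p \<in> I"
      using insert.prems(2) [of b] by simp
    have 2: "(g - z b) * ?P (B - {c}) * p \<in> I"
      using insert.prems(2) [of c] c by (simp add: split)
    have "(z b - z c) * (?P (B - {c}) * p) \<in> I"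
      using diff_mem [OF 1 2] by (simp add: algebra_simps)
    then show "?P (B - {c}) * p \<in> I"
      using insert.prems(1) [of b c] insert.hyps c by auto
  qed (use insert.prems in auto)
qed

text \<open>
  If \<open>\<Prod>(u - g\<^sub>i) \<equiv> \<Prod>(u - z\<^sub>i)\<close> and the differences of the \<open>z\<^sub>i\<close> are cancellable, then \<open>g\<close> behaves
  like a permutation of \<open>z\<close>: a congruence has to be checked only on the elements \<open>q\<close> that
  are killed by all \<open>g\<^sub>i - z\<^bsub>\<phi>(i)\<^esub>\<close> for some permutation \<open>\<phi>\<close>.
\<close>

lemma interpolation_mem:
  fixes g z :: "nat \<Rightarrow> 'r"
  assumes rel: "\<And>u. (\<Prod>i\<in>{1..n}. u - g i) - (\<Prod>i\<in>{1..n}. u - z i) \<in> I"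
    and cancel: "\<And>b c p. b \<in> {1..n} \<Longrightarrow> c \<in> {1..n} \<Longrightarrow> b \<noteq> c \<Longrightarrow> (z b - z c) * p \<in> I \<Longrightarrow> p \<in> I"
    and perm: "\<And>\<phi> q. bij_betw \<phi> {1..n} {1..n} \<Longrightarrow>
                 (\<And>i. i \<in> {1..n} \<Longrightarrow> (g i - z (\<phi> i)) * q \<in> I) \<Longrightarrow> q * h \<in> I"
  shows "h \<in> I"
proof -
  interpret H: cideal "{q. q * h \<in> I}" by (rule quotient_cideal)
  \<comment> \<open>The g_i with i > m already have a value, prescribed by \<phi>; the induction on
    m fixes the next one in all possible ways. While values are being chosen, \<phi> need not be
    injective.\<close>
  have step: "q * h \<in> I"
    if "m \<le> n" "\<phi> \<in> {1..n} \<rightarrow> {1..n}" "\<And>i. i \<in> {m+1..n} \<Longrightarrow> (g i - z (\<phi> i)) * q \<in> I" for m \<phi> q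
    using that
  proof (induction m arbitrary: \<phi> q)
    case 0
    show ?case
    proof (cases "\<phi> ` {1..n} = {1..n}")
      case True
      then have "bij_betw \<phi> {1..n} {1..n}"
        by (simp add: bij_betw_def finite_surj_inj)
      then show ?thesis using 0 by (intro perm) auto
    next
      \<comment> \<open>Here z_b is not attained. The relation at u = z_b shows that the product of
        the z_b - z_\<phi>(i) annihilates q modulo I; each of these differences cancels, so q itself
        lies in I.\<close>
      case False
      then obtain b where b: "b \<in> {1..n}" "b \<notin> \<phi> ` {1..n}" using 0 by blast
      have "(\<Prod>i\<in>{1..n}. z b - z i) = 0" using b by (intro prod_zero) auto
      then have "(\<Prod>i\<in>{1..n}. z b - g i) \<in> I" using rel [of "z b"] by simp
      then have 1: "q * (\<Prod>i\<in>{1..n}. z b - g i) \<in> I" by (rule mult_mem)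
      have 2: "((\<Prod>i\<in>{1..n}. z b - g i) - (\<Prod>i\<in>{1..n}. z b - z (\<phi> i))) * q \<in> I"
      proof (rule diff_prod_mem)
        fix i assume "i \<in> {1..n}"
        then have "(g i - z (\<phi> i)) * q \<in> I" using 0 by simp
        from uminus_mem [OF this] show "(z b - g i - (z b - z (\<phi> i))) * q \<in> I"
          by (simp add: algebra_simps)
      qed
      have 3: "(\<Prod>i\<in>{1..n}. z b - z (\<phi> i)) * q \<in> I"
        using diff_mem [OF 1 2] by (simp add: algebra_simps)
      have "q \<in> I" if "(\<Prod>i\<in>A. z b - z (\<phi> i)) * q \<in> I" "A \<subseteq> {1..n}" for A
        using finite_subset [OF that(2) finite_atLeastAtMost] that
      proof (induction A rule: finite_induct)
        case (insert i A)
        have "b \<noteq> \<phi> i" "\<phi> i \<in> {1..n}" using b 0 insert.prems by auto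
        with cancel [OF b(1), of "\<phi> i"] insert show ?case by (auto simp: mult.assoc)
      qed simp
      from this [OF 3] have "q \<in> I" by simp
      then show ?thesis using mult_mem [of q h] by (simp add: mult.commute)
    qed
  next
    case (Suc m)
    let ?g = "g (Suc m)"
    \<comment> \<open>Interpolation at g_(m+1) in the colon ideal. By the relation at u = g_(m+1),
      the product belonging to b, multiplied by q, is annihilated modulo I by g_(m+1) - z_b; so the
      induction hypothesis applies with \<phi> updated to b at m + 1.\<close>
    have "q \<in> {q. q * h \<in> I}"
    proof (rule H.lagrange_mem [where B = "{1..n}" and z = z and g = ?g])
      fix b assume b: "b \<in> {1..n}"
      let ?q = "(\<Prod>c\<in>{1..n} - {b}. ?g - z c) * q"
      have "(\<Prod>i\<in>{1..n}. ?g - g i) = 0" using Suc.prems(1) by (intro prod_zero) auto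
      then have "(\<Prod>i\<in>{1..n}. ?g - z i) \<in> I" using rel [of ?g] uminus_mem by fastforce
      then have "(?g - z b) * (\<Prod>c\<in>{1..n} - {b}. ?g - z c) \<in> I"
        using b by (simp add: prod.remove)
      from mult_mem [OF this, of q] have b': "(?g - z b) * ?q \<in> I" by (simp add: algebra_simps)
      show "?q \<in> {q. q * h \<in> I}" unfolding mem_Collect_eq
      proof (rule Suc.IH)
        show "\<phi>(Suc m := b) \<in> {1..n} \<rightarrow> {1..n}" using Suc.prems b by auto
        fix i assume i: "i \<in> {m + 1..n}"
        show "(g i - z ((\<phi>(Suc m := b)) i)) * ?q \<in> I"
        proof (cases "i = Suc m")
          case False
          then have "(g i - z (\<phi> i)) * q \<in> I" using i Suc.prems(3) [of i] by auto
          from mult_mem [OF this, of "\<Prod>c\<in>{1..n} - {b}. ?g - z c"]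
          show ?thesis using False by (simp add: mult.left_commute)
        qed (use b' in simp)
      qed (use Suc.prems in simp)
    next
      show "p \<in> {q. q * h \<in> I}"
        if "b \<in> {1..n}" "c \<in> {1..n}" "b \<noteq> c" "(z b - z c) * p \<in> {q. q * h \<in> I}" for b c p
        using that cancel [of b c "p * h"] by (simp add: mult.assoc)
    qed (use Suc.prems in auto)
    then show ?case by simp
  qed
  from step [of n id 1] show ?thesis by (simp add: zero_mem)
qed

end

section \<open>The ring of coefficients\<close>

lemma Lly_mult: assumes "x \<in> Lly" "y \<in> Lly" shows "x * y \<in> Lly"
proof -
  obtain f ls f' ls' where
    "x = rf f / (\<Prod>l\<leftarrow>ls. rf_lam + of_int l * rf_y)" "f \<in> polys_in {Lam, Y}"
    "y = rf f' / (\<Prod>l\<leftarrow>ls'. rf_lam + of_int l * rf_y)" "f' \<in> polys_in {Lam, Y}"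
    using assms unfolding Lly_def by blast
  then show ?thesis unfolding Lly_def
    by (intro CollectI exI [of _ "f * f'"] exI [of _ "ls @ ls'"]) (auto intro: mult_in_polys)
qed

lemma Lly_poly: "f \<in> polys_in {Lam, Y} \<Longrightarrow> rf f \<in> Lly"
  unfolding Lly_def by (intro CollectI exI [of _ f] exI [of _ "[]"]) auto

lemma Lly_inverse: "inverse (rf_lam + of_int l * rf_y) \<in> Lly"
  unfolding Lly_def by (intro CollectI exI [of _ 1] exI [of _ "[l]"]) (auto simp: divide_inverse)

lemma Lzy_mult: assumes "x \<in> Lzy n" "y \<in> Lzy n" shows "x * y \<in> Lzy n"
proof -
  let ?D = "\<lambda>k l. (\<Prod>(i, j)\<in>{(i, j). i \<in> {1..n} \<and> j \<in> {1..n} \<and> i \<noteq> j}. (rf_z i - rf_z j) ^ k i j) *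
              (\<Prod>(i, j)\<in>{1..n} \<times> {1..n}. (rf_z i - rf_z j - rf_y) ^ l i j)"
  obtain f k l f' k' l' where
    *: "x = rf f / ?D k l" "f \<in> polys_in (zy_vars n)"
    "y = rf f' / ?D k' l'" "f' \<in> polys_in (zy_vars n)"
    using assms unfolding Lzy_def by blast
  have "x * y = rf (f * f') / ?D (\<lambda>i j. k i j + k' i j) (\<lambda>i j. l i j + l' i j)"
    by (simp add: * power_add prod.distrib split_def mult_ac)
  then show ?thesis unfolding Lzy_def using mult_in_polys [OF *(2,4)]
    by (intro CollectI exI [of _ "f * f'"] exI conjI)
qed

lemma Lzy_poly: "f \<in> polys_in (zy_vars n) \<Longrightarrow> rf f \<in> Lzy n"
  unfolding Lzy_def
  by (intro CollectI exI [of _ f] exI [of _ "\<lambda>_ _. 0"]) auto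

text \<open>Exponents chosen as an indicator function single out one denominator; this puts the
  inverse of each generator into \<open>Lzy\<close>.\<close>

lemma prod_pair_delta:
  fixes X :: "nat \<Rightarrow> nat \<Rightarrow> 'a :: comm_monoid_mult"
  assumes "finite S" "(i, j) \<in> S"
  shows "(\<Prod>(a, b)\<in>S. X a b ^ (if (a, b) = (i, j) then 1 else 0)) = X i j"
proof -
  have "(\<Prod>(a, b)\<in>S. X a b ^ (if (a, b) = (i, j) then 1 else 0))
      = (\<Prod>p\<in>S. if p = (i, j) then X i j else 1)"
    by (intro prod.cong) (auto split: if_splits)
  with assms show ?thesis by simp
qed

lemma Lzy_inverse_diff:
  assumes "i \<in> {1..n}" "j \<in> {1..n}" "i \<noteq> j"
  shows "inverse (rf_z i - rf_z j) \<in> Lzy n"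
proof -
  let ?S = "{(i, j). i \<in> {1..n} \<and> j \<in> {1..n} \<and> i \<noteq> j}"
  have "finite ?S" by (rule finite_subset [of _ "{1..n} \<times> {1..n}"]) auto
  then have "(\<Prod>(a, b)\<in>?S. (rf_z a - rf_z b) ^ (if (a, b) = (i, j) then 1 else 0)) = rf_z i - rf_z j"
    using assms by (intro prod_pair_delta) auto
  then show ?thesis unfolding Lzy_def
    by (intro CollectI exI [of _ 1] exI [of _ "\<lambda>a b. if (a, b) = (i, j) then 1 else 0"] exI [of _ "\<lambda>_ _. 0"])
      (auto simp: divide_inverse)
qed

text \<open>For i = j this inverts y up to sign, as the diagonal factors of \<open>wt_e\<close>
  require.\<close>

lemma Lzy_inverse_diff_y:
  assumes "i \<in> {1..n}" "j \<in> {1..n}"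
  shows "inverse (rf_z i - rf_z j - rf_y) \<in> Lzy n"
proof -
  have "(\<Prod>(a, b)\<in>{1..n} \<times> {1..n}. (rf_z a - rf_z b - rf_y) ^ (if (a, b) = (i, j) then 1 else 0))
      = rf_z i - rf_z j - rf_y"
    using assms by (intro prod_pair_delta) auto
  then show ?thesis unfolding Lzy_def
    by (intro CollectI exI [of _ 1] exI [of _ "\<lambda>_ _. 0"] exI [of _ "\<lambda>a b. if (a, b) = (i, j) then 1 else 0"])
      (auto simp: divide_inverse)
qed

section \<open>Closure properties of the ring \<open>Llzy\<close>\<close>

lemma Llzy_zero: "0 \<in> Llzy n"
  unfolding Llzy_def by (intro CollectI exI [of _ 0]) auto

lemma Llzy_add_prod:
  assumes "x \<in> Llzy n" "u \<in> Lly" "v \<in> Lzy n"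
  shows "x + u * v \<in> Llzy n"
proof -
  obtain m :: nat and f g where *: "x = (\<Sum>i<m. f i * g i)" "\<forall>i<m. f i \<in> Lly \<and> g i \<in> Lzy n"
    using assms(1) unfolding Llzy_def by blast
  then show ?thesis unfolding Llzy_def using assms
    by (intro CollectI exI [of _ "Suc m"] exI [of _ "f(m := u)"] exI [of _ "g(m := v)"]) auto
qed

lemma Llzy_prod2: "u \<in> Lly \<Longrightarrow> v \<in> Lzy n \<Longrightarrow> u * v \<in> Llzy n"
  using Llzy_add_prod [OF Llzy_zero] by simp

lemma Llzy_add: assumes "x \<in> Llzy n" "y \<in> Llzy n" shows "x + y \<in> Llzy n"
proof -
  obtain m :: nat and f g where *: "y = (\<Sum>i<m. f i * g i)" "\<forall>i<m. f i \<in> Lly \<and> g i \<in> Lzy n"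
    using assms(2) unfolding Llzy_def by blast
  have "k \<le> m \<Longrightarrow> x + (\<Sum>i<k. f i * g i) \<in> Llzy n" for k
  proof (induction k)
    case (Suc k)
    then have "(x + (\<Sum>i<k. f i * g i)) + f k * g k \<in> Llzy n"
      using * by (intro Llzy_add_prod) auto
    then show ?case by (simp add: add.assoc)
  qed (use assms in simp)
  then show ?thesis using * by simp
qed

lemma Llzy_sum: "(\<And>i. i \<in> A \<Longrightarrow> f i \<in> Llzy n) \<Longrightarrow> sum f A \<in> Llzy n"
  by (induction A rule: infinite_finite_induct) (auto intro: Llzy_add Llzy_zero)

lemma Llzy_mult: assumes "x \<in> Llzy n" "y \<in> Llzy n" shows "x * y \<in> Llzy n"
proof -
  obtain m :: nat and f g where x: "x = (\<Sum>i<m. f i * g i)" "\<forall>i<m. f i \<in> Lly \<and> g i \<in> Lzy n"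
    using assms(1) unfolding Llzy_def by blast
  obtain m' :: nat and f' g' where y: "y = (\<Sum>i<m'. f' i * g' i)" "\<forall>i<m'. f' i \<in> Lly \<and> g' i \<in> Lzy n"
    using assms(2) unfolding Llzy_def by blast
  have "x * y = (\<Sum>i<m. \<Sum>j<m'. (f i * f' j) * (g i * g' j))"
    unfolding x(1) y(1) sum_product by (simp add: mult_ac)
  then show ?thesis using x y by (auto intro!: Llzy_sum Llzy_prod2 Lly_mult Lzy_mult)
qed

lemma Lly_subset: "u \<in> Lly \<Longrightarrow> u \<in> Llzy n"
  using Llzy_prod2 [OF _ Lzy_poly [of 1]] by simp

lemma Lzy_subset: "u \<in> Lzy n \<Longrightarrow> u \<in> Llzy n"
  using Llzy_prod2 [OF Lly_poly [of 1]] by simp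

lemma Llzy_poly: "f \<in> polys_in (zy_vars n) \<Longrightarrow> rf f \<in> Llzy n"
  by (intro Lzy_subset Lzy_poly)

lemma of_int_in_polys [simp]: "of_int k \<in> polys_in S"
proof -
  have "of_int k = pconst (of_int k)" by (simp add: pconst_def)
  then show ?thesis by (metis pconst_in_polys)
qed

lemma Llzy_of_int: "of_int k \<in> Llzy n"
  using Llzy_poly [of "of_int k" n] by simp

lemma Llzy_one: "1 \<in> Llzy n"
  using Llzy_of_int [of 1] by simp

lemma Llzy_uminus: "x \<in> Llzy n \<Longrightarrow> - x \<in> Llzy n"
  using Llzy_mult [OF Llzy_of_int [of "-1"]] by simp

lemma Llzy_diff: "x \<in> Llzy n \<Longrightarrow> y \<in> Llzy n \<Longrightarrow> x - y \<in> Llzy n"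
  using Llzy_add [of x n "- y"] Llzy_uminus by simp

lemma Llzy_prod: "(\<And>i. i \<in> A \<Longrightarrow> f i \<in> Llzy n) \<Longrightarrow> prod f A \<in> Llzy n"
  by (induction A rule: infinite_finite_induct) (auto intro: Llzy_mult Llzy_one)

lemma Llzy_power: "x \<in> Llzy n \<Longrightarrow> x ^ k \<in> Llzy n"
  by (induction k) (auto intro: Llzy_mult Llzy_one)

lemma Llzy_y: "rf_y \<in> Llzy n"
  unfolding rf_y_def by (intro Llzy_poly) (simp add: zy_vars_def)

lemma Llzy_lam: "rf_lam \<in> Llzy n"
  unfolding rf_lam_def by (intro Lly_subset Lly_poly) simp

lemma Llzy_z: "i \<in> {1..n} \<Longrightarrow> rf_z i \<in> Llzy n"
  unfolding rf_z_def by (intro Llzy_poly) (simp add: zy_vars_def)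

lemma Llzy_inverse_z: "i \<in> {1..n} \<Longrightarrow> j \<in> {1..n} \<Longrightarrow> i \<noteq> j \<Longrightarrow> inverse (rf_z i - rf_z j) \<in> Llzy n"
  by (intro Lzy_subset Lzy_inverse_diff)

lemma Llzy_inverse_z_y: "i \<in> {1..n} \<Longrightarrow> j \<in> {1..n} \<Longrightarrow> inverse (rf_z i - rf_z j - rf_y) \<in> Llzy n"
  by (intro Lzy_subset Lzy_inverse_diff_y)

lemma Llzy_inverse_z_plus_y:
  assumes "i \<in> {1..n}" "j \<in> {1..n}" shows "inverse (rf_z i - rf_z j + rf_y) \<in> Llzy n"
proof -
  have "inverse (rf_z i - rf_z j + rf_y) = - inverse (rf_z j - rf_z i - rf_y)"
    by (subst inverse_minus_eq [symmetric]) (simp add: algebra_simps)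
  then show ?thesis using Llzy_uminus [OF Llzy_inverse_z_y [OF assms(2,1)]] by simp
qed

lemma Llzy_inverse_lam: "inverse (rf_lam - of_int l * rf_y) \<in> Llzy n"
  using Lly_subset [OF Lly_inverse [of "- l"]] by simp

lemma Llzy_divide: "x \<in> Llzy n \<Longrightarrow> inverse y \<in> Llzy n \<Longrightarrow> x / y \<in> Llzy n"
  by (simp add: divide_inverse Llzy_mult)

lemma Llzy_inverse_mult: "inverse x \<in> Llzy n \<Longrightarrow> inverse y \<in> Llzy n \<Longrightarrow> inverse (x * y) \<in> Llzy n"
  by (simp add: Llzy_mult)

lemma Llzy_inverse_prod: "(\<And>i. i \<in> A \<Longrightarrow> inverse (f i) \<in> Llzy n) \<Longrightarrow> inverse (prod f A) \<in> Llzy n"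
  by (induction A rule: infinite_finite_induct) (auto intro: Llzy_mult Llzy_one)

lemmas Llzy_intros = Llzy_zero Llzy_one Llzy_add Llzy_sum Llzy_mult Llzy_prod Llzy_of_int
  Llzy_uminus Llzy_diff Llzy_power Llzy_y Llzy_lam Llzy_divide Llzy_inverse_mult Llzy_inverse_prod

section \<open>The localisation theorem\<close>

lemma kth_bij:
  assumes "finite J" shows "bij_betw (kth J) {1..card J} J"
proof -
  have "bij_betw (\<lambda>r. r - 1) {1..card J} {..<card J}"
    by (rule bij_betw_byWitness [where f' = Suc]) auto
  moreover have "bij_betw ((!) (sorted_list_of_set J)) {..<card J} J"
    using assms by (intro bij_betw_nth) auto
  ultimately have "bij_betw ((!) (sorted_list_of_set J) \<circ> (\<lambda>r. r - 1)) {1..card J} J"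
    by (rule bij_betw_trans)
  then show ?thesis by (simp add: kth_def [abs_def] comp_def)
qed

lemma kth_mem: "finite J \<Longrightarrow> r \<in> {1..card J} \<Longrightarrow> kth J r \<in> J"
  using kth_bij bij_betwE by blast

lemma ksubsetsD:
  assumes "J \<in> ksubsets n k"
  shows "J \<subseteq> {1..n}" "card J = k" "finite J" "k \<le> n" "card ({1..n} - J) = n - k"
proof -
  show *: "J \<subseteq> {1..n}" "card J = k" using assms by (auto simp: ksubsets_def)
  show "finite J" using * finite_subset by blast
  show "k \<le> n" using card_mono [OF _ *(1)] * by simp
  show "card ({1..n} - J) = n - k"
    using * \<open>finite J\<close> by (simp add: card_Diff_subset)
qed

lemma finite_ksubsets [simp]: "finite (ksubsets n k)"
  by (rule finite_subset [of _ "Pow {1..n}"]) (auto simp: ksubsets_def)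

lemma cring_subring:
  fixes C :: "'r :: comm_ring_1 set"
  assumes "0 \<in> C" "1 \<in> C" "\<And>x y. x \<in> C \<Longrightarrow> y \<in> C \<Longrightarrow> x + y \<in> C"
    "\<And>x y. x \<in> C \<Longrightarrow> y \<in> C \<Longrightarrow> x * y \<in> C" "\<And>x. x \<in> C \<Longrightarrow> - x \<in> C"
  shows "cring \<lparr>carrier = C, monoid.mult = (*), one = 1, ring.zero = 0, add = (+)\<rparr>"
proof (rule cringI)
  show "abelian_group \<lparr>carrier = C, monoid.mult = (*), one = 1, ring.zero = 0, add = (+)\<rparr>"
  proof (rule abelian_groupI)
    fix x assume "x \<in> carrier \<lparr>carrier = C, monoid.mult = (*), one = 1, ring.zero = 0, add = (+)\<rparr>"
    with assms(5) [of x] show "\<exists>y\<in>carrier \<lparr>carrier = C, monoid.mult = (*), one = 1, ring.zero = 0, add = (+)\<rparr>.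
        y \<oplus>\<^bsub>\<lparr>carrier = C, monoid.mult = (*), one = 1, ring.zero = 0, add = (+)\<rparr>\<^esub> x
          = \<zero>\<^bsub>\<lparr>carrier = C, monoid.mult = (*), one = 1, ring.zero = 0, add = (+)\<rparr>\<^esub>"
      by (intro bexI [of _ "- x"]) auto
  qed (use assms in \<open>auto simp: add_ac\<close>)
  show "Group.comm_monoid \<lparr>carrier = C, monoid.mult = (*), one = 1, ring.zero = 0, add = (+)\<rparr>"
    using assms by (intro comm_monoidI) (auto simp: mult_ac)
qed (use assms in \<open>auto simp: ring_distribs\<close>)

section \<open>Invariant polynomials\<close>

definition coh_vars :: "nat \<Rightarrow> nat \<Rightarrow> var set" where
  "coh_vars n k = Gam1 ` {1..k} \<union> Gam2 ` {1..n-k} \<union> zy_vars n"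

definition gam_act :: "(nat \<Rightarrow> nat) \<Rightarrow> (nat \<Rightarrow> nat) \<Rightarrow> cpoly \<Rightarrow> cpoly" where
  "gam_act \<pi>1 \<pi>2 = psubst pconst (pvar \<circ> rename_gam \<pi>1 \<pi>2)"

lemma gam_act_simps [simp]:
  "gam_act \<pi>1 \<pi>2 (p + q) = gam_act \<pi>1 \<pi>2 p + gam_act \<pi>1 \<pi>2 q"
  "gam_act \<pi>1 \<pi>2 (p * q) = gam_act \<pi>1 \<pi>2 p * gam_act \<pi>1 \<pi>2 q"
  "gam_act \<pi>1 \<pi>2 (- p) = - gam_act \<pi>1 \<pi>2 p"
  "gam_act \<pi>1 \<pi>2 (p - q) = gam_act \<pi>1 \<pi>2 p - gam_act \<pi>1 \<pi>2 q"
  "gam_act \<pi>1 \<pi>2 (p ^ m) = gam_act \<pi>1 \<pi>2 p ^ m"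
  "gam_act \<pi>1 \<pi>2 (sum f A) = (\<Sum>i\<in>A. gam_act \<pi>1 \<pi>2 (f i))"
  "gam_act \<pi>1 \<pi>2 (prod f A) = (\<Prod>i\<in>A. gam_act \<pi>1 \<pi>2 (f i))"
  "gam_act \<pi>1 \<pi>2 0 = 0" "gam_act \<pi>1 \<pi>2 1 = 1"
  "gam_act \<pi>1 \<pi>2 (pconst a) = pconst a"
  "gam_act \<pi>1 \<pi>2 (pvar x) = pvar (rename_gam \<pi>1 \<pi>2 x)"
  by (simp_all add: gam_act_def)

lemma gam_act_comp: "gam_act \<pi>1 \<pi>2 (gam_act \<rho>1 \<rho>2 p) = gam_act (\<pi>1 \<circ> \<rho>1) (\<pi>2 \<circ> \<rho>2) p"
proof -
  have *: "rename_gam \<pi>1 \<pi>2 (rename_gam \<rho>1 \<rho>2 x) = rename_gam (\<pi>1 \<circ> \<rho>1) (\<pi>2 \<circ> \<rho>2) x" for x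
    by (cases x) auto
  show ?thesis
    by (simp add: gam_act_def psubst_psubst [OF pconst.complex_algebra_axioms] * comp_def)
qed

lemma gam_act_zy: "p \<in> polys_in (zy_vars n) \<Longrightarrow> gam_act \<pi>1 \<pi>2 p = p"
  unfolding gam_act_def by (rule psubst_pvar_id) (auto simp: zy_vars_def)

lemma gam_act_in_polys:
  assumes "p \<in> polys_in (coh_vars n k)" "\<pi>1 permutes {1..k}" "\<pi>2 permutes {1..n-k}"
  shows "gam_act \<pi>1 \<pi>2 p \<in> polys_in (coh_vars n k)"
  unfolding gam_act_def using assms(1)
proof (rule psubst_in_polys)
  fix x assume "x \<in> coh_vars n k"
  then show "(pvar \<circ> rename_gam \<pi>1 \<pi>2) x \<in> polys_in (coh_vars n k)"
    using permutes_in_image [OF assms(2)] permutes_in_image [OF assms(3)]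
    by (auto simp: coh_vars_def zy_vars_def intro!: pvar_in_polys)
qed

abbreviation gam_inv :: "nat \<Rightarrow> nat \<Rightarrow> cpoly set" where
  "gam_inv n k \<equiv> carrier (gam_inv_ring n k)"

lemma gam_inv_iff:
  "p \<in> gam_inv n k \<longleftrightarrow> p \<in> polys_in (coh_vars n k) \<and>
     (\<forall>\<pi>1 \<pi>2. \<pi>1 permutes {1..k} \<longrightarrow> \<pi>2 permutes {1..n-k} \<longrightarrow> gam_act \<pi>1 \<pi>2 p = p)"
  by (simp add: gam_inv_ring_def coh_vars_def gam_act_def)

lemma gam_inv_ring_simps [simp]:
  "monoid.mult (gam_inv_ring n k) = (*)" "\<one>\<^bsub>gam_inv_ring n k\<^esub> = 1" "\<zero>\<^bsub>gam_inv_ring n k\<^esub> = 0"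
  "add (gam_inv_ring n k) = (+)"
  by (simp_all add: gam_inv_ring_def)

lemma cring_gam_inv_ring: "cring (gam_inv_ring n k)"
  unfolding gam_inv_ring_def
  by (rule cring_subring) (auto intro: polys_in_intros simp: pconst_zero)

lemma gam_inv_zy: "p \<in> polys_in (zy_vars n) \<Longrightarrow> p \<in> gam_inv n k"
  by (auto simp: gam_inv_iff gam_act_zy coh_vars_def elim: polys_in_mono)

lemma gam_inv_pconst: "pconst a \<in> gam_inv n k"
  by (simp add: gam_inv_iff)

lemma gam_inv_add: "p \<in> gam_inv n k \<Longrightarrow> q \<in> gam_inv n k \<Longrightarrow> p + q \<in> gam_inv n k"
  by (simp add: gam_inv_iff add_in_polys)

lemma gam_inv_mult: "p \<in> gam_inv n k \<Longrightarrow> q \<in> gam_inv n k \<Longrightarrow> p * q \<in> gam_inv n k"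
  by (simp add: gam_inv_iff mult_in_polys)

lemma gam_inv_uminus: "p \<in> gam_inv n k \<Longrightarrow> - p \<in> gam_inv n k"
  by (simp add: gam_inv_iff uminus_in_polys)

lemma gam_inv_diff: "p \<in> gam_inv n k \<Longrightarrow> q \<in> gam_inv n k \<Longrightarrow> p - q \<in> gam_inv n k"
  by (simp add: gam_inv_iff diff_in_polys)

lemma gam_inv_sum: "(\<And>i. i \<in> A \<Longrightarrow> f i \<in> gam_inv n k) \<Longrightarrow> sum f A \<in> gam_inv n k"
  by (simp add: gam_inv_iff sum_in_polys)

section \<open>The relation polynomial and the ideal generated by its coefficients\<close>

context complex_algebra
begin

lemma coeff_map_psubst [simp]:
  "poly.coeff (map_poly (psubst c g) p) m = psubst c g (poly.coeff p m)"
  by (simp add: coeff_map_poly)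

lemma map_psubst_mult:
  "map_poly (psubst c g) (p * q) = map_poly (psubst c g) p * map_poly (psubst c g) q"
  by (intro poly_eqI) (simp add: coeff_mult)

lemma map_psubst_diff:
  "map_poly (psubst c g) (p - q) = map_poly (psubst c g) p - map_poly (psubst c g) q"
  by (intro poly_eqI) simp

lemma map_psubst_prod_linear:
  "map_poly (psubst c g) (\<Prod>i\<in>A. [:- f i, 1:]) = (\<Prod>i\<in>A. [:- psubst c g (f i), 1:])"
proof (induction A rule: infinite_finite_induct)
  case (insert x A)
  have "map_poly (psubst c g) [:- f x, 1:] = [:- psubst c g (f x), 1:]"
    by (simp add: map_poly_pCons)
  with insert show ?case unfolding prod.insert [OF insert.hyps] map_psubst_mult by (simp only:)
qed simp_all

text \<open>Substituting in all coefficients at once keeps the product form. Symmetry and vanishing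
  of the relations can thus be read off linear factors, without elementary symmetric
  functions.\<close>

lemma map_psubst_coh_rel:
  "map_poly (psubst c g) (coh_rel_poly n k) =
     (\<Prod>i\<in>{1..k}. [:- g (Gam1 i), 1:]) * (\<Prod>i\<in>{1..n-k}. [:- g (Gam2 i), 1:])
     - (\<Prod>i\<in>{1..n}. [:- g (Z i), 1:])"
  unfolding coh_rel_poly_def map_psubst_diff map_psubst_mult map_psubst_prod_linear by simp

end

lemma coeff_coh_rel_in_polys: "poly.coeff (coh_rel_poly n k) m \<in> polys_in (coh_vars n k)"
proof -
  let ?P = "\<lambda>p. \<forall>m. poly.coeff p m \<in> polys_in (coh_vars n k)"
  have mult: "?P (p * q)" if "?P p" "?P q" for p q
    using that by (auto simp: coeff_mult intro!: polys_in_intros)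
  have lin: "?P [:- p, 1:]" if "p \<in> polys_in (coh_vars n k)" for p
    using that by (auto simp: coeff_pCons uminus_in_polys split: nat.split)
  have prod: "?P (\<Prod>i\<in>A. f i)" if "\<And>i. i \<in> A \<Longrightarrow> ?P (f i)" for A and f :: "nat \<Rightarrow> cpoly poly"
    using that
    by (induction A rule: infinite_finite_induct) (simp, simp, simp only: prod.insert mult insert_iff simp_thms)
  have "?P (\<Prod>i\<in>{1..k}. [:- pvar (Gam1 i), 1:])" "?P (\<Prod>i\<in>{1..n-k}. [:- pvar (Gam2 i), 1:])"
    "?P (\<Prod>i\<in>{1..n}. [:- pvar (Z i), 1:])"
    by (intro prod lin pvar_in_polys; auto simp: coh_vars_def zy_vars_def)+
  then show ?thesis unfolding coh_rel_poly_def
    by (simp only: coeff_diff) (intro diff_in_polys mult [rule_format]; blast)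
qed

text \<open>A permutation only reorders the linear factors of each product.\<close>

lemma coeff_coh_rel_invariant:
  assumes "\<pi>1 permutes {1..k}" "\<pi>2 permutes {1..n-k}"
  shows "gam_act \<pi>1 \<pi>2 (poly.coeff (coh_rel_poly n k) m) = poly.coeff (coh_rel_poly n k) m"
proof -
  have *: "(\<Prod>i\<in>A. [:- pvar (f (\<pi> i)), 1:]) = (\<Prod>i\<in>A. [:- pvar (f i), 1:])"
    if "\<pi> permutes A" for \<pi> A and f :: "nat \<Rightarrow> var"
    using prod.permute [OF that, of "\<lambda>i. [:- pvar (f i), 1:]"] by (simp add: comp_def)
  have "map_poly (gam_act \<pi>1 \<pi>2) (coh_rel_poly n k) = coh_rel_poly n k"
    unfolding gam_act_def pconst.map_psubst_coh_rel using assms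
    by (simp add: coh_rel_poly_def *)
  then have "poly.coeff (map_poly (gam_act \<pi>1 \<pi>2) (coh_rel_poly n k)) m = poly.coeff (coh_rel_poly n k) m"
    by simp
  then show ?thesis by (simp add: gam_act_def)
qed

lemma coeff_coh_rel_gam_inv: "poly.coeff (coh_rel_poly n k) m \<in> gam_inv n k"
  by (simp add: gam_inv_iff coeff_coh_rel_in_polys coeff_coh_rel_invariant)

lemma ideal_coh_ideal: "ideal (coh_ideal n k) (gam_inv_ring n k)"
proof -
  interpret cring "gam_inv_ring n k" by (rule cring_gam_inv_ring)
  show ?thesis unfolding coh_ideal_def
    by (rule genideal_ideal) (auto simp: coeff_coh_rel_gam_inv)
qed

lemma coeff_mem_coh_ideal: "poly.coeff (coh_rel_poly n k) m \<in> coh_ideal n k"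
proof -
  interpret cring "gam_inv_ring n k" by (rule cring_gam_inv_ring)
  show ?thesis unfolding coh_ideal_def
    using genideal_self [of "range (poly.coeff (coh_rel_poly n k))"] coeff_coh_rel_gam_inv by blast
qed

lemma coh_ideal_zero: "0 \<in> coh_ideal n k"
  using additive_subgroup.zero_closed [OF ideal.axioms(1) [OF ideal_coh_ideal], of n k] by simp

lemma coh_ideal_add: "p \<in> coh_ideal n k \<Longrightarrow> q \<in> coh_ideal n k \<Longrightarrow> p + q \<in> coh_ideal n k"
  using additive_subgroup.a_closed [OF ideal.axioms(1) [OF ideal_coh_ideal], of p n k q] by simp

lemma coh_ideal_mult: "p \<in> coh_ideal n k \<Longrightarrow> q \<in> gam_inv n k \<Longrightarrow> q * p \<in> coh_ideal n k"
  using ideal.I_l_closed [OF ideal_coh_ideal, of p n k q] by simp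

lemma coh_ideal_sum: "(\<And>i. i \<in> A \<Longrightarrow> f i \<in> coh_ideal n k) \<Longrightarrow> sum f A \<in> coh_ideal n k"
  by (induction A rule: infinite_finite_induct) (auto intro: coh_ideal_add coh_ideal_zero)

section \<open>Restriction of polynomials to a fixed point\<close>

fun fixpt_var :: "nat \<Rightarrow> nat set \<Rightarrow> var \<Rightarrow> var" where
  "fixpt_var n J (Gam1 i) = Z (kth J i)"
| "fixpt_var n J (Gam2 i) = Z (kth ({1..n} - J) i)"
| "fixpt_var n J v = v"

text \<open>The substitution of \<open>fixpt_val\<close> before passing to fractions
  (\<open>psubst_fixpt_val\<close>). Its values stay in \<complex>[z, y], so they can be moved
  across the tensor product.\<close>

definition fixpt_eval :: "nat \<Rightarrow> nat set \<Rightarrow> cpoly \<Rightarrow> cpoly" where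
  "fixpt_eval n J = psubst pconst (pvar \<circ> fixpt_var n J)"

lemma fixpt_eval_simps [simp]:
  "fixpt_eval n J (p + q) = fixpt_eval n J p + fixpt_eval n J q"
  "fixpt_eval n J (p * q) = fixpt_eval n J p * fixpt_eval n J q"
  "fixpt_eval n J (- p) = - fixpt_eval n J p"
  "fixpt_eval n J (p - q) = fixpt_eval n J p - fixpt_eval n J q"
  "fixpt_eval n J (p ^ m) = fixpt_eval n J p ^ m"
  "fixpt_eval n J (sum f A) = (\<Sum>i\<in>A. fixpt_eval n J (f i))"
  "fixpt_eval n J (prod f A) = (\<Prod>i\<in>A. fixpt_eval n J (f i))"
  "fixpt_eval n J 0 = 0" "fixpt_eval n J 1 = 1"
  "fixpt_eval n J (pconst a) = pconst a"
  "fixpt_eval n J (pvar x) = pvar (fixpt_var n J x)"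
  by (simp_all add: fixpt_eval_def)

lemma fixpt_eval_zy: "p \<in> polys_in (zy_vars n) \<Longrightarrow> fixpt_eval n J p = p"
  unfolding fixpt_eval_def by (rule psubst_pvar_id) (auto simp: zy_vars_def)

lemma fixpt_eval_in_polys:
  assumes "p \<in> polys_in (coh_vars n k)" "J \<in> ksubsets n k"
  shows "fixpt_eval n J p \<in> polys_in (zy_vars n)"
  unfolding fixpt_eval_def using assms(1)
proof (rule psubst_in_polys)
  note J = ksubsetsD [OF assms(2)]
  fix x assume "x \<in> coh_vars n k"
  then show "(pvar \<circ> fixpt_var n J) x \<in> polys_in (zy_vars n)"
    using kth_mem [of J] kth_mem [of "{1..n} - J"] J
    by (fastforce simp: coh_vars_def zy_vars_def intro!: pvar_in_polys)
qed

lemma psubst_fixpt_val: "psubst (rf \<circ> pconst) (fixpt_val n J) p = rf (fixpt_eval n J p)"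
proof -
  have "fixpt_val n J x = rf (pvar (fixpt_var n J x))" for x
    by (cases x) (auto simp: rf_z_def)
  then have "fixpt_val n J = (\<lambda>x. rf ((pvar \<circ> fixpt_var n J) x))" by auto
  then show ?thesis by (simp only: psubst_rf fixpt_eval_def comp_def [of rf])
qed

text \<open>At x_J the products over the two families of \<gamma>'s run over J and its complement;
  together they equal the product over all z's, so the generators vanish. The invariants vanishing
  at x_J form an ideal, which therefore contains the ideal of relations.\<close>

lemma fixpt_eval_coh_ideal:
  assumes p: "p \<in> coh_ideal n k" and J: "J \<in> ksubsets n k"
  shows "fixpt_eval n J p = 0"
proof -
  interpret cring "gam_inv_ring n k" by (rule cring_gam_inv_ring)
  note J = ksubsetsD [OF J]
  have 1: "(\<Prod>i\<in>{1..k}. [:- pvar (Z (kth J i)), 1:]) = (\<Prod>a\<in>J. [:- pvar (Z a), 1:])"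
    using prod.reindex_bij_betw [OF kth_bij [OF J(3)], of "\<lambda>a. [:- pvar (Z a), 1:]"] J by simp
  have 2: "(\<Prod>i\<in>{1..n-k}. [:- pvar (Z (kth ({1..n} - J) i)), 1:])
      = (\<Prod>a\<in>{1..n} - J. [:- pvar (Z a), 1:])"
    using prod.reindex_bij_betw [OF kth_bij [of "{1..n} - J"], of "\<lambda>a. [:- pvar (Z a), 1:]"] J by simp
  have "map_poly (fixpt_eval n J) (coh_rel_poly n k) = 0"
    unfolding fixpt_eval_def pconst.map_psubst_coh_rel
    using 1 2 prod.subset_diff [OF J(1), of "\<lambda>a. [:- pvar (Z a), 1:]"] by (simp add: mult.commute)
  then have "poly.coeff (map_poly (fixpt_eval n J) (coh_rel_poly n k)) m = 0" for m by simp
  then have coeff: "fixpt_eval n J (poly.coeff (coh_rel_poly n k) m) = 0" for m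
    by (simp add: fixpt_eval_def)
  have "ideal {p \<in> gam_inv n k. fixpt_eval n J p = 0} (gam_inv_ring n k)"
  proof (rule idealI)
    show "subgroup {p \<in> gam_inv n k. fixpt_eval n J p = 0} (add_monoid (gam_inv_ring n k))"
    proof (rule add.subgroupI)
      fix p assume p: "p \<in> {p \<in> gam_inv n k. fixpt_eval n J p = 0}"
      then have "\<ominus>\<^bsub>gam_inv_ring n k\<^esub> p = - p"
        by (intro minus_equality) (auto simp: gam_inv_uminus)
      with p show "\<ominus>\<^bsub>gam_inv_ring n k\<^esub> p \<in> {p \<in> gam_inv n k. fixpt_eval n J p = 0}"
        by (simp add: gam_inv_uminus)
    qed (auto intro: gam_inv_add exI [of _ 0] gam_inv_zy)
  qed (auto intro: gam_inv_mult local.ring_axioms)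
  then have "coh_ideal n k \<subseteq> {p \<in> gam_inv n k. fixpt_eval n J p = 0}"
    unfolding coh_ideal_def by (rule genideal_minimal) (auto simp: coeff coeff_coh_rel_gam_inv)
  with p show ?thesis by blast
qed

text \<open>The q m are arbitrary polynomials. Averaging over S_k x S_(n-k) makes them invariant and
  fixes p and the relations; division by the order of the group is possible because constants from
  \<complex> are at hand.\<close>

lemma mem_coh_ideal_by_averaging:
  assumes p: "p \<in> gam_inv n k"
    and eq: "p = (\<Sum>m\<in>M. poly.coeff (coh_rel_poly n k) m * q m)"
  shows "p \<in> coh_ideal n k"
proof -
  let ?c = "poly.coeff (coh_rel_poly n k)"
  let ?G = "{\<pi>. \<pi> permutes {1..k}} \<times> {\<pi>. \<pi> permutes {1..n-k}}"
  \<comment> \<open>The q m may contain variables outside \<open>coh_vars\<close>; setting these to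
    0 alters neither p nor the relations.\<close>
  define proj where "proj = psubst pconst (\<lambda>x. if x \<in> coh_vars n k then pvar x else 0)"
  define avg where "avg r = (\<Sum>(\<pi>1, \<pi>2)\<in>?G. gam_act \<pi>1 \<pi>2 r)" for r
  have fin: "finite ?G" by (auto intro: finite_permutations)
  have proj_id: "proj r = r" if "r \<in> polys_in (coh_vars n k)" for r
    unfolding proj_def using that by (rule psubst_pvar_id) auto
  have proj_in: "proj r \<in> polys_in (coh_vars n k)" for r
    unfolding proj_def by (rule psubst_in_polys [OF polys_in_UNIV]) auto
  have "p = proj p" using p by (simp add: proj_id gam_inv_iff)
  also have "\<dots> = (\<Sum>m\<in>M. ?c m * proj (q m))"
    unfolding eq proj_def pconst.psubst_sum pconst.psubst_mult
    by (simp add: proj_id [unfolded proj_def] coeff_coh_rel_in_polys)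
  finally have p_eq: "p = (\<Sum>m\<in>M. ?c m * proj (q m))" .
  have avg_in: "avg r \<in> gam_inv n k" if r: "r \<in> polys_in (coh_vars n k)" for r
    unfolding gam_inv_iff
  proof (intro conjI allI impI)
    show "avg r \<in> polys_in (coh_vars n k)"
      unfolding avg_def using r by (auto intro!: sum_in_polys gam_act_in_polys)
    fix \<rho>1 \<rho>2 assume \<rho>: "\<rho>1 permutes {1..k}" "\<rho>2 permutes {1..n-k}"
    have bij: "bij_betw (\<lambda>(\<pi>1, \<pi>2). (\<rho>1 \<circ> \<pi>1, \<rho>2 \<circ> \<pi>2)) ?G ?G"
      using \<rho> by (intro bij_betw_byWitness [where f' = "\<lambda>(\<pi>1, \<pi>2). (inv_into UNIV \<rho>1 \<circ> \<pi>1, inv_into UNIV \<rho>2 \<circ> \<pi>2)"])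
        (auto simp: permutes_inv_o o_assoc intro: permutes_compose permutes_inv)
    have "gam_act \<rho>1 \<rho>2 (avg r) = (\<Sum>(\<pi>1, \<pi>2)\<in>?G. gam_act (\<rho>1 \<circ> \<pi>1) (\<rho>2 \<circ> \<pi>2) r)"
      by (simp add: avg_def gam_act_comp split_def)
    also have "\<dots> = avg r"
      unfolding avg_def using sum.reindex_bij_betw [OF bij, of "\<lambda>(\<pi>1, \<pi>2). gam_act \<pi>1 \<pi>2 r"]
      by (simp add: split_def)
    finally show "gam_act \<rho>1 \<rho>2 (avg r) = avg r" .
  qed
  have "avg p = (\<Sum>m\<in>M. \<Sum>(\<pi>1, \<pi>2)\<in>?G. gam_act \<pi>1 \<pi>2 (?c m * proj (q m)))"
    unfolding avg_def by (subst p_eq) (simp add: split_def sum.swap [of _ _ M])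
  also have "\<dots> = (\<Sum>m\<in>M. avg (proj (q m)) * ?c m)"
    unfolding avg_def sum_distrib_right
    by (intro sum.cong refl) (auto simp: coeff_coh_rel_invariant mult.commute)
  also have "\<dots> \<in> coh_ideal n k"
    by (intro coh_ideal_sum coh_ideal_mult coeff_mem_coh_ideal avg_in proj_in)
  finally have "avg p \<in> coh_ideal n k" .
  moreover have "avg p = of_nat (card ?G) * p"
    unfolding avg_def using p by (subst sum.cong [OF refl, of _ _ "\<lambda>_. p"]) (auto simp: gam_inv_iff)
  ultimately have "pconst (1 / of_nat (card ?G)) * (of_nat (card ?G) * p) \<in> coh_ideal n k"
    by (auto intro: coh_ideal_mult gam_inv_pconst)
  moreover have "pconst (1 / of_nat (card ?G)) * of_nat (card ?G) = 1"
  proof -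
    have "card ?G \<noteq> 0"
    proof -
      have "(id, id) \<in> ?G" by (simp add: permutes_id)
      then show ?thesis using fin by (metis card_eq_0_iff empty_iff)
    qed
    then have "pconst (1 / of_nat (card ?G)) * pconst (of_nat (card ?G)) = 1"
      unfolding pconst.c_mult [symmetric] by (simp add: pconst_one)
    then show ?thesis by (simp add: pconst_def)
  qed
  ultimately show ?thesis by (simp only: mult.assoc [symmetric] mult_1)
qed

section \<open>Localisation at the discriminant\<close>

definition offdiag :: "nat \<Rightarrow> (nat \<times> nat) set" where
  "offdiag n = {(a, b). a \<in> {1..n} \<and> b \<in> {1..n} \<and> a \<noteq> b}"

lemma finite_offdiag [simp]: "finite (offdiag n)"
  by (rule finite_subset [of _ "{1..n} \<times> {1..n}"]) (auto simp: offdiag_def)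

text \<open>The discriminant up to sign, as each pair occurs in both orders. Every difference z_a -
  z_b divides it, and it becomes a unit in \<open>Llzy\<close>.\<close>

definition disc :: "nat \<Rightarrow> cpoly" where
  "disc n = (\<Prod>(a, b)\<in>offdiag n. pvar (Z a) - pvar (Z b))"

lemma disc_in_polys: "disc n \<in> polys_in (zy_vars n)"
  unfolding disc_def by (auto simp: offdiag_def zy_vars_def intro!: polys_in_intros)

lemma rf_disc: "rf (disc n) = (\<Prod>(a, b)\<in>offdiag n. rf_z a - rf_z b)"
  by (simp add: disc_def rf_z_def split_def)

lemma rf_disc_nonzero: "rf (disc n) \<noteq> 0"
  unfolding rf_disc by (subst prod_zero_iff [OF finite_offdiag]) (auto simp: offdiag_def rf_z_eq_iff)

lemma Llzy_inverse_disc: "inverse (rf (disc n)) \<in> Llzy n"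
  unfolding rf_disc by (auto intro!: Llzy_inverse_prod Llzy_inverse_z simp: offdiag_def)

lemma bij_betw_permutesE:
  assumes f: "bij_betw f A B" and g: "bij_betw g A B"
  obtains \<pi> where "\<pi> permutes A" "\<And>x. x \<in> A \<Longrightarrow> f (\<pi> x) = g x"
proof
  let ?\<pi> = "\<lambda>x. if x \<in> A then inv_into A f (g x) else x"
  have "bij_betw (inv_into A f \<circ> g) A A"
    using bij_betw_trans [OF g bij_betw_inv_into [OF f]] .
  then have "bij_betw ?\<pi> A A" by (rule bij_betw_cong [THEN iffD1, rotated]) auto
  then show "?\<pi> permutes A" by (rule bij_imp_permutes) auto
  show "f (?\<pi> x) = g x" if "x \<in> A" for x
    using that f g bij_betw_inv_into_right bij_betwE by fastforce
qed

text \<open>By interpolation it suffices to consider elements q on which every \<gamma> acts as some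
  z_\<phi>(i). On such q, multiplication by h amounts to multiplication by the value of h at x_J,
  where J is the image of {1..k} under \<phi>, and this value is 0.\<close>

lemma coh_ideal_saturation:
  assumes h: "h \<in> gam_inv n k" and k: "k \<le> n"
    and van: "\<And>J. J \<in> ksubsets n k \<Longrightarrow> fixpt_eval n J h = 0"
  shows "\<exists>N. disc n ^ N * h \<in> coh_ideal n k"
proof -
  let ?rel = "coh_rel_poly n k"
  \<comment> \<open>\<open>I0\<close> is the ideal generated by the relations among all polynomials.
    \<open>I\<close> is its saturation by powers of \<open>disc\<close>, where the differences z_b -
    z_c cancel as interpolation demands.\<close>
  define I0 where "I0 = {p. \<exists>q. p = (\<Sum>m\<le>degree ?rel. poly.coeff ?rel m * q m)}"
  define I where "I = {p. \<exists>N. disc n ^ N * p \<in> I0}"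
  \<comment> \<open>A single numbering of both families of \<gamma>'s; the second family starts at k
    + 1.\<close>
  define gam where "gam i = (if i \<le> k then Gam1 i else Gam2 (i - k))" for i
  interpret I0: cideal I0
  proof
    show "0 \<in> I0" unfolding I0_def by (auto intro: exI [of _ "\<lambda>_. 0"])
    fix p assume "p \<in> I0"
    then obtain q where p: "p = (\<Sum>m\<le>degree ?rel. poly.coeff ?rel m * q m)"
      unfolding I0_def by blast
    show "r * p \<in> I0" for r
      unfolding I0_def p by (auto simp: sum_distrib_left mult.left_commute intro!: exI [of _ "\<lambda>m. r * q m"])
    fix p' assume "p' \<in> I0"
    then obtain q' where p': "p' = (\<Sum>m\<le>degree ?rel. poly.coeff ?rel m * q' m)"
      unfolding I0_def by blast
    show "p + p' \<in> I0"
      unfolding I0_def p p'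
      by (auto simp: ring_distribs sum.distrib intro!: exI [of _ "\<lambda>m. q m + q' m"])
  qed
  interpret I: cideal I
  proof
    show "0 \<in> I" unfolding I_def by (auto simp: I0.zero_mem)
    fix p assume "p \<in> I"
    then obtain N where N: "disc n ^ N * p \<in> I0" unfolding I_def by blast
    show "r * p \<in> I" for r
      using I0.mult_mem [OF N, of r] unfolding I_def by (auto simp: mult.left_commute)
    fix p' assume "p' \<in> I"
    then obtain N' where N': "disc n ^ N' * p' \<in> I0" unfolding I_def by blast
    have "disc n ^ N' * (disc n ^ N * p) + disc n ^ N * (disc n ^ N' * p') \<in> I0"
      by (intro I0.add_mem I0.mult_mem [OF N] I0.mult_mem [OF N'])
    then have "disc n ^ (N + N') * (p + p') \<in> I0" by (simp add: algebra_simps power_add)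
    then show "p + p' \<in> I" unfolding I_def by blast
  qed
  have sub: "p \<in> I" if "p \<in> I0" for p
    using that unfolding I_def by (auto intro: exI [of _ 0])
  have "h \<in> I"
  proof (rule I.interpolation_mem [where n = n and g = "\<lambda>i. pvar (gam i)" and z = "\<lambda>i. pvar (Z i)"])
    fix u
    have 1: "(\<Prod>i\<in>{1..k}. u - pvar (gam i)) = (\<Prod>i\<in>{1..k}. u - pvar (Gam1 i))"
      by (intro prod.cong) (auto simp: gam_def)
    have "bij_betw (\<lambda>i. i + k) {1..n-k} {k+1..n}"
      using k by (intro bij_betw_byWitness [where f' = "\<lambda>i. i - k"]) auto
    from prod.reindex_bij_betw [OF this, of "\<lambda>i. u - pvar (gam i)", symmetric]
    have 2: "(\<Prod>i\<in>{k+1..n}. u - pvar (gam i)) = (\<Prod>i\<in>{1..n-k}. u - pvar (Gam2 i))"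
      by (rule trans) (intro prod.cong, auto simp: gam_def)
    have "{1..n} = {1..k} \<union> {k+1..n}" using k by auto
    then have "(\<Prod>i\<in>{1..n}. u - pvar (gam i))
        = (\<Prod>i\<in>{1..k}. u - pvar (gam i)) * (\<Prod>i\<in>{k+1..n}. u - pvar (gam i))"
      by (simp only: prod.union_disjoint [of "{1..k}" "{k+1..n}"]) (auto intro: prod.union_disjoint)
    then have "(\<Prod>i\<in>{1..n}. u - pvar (gam i)) - (\<Prod>i\<in>{1..n}. u - pvar (Z i)) = poly ?rel u"
      unfolding 1 2 coh_rel_poly_def by (simp add: poly_prod)
    also have "\<dots> \<in> I0" unfolding I0_def poly_altdef by blast
    finally show "(\<Prod>i\<in>{1..n}. u - pvar (gam i)) - (\<Prod>i\<in>{1..n}. u - pvar (Z i)) \<in> I"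
      by (rule sub)
  next
    fix b c p
    assume bc: "b \<in> {1..n}" "c \<in> {1..n}" "b \<noteq> c" and mem: "(pvar (Z b) - pvar (Z c)) * p \<in> I"
    then obtain N where N: "disc n ^ N * ((pvar (Z b) - pvar (Z c)) * p) \<in> I0" unfolding I_def by blast
    have "(b, c) \<in> offdiag n" using bc by (simp add: offdiag_def)
    then have "disc n = (pvar (Z b) - pvar (Z c)) * (\<Prod>(a, b)\<in>offdiag n - {(b, c)}. pvar (Z a) - pvar (Z b))"
      unfolding disc_def by (simp add: prod.remove)
    then obtain d where d: "disc n = (pvar (Z b) - pvar (Z c)) * d" by blast
    have "disc n ^ Suc N * p = disc n * (disc n ^ N * p)" by (simp add: mult.assoc)
    also have "\<dots> = ((pvar (Z b) - pvar (Z c)) * d) * (disc n ^ N * p)"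
      using d by (rule arg_cong)
    also have "\<dots> = d * (disc n ^ N * ((pvar (Z b) - pvar (Z c)) * p))"
      by (simp only: mult_ac)
    finally have "disc n ^ Suc N * p \<in> I0" using I0.mult_mem [OF N, of d] by (simp only:)
    then show "p \<in> I" unfolding I_def by blast
  next
    fix \<phi> q
    assume \<phi>: "bij_betw \<phi> {1..n} {1..n}"
      and q: "\<And>i. i \<in> {1..n} \<Longrightarrow> (pvar (gam i) - pvar (Z (\<phi> i))) * q \<in> I"
    define G where "G x = (case x of Gam1 i \<Rightarrow> Z (\<phi> i) | Gam2 i \<Rightarrow> Z (\<phi> (i + k)) | _ \<Rightarrow> x)" for x
    \<comment> \<open>Multiplied by q, a polynomial and its image s(p) under \<gamma> -> z_\<phi>
      agree modulo \<open>I\<close>. For products this uses p p' - s(p) s(p') = p (p' - s(p')) +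
      s(p') (p - s(p)).\<close>
    have cong: "(p - psubst pconst (\<lambda>x. pvar (G x)) p) * q \<in> I" if "p \<in> polys_in (coh_vars n k)" for p
      using that
    proof (induction p rule: polys_in_induct)
      case (var x)
      consider i where "x = Gam1 i" "i \<in> {1..k}" | i where "x = Gam2 i" "i \<in> {1..n-k}" | "G x = x"
        using var by (auto simp: coh_vars_def zy_vars_def G_def)
      then show ?case
      proof cases
        case 1
        then show ?thesis using q [of i] k by (simp add: gam_def G_def)
      next
        case 2
        then have "i + k \<in> {1..n}" using k by auto
        then show ?thesis using q [of "i + k"] 2 by (simp add: gam_def G_def)
      qed (simp add: I.zero_mem)
    next
      case (add p p')
      from I.add_mem [OF this] show ?case by (simp add: algebra_simps)
    next
      case (mult p p')
      let ?s = "psubst pconst (\<lambda>x. pvar (G x))"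
      have "p * ((p' - ?s p') * q) + ?s p' * ((p - ?s p) * q) \<in> I"
        by (intro I.add_mem I.mult_mem [OF mult(1)] I.mult_mem [OF mult(2)])
      then show ?case by (simp add: algebra_simps)
    qed (simp add: I.zero_mem)
    define J where "J = \<phi> ` {1..k}"
    have inj: "inj_on \<phi> {1..n}" and im: "\<phi> ` {1..n} = {1..n}" using \<phi> by (auto simp: bij_betw_def)
    have inj1: "inj_on \<phi> {1..k}" using inj k by (auto intro: inj_on_subset)
    have J: "J \<in> ksubsets n k"
      using im k inj1 by (fastforce simp: J_def ksubsets_def card_image)
    note J' = ksubsetsD [OF J]
    have b1: "bij_betw \<phi> {1..k} J" using inj1 by (simp add: J_def bij_betw_def)
    have "bij_betw \<phi> ({1..n} - {1..k}) ({1..n} - J)"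
      using bij_betw_DiffI [OF \<phi> b1] J'(1) k by auto
    moreover have "bij_betw (\<lambda>i. i + k) {1..n-k} ({1..n} - {1..k})"
      using k by (intro bij_betw_byWitness [where f' = "\<lambda>i. i - k"]) auto
    ultimately have b2: "bij_betw (\<lambda>i. \<phi> (i + k)) {1..n-k} ({1..n} - J)"
      using bij_betw_trans [of "\<lambda>i. i + k" _ _ \<phi>] by (simp add: comp_def)
    \<comment> \<open>\<phi> enumerates J and its complement in arbitrary order, \<open>kth\<close>
      in increasing order. The permutations \<pi>1 and \<pi>2 translate between them, and h is
      invariant under these.\<close>
    obtain \<pi>1 where \<pi>1: "\<pi>1 permutes {1..k}" "\<And>i. i \<in> {1..k} \<Longrightarrow> \<phi> (\<pi>1 i) = kth J i"
      using bij_betw_permutesE [OF b1 kth_bij [OF J'(3), unfolded J'(2)]] by blast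
    obtain \<pi>2 where \<pi>2: "\<pi>2 permutes {1..n-k}"
      "\<And>i. i \<in> {1..n-k} \<Longrightarrow> \<phi> (\<pi>2 i + k) = kth ({1..n} - J) i"
      using bij_betw_permutesE [OF b2 kth_bij [of "{1..n} - J", unfolded J'(5)]] by blast
    have "psubst pconst (\<lambda>x. pvar (G x)) h = psubst pconst (\<lambda>x. pvar (G x)) (gam_act \<pi>1 \<pi>2 h)"
      using h \<pi>1 \<pi>2 by (simp add: gam_inv_iff)
    also have "\<dots> = psubst pconst (\<lambda>x. pvar (G (rename_gam \<pi>1 \<pi>2 x))) h"
      by (simp add: gam_act_def psubst_psubst [OF pconst.complex_algebra_axioms])
    also have "\<dots> = fixpt_eval n J h"
      unfolding fixpt_eval_def
    proof (rule pconst.psubst_cong)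
      show "h \<in> polys_in (coh_vars n k)" using h by (simp add: gam_inv_iff)
      show "pvar (G (rename_gam \<pi>1 \<pi>2 x)) = (pvar \<circ> fixpt_var n J) x" if "x \<in> coh_vars n k" for x
        using that \<pi>1 \<pi>2 by (auto simp: coh_vars_def zy_vars_def G_def)
    qed
    also have "\<dots> = 0" by (rule van [OF J])
    finally show "q * h \<in> I" using cong [of h] h by (simp add: gam_inv_iff mult.commute)
  qed
  then obtain N where "disc n ^ N * h \<in> I0" unfolding I_def by blast
  then obtain q where "disc n ^ N * h = (\<Sum>m\<le>degree ?rel. poly.coeff ?rel m * q m)"
    unfolding I0_def by blast
  then have "disc n ^ N * h \<in> coh_ideal n k"
    by (rule mem_coh_ideal_by_averaging [rotated])
      (intro gam_inv_mult gam_inv_zy power_in_polys disc_in_polys h)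
  then show ?thesis ..
qed

text \<open>A class supported at x_J. The first product vanishes at x_K for K \<noteq> J, since K
  then has an element outside J; the second supplies the differences that are missing from
  \<open>disc\<close>, so that the value at x_J is \<open>disc\<close> for every J.\<close>

definition fixpt_class :: "nat \<Rightarrow> nat \<Rightarrow> nat set \<Rightarrow> cpoly" where
  "fixpt_class n k J = (\<Prod>i\<in>{1..k}. \<Prod>b\<in>{1..n} - J. pvar (Gam1 i) - pvar (Z b)) *
     (\<Prod>(a, b)\<in>offdiag n - J \<times> ({1..n} - J). pvar (Z a) - pvar (Z b))"

lemma fixpt_class_gam_inv: "fixpt_class n k J \<in> gam_inv n k"
  unfolding gam_inv_iff
proof (intro conjI allI impI)
  show "fixpt_class n k J \<in> polys_in (coh_vars n k)"
    unfolding fixpt_class_def offdiag_def coh_vars_def zy_vars_def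
    by (auto intro!: mult_in_polys prod_in_polys diff_in_polys pvar_in_polys)
  fix \<pi>1 \<pi>2 assume \<pi>: "\<pi>1 permutes {1..k}"
  have "(\<Prod>i\<in>{1..k}. \<Prod>b\<in>{1..n} - J. pvar (Gam1 (\<pi>1 i)) - pvar (Z b))
      = (\<Prod>i\<in>{1..k}. \<Prod>b\<in>{1..n} - J. pvar (Gam1 i) - pvar (Z b))"
    using prod.permute [OF \<pi>, of "\<lambda>i. \<Prod>b\<in>{1..n} - J. pvar (Gam1 i) - pvar (Z b)"]
    unfolding comp_def by (rule sym)
  then show "gam_act \<pi>1 \<pi>2 (fixpt_class n k J) = fixpt_class n k J"
    unfolding fixpt_class_def gam_act_simps split_def rename_gam.simps by (simp only:)
qed

lemma fixpt_eval_class: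
  assumes J: "J \<in> ksubsets n k" and K: "K \<in> ksubsets n k"
  shows "fixpt_eval n K (fixpt_class n k J) = (if K = J then disc n else 0)"
proof -
  note J' = ksubsetsD [OF J] and K' = ksubsetsD [OF K]
  let ?P = "\<lambda>S. \<Prod>(a, b)\<in>S. pvar (Z a) - pvar (Z b)"
  have "fixpt_eval n K (fixpt_class n k J)
      = (\<Prod>i\<in>{1..k}. \<Prod>b\<in>{1..n} - J. pvar (Z (kth K i)) - pvar (Z b)) * ?P (offdiag n - J \<times> ({1..n} - J))"
    by (simp add: fixpt_class_def split_def)
  also have "(\<Prod>i\<in>{1..k}. \<Prod>b\<in>{1..n} - J. pvar (Z (kth K i)) - pvar (Z b))
      = (\<Prod>a\<in>K. \<Prod>b\<in>{1..n} - J. pvar (Z a) - pvar (Z b))"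
    using prod.reindex_bij_betw [OF kth_bij [OF K'(3)],
        of "\<lambda>a. \<Prod>b\<in>{1..n} - J. pvar (Z a) - pvar (Z b)"] K' by simp
  also have "\<dots> = ?P (K \<times> ({1..n} - J))"
    using K' by (simp add: prod.cartesian_product)
  also have "?P (K \<times> ({1..n} - J)) * ?P (offdiag n - J \<times> ({1..n} - J)) = (if K = J then disc n else 0)"
  proof (cases "K = J")
    case True
    have "J \<times> ({1..n} - J) \<subseteq> offdiag n" using J' by (auto simp: offdiag_def)
    from prod.subset_diff [OF this finite_offdiag] True show ?thesis
      by (metis (no_types, lifting) disc_def mult.commute)
  next
    case False
    have "\<not> K \<subseteq> J" using False card_subset_eq [OF J'(3)] J' K' by auto
    then obtain a where "a \<in> K" "a \<notin> J" by blast
    then have "(a, a) \<in> K \<times> ({1..n} - J)" using K' by auto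
    then have "?P (K \<times> ({1..n} - J)) = 0" using K' by (intro prod_zero) auto
    with False show ?thesis by simp
  qed
  finally show ?thesis .
qed

text \<open>Both terms of the difference agree at each x_K, where only J = K contributes to the sum;
  saturation does the rest.\<close>

lemma fixpt_expansion:
  assumes p: "p \<in> gam_inv n k" and k: "k \<le> n"
  shows "\<exists>N. disc n ^ N * (disc n * p - (\<Sum>J\<in>ksubsets n k. fixpt_eval n J p * fixpt_class n k J))
           \<in> coh_ideal n k"
proof (rule coh_ideal_saturation [OF _ k])
  have ev: "fixpt_eval n J p \<in> polys_in (zy_vars n)" if "J \<in> ksubsets n k" for J
    using that p by (intro fixpt_eval_in_polys) (auto simp: gam_inv_iff)
  show "disc n * p - (\<Sum>J\<in>ksubsets n k. fixpt_eval n J p * fixpt_class n k J) \<in> gam_inv n k"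
    by (intro gam_inv_diff gam_inv_mult gam_inv_sum gam_inv_zy fixpt_class_gam_inv p ev disc_in_polys)
  fix K assume K: "K \<in> ksubsets n k"
  have "fixpt_eval n K (\<Sum>J\<in>ksubsets n k. fixpt_eval n J p * fixpt_class n k J)
      = (\<Sum>J\<in>ksubsets n k. if J = K then disc n * fixpt_eval n K p else 0)"
    unfolding fixpt_eval_simps
    by (intro sum.cong refl) (auto simp: fixpt_eval_class K fixpt_eval_zy ev)
  also have "\<dots> = disc n * fixpt_eval n K p" using K by simp
  finally show "fixpt_eval n K (disc n * p - (\<Sum>J\<in>ksubsets n k. fixpt_eval n J p * fixpt_class n k J)) = 0"
    by (simp add: fixpt_eval_zy disc_in_polys)
qed

section \<open>Cohomology classes as cosets of invariant polynomials\<close>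

definition coh_class :: "nat \<Rightarrow> nat \<Rightarrow> cpoly \<Rightarrow> cpoly set" where
  "coh_class n k p = coh_ideal n k +>\<^bsub>gam_inv_ring n k\<^esub> p"

lemma coh_class_eq: "coh_class n k p = {h + p | h. h \<in> coh_ideal n k}"
  by (auto simp: coh_class_def a_r_coset_def r_coset_def)

lemma coh_class_cong:
  assumes "p - q \<in> coh_ideal n k" shows "coh_class n k p = coh_class n k q"
proof -
  have "q - p \<in> coh_ideal n k"
    using coh_ideal_mult [OF assms, of "-1"] gam_inv_pconst [of "-1" n k]
    by (simp add: pconst_def single_uminus)
  have "\<exists>h'. h + p = h' + q \<and> h' \<in> coh_ideal n k" if "h \<in> coh_ideal n k" for h
    using coh_ideal_add [OF that assms] by (intro exI [of _ "h + (p - q)"]) auto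
  moreover have "\<exists>h'. h + q = h' + p \<and> h' \<in> coh_ideal n k" if "h \<in> coh_ideal n k" for h
    using coh_ideal_add [OF that \<open>q - p \<in> _\<close>] by (intro exI [of _ "h + (q - p)"]) auto
  ultimately show ?thesis unfolding coh_class_eq by blast
qed

lemma carrier_HT: "carrier (HT n k) = coh_class n k ` gam_inv n k"
  by (auto simp: HT_def Let_def FactRing_def A_RCOSETS_def RCOSETS_def coh_class_def a_r_coset_def)

lemma HT_add:
  assumes "p \<in> gam_inv n k" "q \<in> gam_inv n k"
  shows "coh_class n k p \<oplus>\<^bsub>HT n k\<^esub> coh_class n k q = coh_class n k (p + q)"
proof -
  have "abelian_subgroup (coh_ideal n k) (gam_inv_ring n k)"
    by (intro abelian_subgroupI3 ideal.axioms(1) [OF ideal_coh_ideal] ring.is_abelian_group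
        cring.axioms(1) [OF cring_gam_inv_ring])
  from abelian_subgroup.a_rcos_sum [OF this, of p q] assms show ?thesis
    by (simp add: HT_def Let_def FactRing_def coh_class_def)
qed

lemma HT_smult:
  assumes "f \<in> gam_inv n k" "p \<in> gam_inv n k"
  shows "f \<odot>\<^bsub>HT n k\<^esub> coh_class n k p = coh_class n k (f * p)"
  using ideal.rcoset_mult_add [OF ideal_coh_ideal, of f n k p] assms
  by (simp add: HT_def Let_def FactRing_def coh_class_def)

text \<open>The ideal vanishes at x_J, so the substitution is constant on the coset and
  \<open>the_elem\<close> picks that value.\<close>

lemma restr_HT_class:
  assumes "J \<in> ksubsets n k"
  shows "restr_HT n J (coh_class n k p) = rf (fixpt_eval n J p)"
proof -
  have "psubst (rf \<circ> pconst) (fixpt_val n J) ` coh_class n k p = {rf (fixpt_eval n J p)}"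
    using fixpt_eval_coh_ideal [OF _ assms] coh_ideal_zero
    by (force simp: coh_class_eq psubst_fixpt_val)
  then show ?thesis by (simp add: restr_HT_def)
qed

section \<open>Localised cohomology as formal sums modulo bilinearity\<close>

definition HTL_free :: "nat \<Rightarrow> nat \<Rightarrow> (cpoly set \<times> ratfun \<Rightarrow>\<^sub>0 int) monoid" where
  "HTL_free n k = free_Abelian_group (carrier (HT n k) \<times> Llzy n)"

definition HTL_rel :: "nat \<Rightarrow> nat \<Rightarrow> (cpoly set \<times> ratfun \<Rightarrow>\<^sub>0 int) set" where
  "HTL_rel n k = generate (HTL_free n k) (tensor_rels (Czy n) (HT n k) (Lring n))"

definition HTL_coset :: "nat \<Rightarrow> nat \<Rightarrow> (cpoly set \<times> ratfun \<Rightarrow>\<^sub>0 int) \<Rightarrow> loc_class" where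
  "HTL_coset n k c = {x + c | x. x \<in> HTL_rel n k}"

definition HTL_frags :: "nat \<Rightarrow> nat \<Rightarrow> (cpoly set \<times> ratfun \<Rightarrow>\<^sub>0 int) set" where
  "HTL_frags n k = {c. Poly_Mapping.keys c \<subseteq> carrier (HT n k) \<times> Llzy n}"

text \<open>The elementary tensor of the class of p with l, before division by the
  relations.\<close>

definition tens :: "nat \<Rightarrow> nat \<Rightarrow> cpoly \<Rightarrow> ratfun \<Rightarrow> (cpoly set \<times> ratfun \<Rightarrow>\<^sub>0 int)" where
  "tens n k p l = frag_of (coh_class n k p, l)"

lemma Lring_simps [simp]:
  "carrier (Lring n) = Llzy n" "add (Lring n) = (+)" "f \<odot>\<^bsub>Lring n\<^esub> l = rf f * l"
  "monoid.mult (Lring n) = (*)"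
  by (simp_all add: Lring_def)

lemma Czy_simps [simp]: "carrier (Czy n) = polys_in (zy_vars n)"
  by (simp add: Czy_def)

text \<open>With polynomial representatives, case distinctions on the relations deal with
  polynomials instead of cosets.\<close>

lemma tensor_rels_HTL:
  "tensor_rels (Czy n) (HT n k) (Lring n) =
     {tens n k (p + q) l - tens n k p l - tens n k q l | p q l. p \<in> gam_inv n k \<and> q \<in> gam_inv n k \<and> l \<in> Llzy n} \<union>
     {tens n k p (l + l') - tens n k p l - tens n k p l' | p l l'. p \<in> gam_inv n k \<and> l \<in> Llzy n \<and> l' \<in> Llzy n} \<union>
     {tens n k (f * p) l - tens n k p (rf f * l) | f p l. f \<in> polys_in (zy_vars n) \<and> p \<in> gam_inv n k \<and> l \<in> Llzy n}"
proof -
  have image3: "{F m m' b | m m' b. m \<in> g ` A \<and> m' \<in> g ` A \<and> b \<in> L}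
      = {F (g p) (g q) b | p q b. p \<in> A \<and> q \<in> A \<and> b \<in> L}"
    for F :: "'u \<Rightarrow> 'u \<Rightarrow> 'v \<Rightarrow> 'w" and g :: "'x \<Rightarrow> 'u" and A L by blast
  have image2: "{F r m b | r m b. r \<in> P \<and> m \<in> g ` A \<and> b \<in> L}
      = {F r (g p) b | r p b. r \<in> P \<and> p \<in> A \<and> b \<in> L}"
    for F :: "'y \<Rightarrow> 'u \<Rightarrow> 'v \<Rightarrow> 'w" and g :: "'x \<Rightarrow> 'u" and A L P by blast
  have "{frag_of (m \<oplus>\<^bsub>HT n k\<^esub> m', b) - frag_of (m, b) - frag_of (m', b)
        | m m' b. m \<in> carrier (HT n k) \<and> m' \<in> carrier (HT n k) \<and> b \<in> Llzy n}
    = {tens n k (p + q) l - tens n k p l - tens n k q l | p q l. p \<in> gam_inv n k \<and> q \<in> gam_inv n k \<and> l \<in> Llzy n}"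
    unfolding carrier_HT tens_def image3 by (simp add: HT_add cong: rev_conj_cong)
  moreover have "{frag_of (m, b + b') - frag_of (m, b) - frag_of (m, b')
        | m b b'. m \<in> carrier (HT n k) \<and> b \<in> Llzy n \<and> b' \<in> Llzy n}
    = {tens n k p (l + l') - tens n k p l - tens n k p l' | p l l'. p \<in> gam_inv n k \<and> l \<in> Llzy n \<and> l' \<in> Llzy n}"
    unfolding carrier_HT tens_def by auto
  moreover have "{frag_of (r \<odot>\<^bsub>HT n k\<^esub> m, b) - frag_of (m, rf r * b)
        | r m b. r \<in> polys_in (zy_vars n) \<and> m \<in> carrier (HT n k) \<and> b \<in> Llzy n}
    = {tens n k (f * p) l - tens n k p (rf f * l) | f p l. f \<in> polys_in (zy_vars n) \<and> p \<in> gam_inv n k \<and> l \<in> Llzy n}"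
    unfolding carrier_HT tens_def image2 by (simp add: HT_smult gam_inv_zy cong: rev_conj_cong)
  ultimately show ?thesis unfolding tensor_rels_def by simp
qed

lemma tens_in_frags: "p \<in> gam_inv n k \<Longrightarrow> l \<in> Llzy n \<Longrightarrow> tens n k p l \<in> HTL_frags n k"
  by (auto simp: tens_def carrier_HT HTL_frags_def)

lemma frags_add: "c \<in> HTL_frags n k \<Longrightarrow> d \<in> HTL_frags n k \<Longrightarrow> c + d \<in> HTL_frags n k"
  using keys_add [of c d] unfolding HTL_frags_def by blast

lemma frags_diff: "c \<in> HTL_frags n k \<Longrightarrow> d \<in> HTL_frags n k \<Longrightarrow> c - d \<in> HTL_frags n k"
  using keys_diff [of c d] unfolding HTL_frags_def by blast

lemma frags_zero: "0 \<in> HTL_frags n k"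
  by (simp add: HTL_frags_def)

lemma frags_uminus: "c \<in> HTL_frags n k \<Longrightarrow> - c \<in> HTL_frags n k"
  by (simp add: HTL_frags_def)

lemma tensor_rels_in_frags: "tensor_rels (Czy n) (HT n k) (Lring n) \<subseteq> HTL_frags n k"
  unfolding tensor_rels_HTL
  using Llzy_add Llzy_mult Llzy_poly gam_inv_add gam_inv_mult gam_inv_zy
  by (auto intro!: frags_diff tens_in_frags)

lemma comm_group_HTL_free: "comm_group (HTL_free n k)"
  unfolding HTL_free_def by (rule abelian_free_Abelian_group)

lemma HTL_free_simps [simp]:
  "carrier (HTL_free n k) = HTL_frags n k" "monoid.mult (HTL_free n k) = (+)" "\<one>\<^bsub>HTL_free n k\<^esub> = 0"
  by (auto simp: HTL_free_def free_Abelian_group_def HTL_frags_def)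

lemma subgroup_HTL_rel: "subgroup (HTL_rel n k) (HTL_free n k)"
proof -
  interpret comm_group "HTL_free n k" by (rule comm_group_HTL_free)
  show ?thesis unfolding HTL_rel_def
    using tensor_rels_in_frags by (intro generate_is_subgroup) auto
qed

lemma HTL_rel_zero: "0 \<in> HTL_rel n k"
  using subgroup.one_closed [OF subgroup_HTL_rel] by simp

lemma HTL_rel_add: "c \<in> HTL_rel n k \<Longrightarrow> d \<in> HTL_rel n k \<Longrightarrow> c + d \<in> HTL_rel n k"
  using subgroup.m_closed [OF subgroup_HTL_rel] by simp

lemma HTL_rel_frags: "c \<in> HTL_rel n k \<Longrightarrow> c \<in> HTL_frags n k"
  using subgroup.subset [OF subgroup_HTL_rel] by auto

lemma HTL_rel_uminus: "c \<in> HTL_rel n k \<Longrightarrow> - c \<in> HTL_rel n k"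
  using subgroup.m_inv_closed [OF subgroup_HTL_rel, of c n k] HTL_rel_frags [of c n k]
  by (simp add: HTL_free_def HTL_frags_def)

lemma HTL_rel_diff: "c \<in> HTL_rel n k \<Longrightarrow> d \<in> HTL_rel n k \<Longrightarrow> c - d \<in> HTL_rel n k"
  using HTL_rel_add [of c n k "- d"] HTL_rel_uminus by simp

lemma HTL_rel_incl: "c \<in> tensor_rels (Czy n) (HT n k) (Lring n) \<Longrightarrow> c \<in> HTL_rel n k"
  unfolding HTL_rel_def by (rule generate.incl)

lemma r_coset_HTL: "HTL_rel n k #>\<^bsub>HTL_free n k\<^esub> c = HTL_coset n k c"
  by (auto simp: r_coset_def HTL_coset_def)

lemma HTL_coset_eq_iff: "HTL_coset n k c = HTL_coset n k d \<longleftrightarrow> c - d \<in> HTL_rel n k"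
proof
  assume "HTL_coset n k c = HTL_coset n k d"
  moreover have "c \<in> HTL_coset n k c" using HTL_rel_zero [of n k] by (force simp: HTL_coset_def)
  ultimately obtain x where "c = x + d" "x \<in> HTL_rel n k" by (auto simp: HTL_coset_def)
  then show "c - d \<in> HTL_rel n k" by simp
next
  assume *: "c - d \<in> HTL_rel n k"
  have "\<exists>x'. x + c = x' + d \<and> x' \<in> HTL_rel n k" if "x \<in> HTL_rel n k" for x
    using HTL_rel_add [OF that *] by (intro exI [of _ "x + (c - d)"]) simp
  moreover have "\<exists>x'. x + d = x' + c \<and> x' \<in> HTL_rel n k" if "x \<in> HTL_rel n k" for x
    using HTL_rel_diff [OF that *] by (intro exI [of _ "x - (c - d)"]) simp
  ultimately show "HTL_coset n k c = HTL_coset n k d" unfolding HTL_coset_def by blast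
qed

lemma carrier_HTL: "carrier (HTL n k) = HTL_coset n k ` HTL_frags n k"
  by (simp add: HTL_def ext_scalars_def Let_def carrier_FactGroup r_coset_HTL
      flip: HTL_free_def HTL_rel_def)

lemma HTL_zero: "\<zero>\<^bsub>HTL n k\<^esub> = HTL_coset n k 0"
  by (simp add: HTL_def ext_scalars_def Let_def HTL_coset_def flip: HTL_free_def HTL_rel_def)

lemma HTL_add:
  assumes "c \<in> HTL_frags n k" "d \<in> HTL_frags n k"
  shows "HTL_coset n k c \<oplus>\<^bsub>HTL n k\<^esub> HTL_coset n k d = HTL_coset n k (c + d)"
proof -
  interpret comm_group "HTL_free n k" by (rule comm_group_HTL_free)
  have "HTL_rel n k \<lhd> HTL_free n k" using subgroup_HTL_rel by (rule subgroup_imp_normal)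
  from normal.rcos_sum [OF this, of c d] assms show ?thesis
    by (simp add: HTL_def ext_scalars_def Let_def r_coset_HTL flip: HTL_free_def HTL_rel_def)
qed

lemma abelian_group_HTL: "abelian_group (HTL n k)"
proof (rule abelian_groupI)
  fix x assume "x \<in> carrier (HTL n k)"
  then obtain c where c: "x = HTL_coset n k c" "c \<in> HTL_frags n k" by (auto simp: carrier_HTL)
  then have "HTL_coset n k (- c) \<in> carrier (HTL n k)" by (auto simp: carrier_HTL frags_uminus)
  moreover have "HTL_coset n k (- c) \<oplus>\<^bsub>HTL n k\<^esub> x = \<zero>\<^bsub>HTL n k\<^esub>"
    using c by (simp add: HTL_add HTL_zero frags_uminus)
  ultimately show "\<exists>y\<in>carrier (HTL n k). y \<oplus>\<^bsub>HTL n k\<^esub> x = \<zero>\<^bsub>HTL n k\<^esub>" by blast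
qed (auto simp: carrier_HTL HTL_add HTL_zero add_ac frags_add frags_zero)

definition scal :: "ratfun \<Rightarrow> (cpoly set \<times> ratfun \<Rightarrow>\<^sub>0 int) \<Rightarrow> (cpoly set \<times> ratfun \<Rightarrow>\<^sub>0 int)" where
  "scal b = frag_extend (\<lambda>(m, b'). frag_of (m, b * b'))"

lemma scal_add: "scal b (c + d) = scal b c + scal b d"
  by (simp add: scal_def frag_extend_add)

lemma scal_diff: "scal b (c - d) = scal b c - scal b d"
  by (simp add: scal_def frag_extend_diff)

lemma scal_uminus: "scal b (- c) = - scal b c"
  by (simp add: scal_def frag_extend_minus)

lemma scal_tens: "scal b (tens n k p l) = tens n k p (b * l)"
  by (simp add: scal_def tens_def)

lemma scal_frags:
  assumes "b \<in> Llzy n" "c \<in> HTL_frags n k" shows "scal b c \<in> HTL_frags n k"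
proof -
  have "Poly_Mapping.keys (scal b c) \<subseteq> (\<Union>x\<in>Poly_Mapping.keys c. Poly_Mapping.keys ((\<lambda>(m, b'). frag_of (m, b * b')) x :: _ \<Rightarrow>\<^sub>0 int))"
    unfolding scal_def by (rule keys_frag_extend)
  also have "\<dots> \<subseteq> carrier (HT n k) \<times> Llzy n"
    using assms by (fastforce simp: HTL_frags_def intro: Llzy_mult)
  finally show ?thesis by (simp add: HTL_frags_def)
qed

text \<open>Each family of relations is mapped into itself, because b only multiplies second
  components. Hence the scalar action of \<open>ext_scalars\<close>, a union over all
  representatives, is a single coset (\<open>HTL_smult\<close>).\<close>

lemma scal_rel:
  assumes b: "b \<in> Llzy n" and c: "c \<in> HTL_rel n k" shows "scal b c \<in> HTL_rel n k"
proof -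
  have rels: "scal b c \<in> tensor_rels (Czy n) (HT n k) (Lring n)"
    if "c \<in> tensor_rels (Czy n) (HT n k) (Lring n)" for c
    using that [unfolded tensor_rels_HTL]
  proof (elim UnE CollectE exE conjE)
    fix p q l
    assume *: "c = tens n k (p + q) l - tens n k p l - tens n k q l" "p \<in> gam_inv n k" "q \<in> gam_inv n k" "l \<in> Llzy n"
    then have "scal b c = tens n k (p + q) (b * l) - tens n k p (b * l) - tens n k q (b * l)"
      by (simp add: scal_diff scal_tens)
    then show "scal b c \<in> tensor_rels (Czy n) (HT n k) (Lring n)"
      unfolding tensor_rels_HTL using * Llzy_mult [OF b] by blast
  next
    fix p l l'
    assume *: "c = tens n k p (l + l') - tens n k p l - tens n k p l'" "p \<in> gam_inv n k" "l \<in> Llzy n" "l' \<in> Llzy n"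
    then have "scal b c = tens n k p (b * l + b * l') - tens n k p (b * l) - tens n k p (b * l')"
      by (simp add: scal_diff scal_tens ring_distribs)
    then show "scal b c \<in> tensor_rels (Czy n) (HT n k) (Lring n)"
      unfolding tensor_rels_HTL using * Llzy_mult [OF b] by blast
  next
    fix f p l
    assume *: "c = tens n k (f * p) l - tens n k p (rf f * l)" "f \<in> polys_in (zy_vars n)" "p \<in> gam_inv n k" "l \<in> Llzy n"
    then have "scal b c = tens n k (f * p) (b * l) - tens n k p (rf f * (b * l))"
      by (simp add: scal_diff scal_tens mult.left_commute)
    then show "scal b c \<in> tensor_rels (Czy n) (HT n k) (Lring n)"
      unfolding tensor_rels_HTL using * Llzy_mult [OF b] by blast
  qed
  show ?thesis using c unfolding HTL_rel_def
  proof (induction c rule: generate.induct)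
    case one
    then show ?case by (simp add: scal_def generate.one [of "HTL_free n k", simplified])
  next
    case (incl h)
    then show ?case by (intro generate.incl rels)
  next
    case (inv h)
    then have "h \<in> HTL_frags n k" using tensor_rels_in_frags by blast
    then have "inv\<^bsub>HTL_free n k\<^esub> h = - h" by (simp add: HTL_free_def HTL_frags_def)
    then show ?case
      using HTL_rel_uminus [OF HTL_rel_incl [OF rels [OF inv]]] by (simp add: scal_uminus HTL_rel_def)
  next
    case (eng h1 h2)
    then show ?case using HTL_rel_add by (simp add: scal_add HTL_rel_def)
  qed
qed

lemma HTL_smult:
  assumes b: "b \<in> Llzy n"
  shows "b \<odot>\<^bsub>HTL n k\<^esub> HTL_coset n k c = HTL_coset n k (scal b c)"
proof -
  have "b \<odot>\<^bsub>HTL n k\<^esub> HTL_coset n k c = (\<Union>d\<in>HTL_coset n k c. HTL_coset n k (scal b d))"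
    by (simp add: HTL_def ext_scalars_def Let_def r_coset_HTL scal_def flip: HTL_free_def HTL_rel_def)
  moreover have "HTL_coset n k (scal b d) = HTL_coset n k (scal b c)" if "d \<in> HTL_coset n k c" for d
    using that scal_rel [OF b] by (auto simp: HTL_coset_def [of n k c] HTL_coset_eq_iff scal_add)
  moreover have "c \<in> HTL_coset n k c" using HTL_rel_zero [of n k] by (force simp: HTL_coset_def)
  ultimately show ?thesis by blast
qed

section \<open>Restriction of localised classes\<close>

definition frag_restr :: "nat \<Rightarrow> nat set \<Rightarrow> (cpoly set \<times> ratfun \<Rightarrow>\<^sub>0 int) \<Rightarrow> ratfun" where
  "frag_restr n J c = (\<Sum>(h, l)\<in>Poly_Mapping.keys c.
     of_int (Poly_Mapping.lookup c (h, l)) * (restr_HT n J h * l))"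

lemma frag_restr_add: "frag_restr n J (c + d) = frag_restr n J c + frag_restr n J d"
  unfolding frag_restr_def split_def
  using setsum_keys_plus_distrib [of "\<lambda>x v. of_int v * (restr_HT n J (fst x) * snd x)" c d]
  by (simp add: ring_distribs)

lemma frag_restr_uminus: "frag_restr n J (- c) = - frag_restr n J c"
  by (simp add: frag_restr_def split_def sum_negf)

lemma frag_restr_diff: "frag_restr n J (c - d) = frag_restr n J c - frag_restr n J d"
  using frag_restr_add [of n J c "- d"] by (simp add: frag_restr_uminus)

lemma frag_restr_zero [simp]: "frag_restr n J 0 = 0"
  by (simp add: frag_restr_def)

lemma frag_restr_sum: "frag_restr n J (sum f A) = (\<Sum>i\<in>A. frag_restr n J (f i))"
  by (induction A rule: infinite_finite_induct) (auto simp: frag_restr_add)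

lemma frag_restr_frag_of: "frag_restr n J (frag_of (h, l)) = restr_HT n J h * l"
  by (simp add: frag_restr_def)

lemma frag_restr_tens:
  "J \<in> ksubsets n k \<Longrightarrow> frag_restr n J (tens n k p l) = rf (fixpt_eval n J p) * l"
  by (simp add: tens_def frag_restr_frag_of restr_HT_class)

lemma frag_restr_scal: "frag_restr n J (scal b c) = b * frag_restr n J c"
proof -
  have "Poly_Mapping.keys c \<subseteq> UNIV" by simp
  then show ?thesis
  proof (induction c rule: frag_induction)
    case (one x)
    then show ?case by (cases x rule: prod.exhaust) (simp add: scal_def frag_restr_frag_of mult_ac)
  qed (simp_all add: scal_diff frag_restr_diff ring_distribs, simp add: scal_def)
qed

text \<open>Restriction is additive in both components. For the relations that move f across the
  tensor sign it matters that the substitution leaves polynomials in z and y unchanged.\<close>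

lemma frag_restr_rel:
  assumes J: "J \<in> ksubsets n k" and c: "c \<in> HTL_rel n k" shows "frag_restr n J c = 0"
proof -
  have rels: "frag_restr n J c = 0" if "c \<in> tensor_rels (Czy n) (HT n k) (Lring n)" for c
    using that unfolding tensor_rels_HTL
    by (auto simp: frag_restr_diff frag_restr_tens [OF J] ring_distribs fixpt_eval_zy mult_ac)
  show ?thesis using c unfolding HTL_rel_def
  proof (induction c rule: generate.induct)
    case (inv h)
    then have "h \<in> HTL_frags n k" using tensor_rels_in_frags by blast
    then have "inv\<^bsub>HTL_free n k\<^esub> h = - h" by (simp add: HTL_free_def HTL_frags_def)
    then show ?case using rels [OF inv] by (simp add: frag_restr_uminus)
  qed (simp_all add: rels frag_restr_add)
qed

lemma restr_HTL_coset:
  assumes "J \<in> ksubsets n k"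
  shows "restr_HTL n J (HTL_coset n k c) = frag_restr n J c"
proof -
  have "frag_restr n J ` HTL_coset n k c = {frag_restr n J c}"
    using HTL_rel_zero [of n k] by (force simp: HTL_coset_def frag_restr_add frag_restr_rel [OF assms])
  then show ?thesis by (simp add: restr_HTL_def frag_restr_def [abs_def])
qed

text \<open>Equalities in the tensor product are expressed by differences lying in
  \<open>HTL_rel\<close>; \<open>rel_trans\<close> chains them.\<close>

lemma tens_add1:
  "p \<in> gam_inv n k \<Longrightarrow> q \<in> gam_inv n k \<Longrightarrow> l \<in> Llzy n \<Longrightarrow>
     tens n k (p + q) l - (tens n k p l + tens n k q l) \<in> HTL_rel n k"
  by (intro HTL_rel_incl) (force simp: tensor_rels_HTL diff_diff_add)

lemma tens_add2:
  "p \<in> gam_inv n k \<Longrightarrow> l \<in> Llzy n \<Longrightarrow> l' \<in> Llzy n \<Longrightarrow>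
     tens n k p (l + l') - (tens n k p l + tens n k p l') \<in> HTL_rel n k"
  by (intro HTL_rel_incl) (force simp: tensor_rels_HTL diff_diff_add)

lemma tens_smult:
  "f \<in> polys_in (zy_vars n) \<Longrightarrow> p \<in> gam_inv n k \<Longrightarrow> l \<in> Llzy n \<Longrightarrow>
     tens n k (f * p) l - tens n k p (rf f * l) \<in> HTL_rel n k"
  by (intro HTL_rel_incl) (force simp: tensor_rels_HTL)

lemma tens_sum1:
  assumes "finite A" "\<And>i. i \<in> A \<Longrightarrow> p i \<in> gam_inv n k" "l \<in> Llzy n"
  shows "tens n k (sum p A) l - (\<Sum>i\<in>A. tens n k (p i) l) \<in> HTL_rel n k"
  using assms
proof (induction A rule: finite_induct)
  case empty
  have "tens n k (0 + 0) l - (tens n k 0 l + tens n k 0 l) \<in> HTL_rel n k"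
    using empty by (intro tens_add1 gam_inv_zy) auto
  from HTL_rel_uminus [OF this] show ?case by simp
next
  case (insert i A)
  have "tens n k (p i + sum p A) l - (tens n k (p i) l + tens n k (sum p A) l) \<in> HTL_rel n k"
    using insert by (intro tens_add1 gam_inv_sum) auto
  moreover have "tens n k (sum p A) l - (\<Sum>i\<in>A. tens n k (p i) l) \<in> HTL_rel n k"
    using insert by auto
  ultimately have "(tens n k (p i + sum p A) l - (tens n k (p i) l + tens n k (sum p A) l))
      + (tens n k (sum p A) l - (\<Sum>i\<in>A. tens n k (p i) l)) \<in> HTL_rel n k"
    by (rule HTL_rel_add)
  then show ?case using insert by (simp add: algebra_simps)
qed

lemma HTL_rel_sum: "(\<And>i. i \<in> A \<Longrightarrow> f i \<in> HTL_rel n k) \<Longrightarrow> sum f A \<in> HTL_rel n k"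
  by (induction A rule: infinite_finite_induct) (auto intro: HTL_rel_add HTL_rel_zero)

lemma rel_trans: "c - d \<in> HTL_rel n k \<Longrightarrow> d - e \<in> HTL_rel n k \<Longrightarrow> c - e \<in> HTL_rel n k"
  using HTL_rel_add [of "c - d" n k "d - e"] by simp

text \<open>A formal sum whose restriction to x_J is x J: the value \<open>disc\<close> of
  \<open>fixpt_class\<close> is divided out in the second component.\<close>

definition fixpt_lift :: "nat \<Rightarrow> nat \<Rightarrow> (nat set \<Rightarrow> ratfun) \<Rightarrow> (cpoly set \<times> ratfun \<Rightarrow>\<^sub>0 int)" where
  "fixpt_lift n k x = (\<Sum>J\<in>ksubsets n k. tens n k (fixpt_class n k J) (x J / rf (disc n)))"

text \<open>With E a power of \<open>disc\<close>, p \<otimes> l equals (E p) \<otimes> (l / E). The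
  expansion of E p holds in cohomology itself, and afterwards all polynomial coefficients move back
  to the second component.\<close>

lemma tens_expansion:
  assumes p: "p \<in> gam_inv n k" and l: "l \<in> Llzy n" and k: "k \<le> n"
  shows "tens n k p l - fixpt_lift n k (\<lambda>J. rf (fixpt_eval n J p) * l) \<in> HTL_rel n k"
proof -
  obtain N where N: "disc n ^ N * (disc n * p - (\<Sum>J\<in>ksubsets n k. fixpt_eval n J p * fixpt_class n k J))
      \<in> coh_ideal n k" (is "disc n ^ N * (_ - ?s) \<in> _")
    using fixpt_expansion [OF p k] by blast
  \<comment> \<open>One power more than saturation requires, since \<open>fixpt_expansion\<close>
    expands \<open>disc\<close> times p.\<close>
  define E where "E = disc n ^ Suc N"
  have ev: "fixpt_eval n J p \<in> polys_in (zy_vars n)" if "J \<in> ksubsets n k" for J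
    using that p by (intro fixpt_eval_in_polys) (auto simp: gam_inv_iff)
  have Ein: "E \<in> polys_in (zy_vars n)" unfolding E_def by (intro power_in_polys disc_in_polys)
  define l' where "l' = l / rf E"
  have rfE: "rf E \<noteq> 0" by (simp only: E_def rf_power) (simp add: rf_disc_nonzero del: rf_eq_0_iff)
  have "inverse (rf E) = inverse (rf (disc n)) ^ Suc N"
    unfolding E_def by (simp only: rf_power power_inverse)
  then have l': "l' \<in> Llzy n" unfolding l'_def
    using l by (metis Llzy_divide Llzy_power Llzy_inverse_disc)
  have "E * p - disc n ^ N * ?s \<in> coh_ideal n k" using N by (simp add: E_def algebra_simps)
  then have class_eq: "tens n k (E * p) l' = tens n k (\<Sum>J\<in>ksubsets n k. (disc n ^ N * fixpt_eval n J p) * fixpt_class n k J) l'"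
    unfolding tens_def sum_distrib_left mult.assoc by (simp add: coh_class_cong)
  have "tens n k (E * p) l' - tens n k p (rf E * l') \<in> HTL_rel n k"
    by (intro tens_smult Ein p l')
  moreover have "rf E * l' = l" using rfE by (simp add: l'_def)
  ultimately have 1: "tens n k p l - tens n k (E * p) l' \<in> HTL_rel n k"
    using HTL_rel_uminus by fastforce
  have 2: "tens n k (\<Sum>J\<in>ksubsets n k. (disc n ^ N * fixpt_eval n J p) * fixpt_class n k J) l'
      - (\<Sum>J\<in>ksubsets n k. tens n k ((disc n ^ N * fixpt_eval n J p) * fixpt_class n k J) l') \<in> HTL_rel n k"
    by (intro tens_sum1 l' finite_ksubsets gam_inv_mult gam_inv_zy ev fixpt_class_gam_inv power_in_polys disc_in_polys)
  have 3: "(\<Sum>J\<in>ksubsets n k. tens n k ((disc n ^ N * fixpt_eval n J p) * fixpt_class n k J) l'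
      - tens n k (fixpt_class n k J) (rf (disc n ^ N * fixpt_eval n J p) * l')) \<in> HTL_rel n k"
    by (intro HTL_rel_sum tens_smult l' mult_in_polys ev fixpt_class_gam_inv power_in_polys disc_in_polys)
  have "rf (disc n ^ N * fixpt_eval n J p) * l' = rf (fixpt_eval n J p) * l / rf (disc n)" for J
  proof -
    have "rf (disc n) \<noteq> 0" by (rule rf_disc_nonzero)
    then show ?thesis by (simp add: l'_def E_def del: rf_eq_0_iff)
  qed
  with 3 have 4: "(\<Sum>J\<in>ksubsets n k. tens n k ((disc n ^ N * fixpt_eval n J p) * fixpt_class n k J) l')
      - fixpt_lift n k (\<lambda>J. rf (fixpt_eval n J p) * l) \<in> HTL_rel n k"
    by (simp add: fixpt_lift_def sum_subtractf)
  show ?thesis using rel_trans [OF 1 [unfolded class_eq] rel_trans [OF 2 4]] .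
qed

lemma Llzy_frag_restr:
  assumes J: "J \<in> ksubsets n k" and c: "c \<in> HTL_frags n k"
  shows "frag_restr n J c \<in> Llzy n"
  unfolding frag_restr_def
proof (intro Llzy_sum, clarify)
  fix h l assume "(h, l) \<in> Poly_Mapping.keys c"
  with c obtain p where *: "h = coh_class n k p" "p \<in> gam_inv n k" "l \<in> Llzy n"
    by (auto simp: carrier_HT HTL_frags_def)
  have "fixpt_eval n J p \<in> polys_in (zy_vars n)"
    using J * by (intro fixpt_eval_in_polys) (auto simp: gam_inv_iff)
  with * show "of_int (Poly_Mapping.lookup c (h, l)) * (restr_HT n J h * l) \<in> Llzy n"
    by (auto simp: restr_HT_class [OF J] intro!: Llzy_intros Llzy_poly)
qed

text \<open>\<open>tens_expansion\<close> extends to formal sums by additivity. However,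
  \<open>fixpt_lift\<close> is additive only modulo \<open>HTL_rel\<close>, because tensors with
  different second components are independent generators; \<open>lift_diff\<close> accounts for
  this.\<close>

lemma frag_expansion_fixpt:
  assumes k: "k \<le> n" and c: "c \<in> HTL_frags n k"
  shows "c - fixpt_lift n k (\<lambda>J. frag_restr n J c) \<in> HTL_rel n k"
proof -
  have lift_diff: "fixpt_lift n k (\<lambda>J. x J - y J) - (fixpt_lift n k x - fixpt_lift n k y) \<in> HTL_rel n k"
    if "\<And>J. J \<in> ksubsets n k \<Longrightarrow> x J \<in> Llzy n" "\<And>J. J \<in> ksubsets n k \<Longrightarrow> y J \<in> Llzy n" for x y
  proof -
    have "(\<Sum>J\<in>ksubsets n k.
        - (tens n k (fixpt_class n k J) ((x J - y J) / rf (disc n) + y J / rf (disc n))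
            - (tens n k (fixpt_class n k J) ((x J - y J) / rf (disc n)) + tens n k (fixpt_class n k J) (y J / rf (disc n)))))
          \<in> HTL_rel n k"
      using that by (intro HTL_rel_sum HTL_rel_uminus tens_add2 fixpt_class_gam_inv Llzy_divide Llzy_diff Llzy_inverse_disc)
    then show ?thesis
      by (simp add: fixpt_lift_def add_divide_distrib [symmetric] sum_subtractf sum.distrib algebra_simps
        del: sum_subtractf) (simp add: algebra_simps sum_subtractf sum.distrib)
  qed
  from c have "Poly_Mapping.keys c \<subseteq> carrier (HT n k) \<times> Llzy n" by (simp add: HTL_frags_def)
  then have "c \<in> HTL_frags n k \<and> c - fixpt_lift n k (\<lambda>J. frag_restr n J c) \<in> HTL_rel n k"
  proof (induction c rule: frag_induction)
    case zero
    have "(0::cpoly set \<times> ratfun \<Rightarrow>\<^sub>0 int) - fixpt_lift n k (\<lambda>J. 0) \<in> HTL_rel n k"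
      using lift_diff [of "\<lambda>_. 0" "\<lambda>_. 0"] HTL_rel_uminus Llzy_zero by fastforce
    then show ?case by (simp add: frags_zero)
  next
    case (one x)
    then obtain p l where x: "x = (coh_class n k p, l)" "p \<in> gam_inv n k" "l \<in> Llzy n"
      by (auto simp: carrier_HT HTL_frags_def)
    have "fixpt_lift n k (\<lambda>J. frag_restr n J (tens n k p l)) = fixpt_lift n k (\<lambda>J. rf (fixpt_eval n J p) * l)"
      unfolding fixpt_lift_def by (simp add: frag_restr_tens)
    then show ?case using tens_expansion [OF x(2,3) k] tens_in_frags [OF x(2,3)] x by (simp add: tens_def)
  next
    case (diff a b)
    let ?L = "\<lambda>c. fixpt_lift n k (\<lambda>J. frag_restr n J c)"
    have a: "a \<in> HTL_frags n k" "a - ?L a \<in> HTL_rel n k" and b: "b \<in> HTL_frags n k" "b - ?L b \<in> HTL_rel n k"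
      using diff by auto
    have "?L (a - b) - (?L a - ?L b) \<in> HTL_rel n k"
      using lift_diff [of "\<lambda>J. frag_restr n J a" "\<lambda>J. frag_restr n J b"] Llzy_frag_restr a b
      by (simp add: frag_restr_diff)
    from HTL_rel_diff [OF HTL_rel_diff [OF a(2) b(2)] this]
    show ?case using frags_diff [OF a(1) b(1)] by (simp add: algebra_simps)
  qed
  then show ?thesis by blast
qed

text \<open>The coefficients in the expansion of a class are its restrictions.\<close>

lemma restr_HTL_inj:
  assumes k: "k \<le> n" and x: "x \<in> carrier (HTL n k)" and y: "y \<in> carrier (HTL n k)"
    and eq: "\<And>J. J \<in> ksubsets n k \<Longrightarrow> restr_HTL n J x = restr_HTL n J y"
  shows "x = y"
proof -
  obtain c d where cd: "x = HTL_coset n k c" "c \<in> HTL_frags n k" "y = HTL_coset n k d" "d \<in> HTL_frags n k"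
    using x y by (auto simp: carrier_HTL)
  have "fixpt_lift n k (\<lambda>J. frag_restr n J c) = fixpt_lift n k (\<lambda>J. frag_restr n J d)"
    unfolding fixpt_lift_def using eq cd by (simp add: restr_HTL_coset)
  then have "c - d \<in> HTL_rel n k"
    using HTL_rel_diff [OF frag_expansion_fixpt [OF k cd(2)] frag_expansion_fixpt [OF k cd(4)]] by simp
  then show ?thesis using cd by (simp add: HTL_coset_eq_iff)
qed

lemma restr_HTL_surj:
  assumes f: "\<And>J. J \<in> ksubsets n k \<Longrightarrow> f J \<in> Llzy n"
  shows "\<exists>x\<in>carrier (HTL n k). \<forall>J\<in>ksubsets n k. restr_HTL n J x = f J"
proof
  have "fixpt_lift n k f \<in> HTL_frags n k"
    unfolding fixpt_lift_def HTL_frags_def mem_Collect_eq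
    using f by (intro order_trans [OF keys_sum] UN_least tens_in_frags [unfolded HTL_frags_def mem_Collect_eq]
        fixpt_class_gam_inv Llzy_divide Llzy_inverse_disc)
  then show "HTL_coset n k (fixpt_lift n k f) \<in> carrier (HTL n k)"
    by (simp add: carrier_HTL)
  show "\<forall>J\<in>ksubsets n k. restr_HTL n J (HTL_coset n k (fixpt_lift n k f)) = f J"
  proof
    fix J assume J: "J \<in> ksubsets n k"
    have "restr_HTL n J (HTL_coset n k (fixpt_lift n k f))
        = (\<Sum>K\<in>ksubsets n k. if K = J then f J else 0)"
      unfolding restr_HTL_coset [OF J] fixpt_lift_def frag_restr_sum frag_restr_tens [OF J]
      using rf_disc_nonzero by (intro sum.cong refl) (auto simp: fixpt_eval_class J)
    also have "\<dots> = f J" using J by simp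
    finally show "restr_HTL n J (HTL_coset n k (fixpt_lift n k f)) = f J" .
  qed
qed

lemma HTL_smult_closed:
  assumes "b \<in> Llzy n" "x \<in> carrier (HTL n k)"
  shows "b \<odot>\<^bsub>HTL n k\<^esub> x \<in> carrier (HTL n k)"
  using assms scal_frags [of b n _ k] by (auto simp: carrier_HTL HTL_smult)

lemma restr_HTL_smult:
  assumes "J \<in> ksubsets n k" "b \<in> Llzy n" "x \<in> carrier (HTL n k)"
  shows "restr_HTL n J (b \<odot>\<^bsub>HTL n k\<^esub> x) = b * restr_HTL n J x"
  using assms by (auto simp: carrier_HTL HTL_smult restr_HTL_coset frag_restr_scal)

lemma restr_HTL_finsum:
  assumes J: "J \<in> ksubsets n k" and "finite A" and "\<And>i. i \<in> A \<Longrightarrow> f i \<in> carrier (HTL n k)"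
  shows "restr_HTL n J (finsum (HTL n k) f A) = (\<Sum>i\<in>A. restr_HTL n J (f i))"
  using assms(2,3)
proof (induction A rule: finite_induct)
  case empty
  interpret abelian_group "HTL n k" by (rule abelian_group_HTL)
  show ?case by (simp add: HTL_zero restr_HTL_coset [OF J])
next
  case (insert i A)
  interpret abelian_group "HTL n k" by (rule abelian_group_HTL)
  have "finsum (HTL n k) f A \<in> carrier (HTL n k)" using insert by (intro finsum_closed) auto
  moreover have "restr_HTL n J (x \<oplus>\<^bsub>HTL n k\<^esub> y) = restr_HTL n J x + restr_HTL n J y"
    if "x \<in> carrier (HTL n k)" "y \<in> carrier (HTL n k)" for x y
    using that by (auto simp: carrier_HTL HTL_add restr_HTL_coset [OF J] frag_restr_add)
  ultimately show ?case using insert by (simp add: finsum_insert Pi_iff)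
qed

section \<open>Exchange relations for weight functions\<close>

lemma kth_strict_mono:
  assumes "1 \<le> r" "r < s" "s \<le> card J" shows "kth J r < kth J s"
proof -
  have "sorted_wrt (<) (sorted_list_of_set J)" by (rule strict_sorted_list_of_set)
  then show ?thesis unfolding kth_def using assms
    by (intro sorted_wrt_nth_less [where P = "(<)"]) auto
qed

lemma kth_image:
  assumes J: "finite J" and mono: "strict_mono_on J f" and r: "r \<in> {1..card J}"
  shows "kth (f ` J) r = f (kth J r)"
proof -
  have inj: "inj_on f J" using mono by (rule strict_mono_on_imp_inj_on)
  have "sorted_wrt (<) (map f (sorted_list_of_set J))"
    unfolding sorted_wrt_map
    by (rule sorted_wrt_mono_rel [OF _ strict_sorted_list_of_set [of J]])
      (use mono J in \<open>auto simp: strict_mono_on_def\<close>)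
  then have "sorted_list_of_set (f ` J) = map f (sorted_list_of_set J)"
    using J by (intro sorted_distinct_set_unique) (auto simp: strict_sorted_iff)
  moreover have "r - 1 < length (sorted_list_of_set J)" using r by auto
  ultimately show ?thesis by (simp add: kth_def)
qed

text \<open>Explains why a weight function is unchanged if both a and a + 1 lie in its index set: x
  and x' are the variables of the two rows, p = z_a and q = z_(a+1). One summand alone is not
  symmetric in p and q, but its antisymmetrisation in x and x' is.\<close>

lemma two_row_exchange:
  fixes x x' p q \<Lambda> y :: "'f::comm_ring"
  shows "(\<Lambda> - y + x - p) * (x - q) * ((x' - p + y) * (\<Lambda> + x' - q)) * (x - x' + y)
   - (\<Lambda> - y + x' - p) * (x' - q) * ((x - p + y) * (\<Lambda> + x - q)) * (x' - x + y)
  = (\<Lambda> - y + x - q) * (x - p) * ((x' - q + y) * (\<Lambda> + x' - p)) * (x - x' + y)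
   - (\<Lambda> - y + x' - q) * (x' - p) * ((x - q + y) * (\<Lambda> + x - p)) * (x' - x + y)"
proof -
  \<comment> \<open>With a = x - p, b = x - q, d = x - x', the factors are regrouped so that,
    besides d + y or y - d, one contains only a and d and the other only b and d.\<close>
  have expand: "(\<Lambda> - y + a) * b * ((a - d + y) * (\<Lambda> + (b - d))) * (d + y)
      - (\<Lambda> - y + (a - d)) * (b - d) * ((a + y) * (\<Lambda> + b)) * (y - d)
    = (a * (a - d) + y * d + \<Lambda> * (a - d) + y * (\<Lambda> - y)) * (b * (b - d) + \<Lambda> * b) * (d + y)
      - (a * (a - d) - y * d + \<Lambda> * a + y * (\<Lambda> - y)) * (b * (b - d) + \<Lambda> * (b - d)) * (y - d)" for a b d
  proof -
    have "(\<Lambda> - y + a) * (a - d + y) = a * (a - d) + y * d + \<Lambda> * (a - d) + y * (\<Lambda> - y)"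
      "(\<Lambda> - y + (a - d)) * (a + y) = a * (a - d) - y * d + \<Lambda> * a + y * (\<Lambda> - y)"
      "b * (\<Lambda> + (b - d)) = b * (b - d) + \<Lambda> * b" "(b - d) * (\<Lambda> + b) = b * (b - d) + \<Lambda> * (b - d)"
      by (simp_all add: algebra_simps)
    then show ?thesis by (metis (no_types, lifting) mult.assoc mult.left_commute)
  qed
  have exchange: "(a * (a - d) + y * d + \<Lambda> * (a - d) + y * (\<Lambda> - y)) * (b * (b - d) + \<Lambda> * b) * (d + y)
      - (a * (a - d) - y * d + \<Lambda> * a + y * (\<Lambda> - y)) * (b * (b - d) + \<Lambda> * (b - d)) * (y - d)
    = (b * (b - d) + y * d + \<Lambda> * (b - d) + y * (\<Lambda> - y)) * (a * (a - d) + \<Lambda> * a) * (d + y)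
      - (b * (b - d) - y * d + \<Lambda> * b + y * (\<Lambda> - y)) * (a * (a - d) + \<Lambda> * (a - d)) * (y - d)" for a b d
    by (simp add: algebra_simps)
  have swap: "y - (x - x') = x' - x + y" by simp
  from expand [of "x - p" "x - q" "x - x'"] expand [of "x - q" "x - p" "x - x'"] exchange [of "x - p" "x - x'" "x - q"]
  show ?thesis by (simp add: add_diff_eq swap)
qed

text \<open>The row of i = \<open>kth I r\<close> with u in place of t_r. The weight w is a separate
  argument, so that rows of different index sets can be compared.\<close>

definition wt_row :: "nat \<Rightarrow> nat \<Rightarrow> int \<Rightarrow> 'f::field \<Rightarrow> 'f \<Rightarrow> (nat \<Rightarrow> 'f) \<Rightarrow> 'f \<Rightarrow> 'f" where
  "wt_row n i w lam u z y = (\<Prod>b\<in>{1..n}. if b < i then u - z b + y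
     else if b = i then lam + u - z b - of_int w * y else u - z b)"

definition wt_pairs :: "nat \<Rightarrow> (nat \<times> nat) set" where
  "wt_pairs k = {(a, b). 1 \<le> a \<and> a < b \<and> b \<le> k}"

lemma finite_wt_pairs [simp]: "finite (wt_pairs k)"
  by (rule finite_subset [of _ "{1..k} \<times> {1..k}"]) (auto simp: wt_pairs_def)

definition wt_summand :: "nat \<Rightarrow> nat set \<Rightarrow> 'f::field \<Rightarrow> (nat \<Rightarrow> 'f) \<Rightarrow> 'f \<Rightarrow> (nat \<Rightarrow> 'f) \<Rightarrow> 'f" where
  "wt_summand n I lam z y u =
     (\<Prod>r\<in>{1..card I}. wt_row n (kth I r) (wt_w n (kth I r) I) lam (u r) z y) *
     (\<Prod>(a, b)\<in>wt_pairs (card I). (u a - u b + y) / (u a - u b))"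

lemma wt_W_eq:
  "wt_W n I lam t z y = y ^ card I * (\<Sum>\<pi>\<in>{\<pi>. \<pi> permutes {1..card I}}. wt_summand n I lam z y (t \<circ> \<pi>))"
  unfolding wt_W_def Let_def wt_summand_def wt_pairs_def wt_row_def wt_l_def ..

section \<open>Exchange of two neighbouring positions\<close>

locale adjacent_positions =
  fixes n a :: nat
  assumes a: "1 \<le> a" and an: "Suc a \<le> n"
begin

abbreviation (input) "s \<equiv> Transposition.transpose a (Suc a)"

lemma adj_permutes: "s permutes {1..n}"
  using a an by (intro permutes_swap_id) auto

lemma adj_less_iff: "i \<noteq> Suc a \<Longrightarrow> s b < i \<longleftrightarrow> b < i" and adj_greater_iff: "i \<noteq> a \<Longrightarrow> s b > i \<longleftrightarrow> b > i"
  by (auto simp: transpose_def)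

text \<open>Columns a and a + 1 lie on the same side of i, so their factors have the same form, and
  exchanging z_a and z_(a+1) only reorders them.\<close>

lemma wt_row_other:
  assumes "i \<noteq> a" "i \<noteq> Suc a"
  shows "wt_row n i w lam u (z \<circ> s) y = wt_row n i w lam u z y"
proof -
  define F where "F b v = (if b < i then u - v + y else if b = i then lam + u - v - of_int w * y else u - v)"
    for b v
  have "s b = i \<longleftrightarrow> b = i" for b using assms by (auto simp: transpose_def)
  then have "F (s b) v = F b v" for b v by (simp only: F_def adj_less_iff [OF assms(2)])
  then show ?thesis
    using prod.permute [OF adj_permutes, of "\<lambda>b. F b (z b)"]
    by (simp add: wt_row_def F_def [symmetric])
qed

text \<open>The factors outside columns a and a + 1. They are common to row a and row a + 1 and
  unaffected by the exchange.\<close>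

definition wt_rest :: "'f::field \<Rightarrow> (nat \<Rightarrow> 'f) \<Rightarrow> 'f \<Rightarrow> 'f" where
  "wt_rest u z y = (\<Prod>b\<in>{1..n} - {a, Suc a}. if b < a then u - z b + y else u - z b)"

lemma wt_rest_adj: "wt_rest u (z \<circ> s) y = wt_rest u z y"
  unfolding wt_rest_def by (intro prod.cong) (auto simp: transpose_def)

lemma prod_split_adj:
  fixes f :: "nat \<Rightarrow> 'f::comm_monoid_mult"
  shows "prod f {1..n} = f a * f (Suc a) * prod f ({1..n} - {a, Suc a})"
proof -
  have "prod f {1..n} = f a * prod f ({1..n} - {a})" using a an by (intro prod.remove) auto
  also have "prod f ({1..n} - {a}) = f (Suc a) * prod f ({1..n} - {a} - {Suc a})"
    using a an by (intro prod.remove) auto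
  finally show ?thesis by (simp add: Diff_insert2 [symmetric] mult.assoc insert_commute)
qed

lemma wt_row_a:
  "wt_row n a w lam u z y = wt_rest u z y * ((lam + u - z a - of_int w * y) * (u - z (Suc a)))"
proof -
  have "(\<Prod>b\<in>{1..n} - {a, Suc a}. if b < a then u - z b + y
     else if b = a then lam + u - z b - of_int w * y else u - z b) = wt_rest u z y"
    unfolding wt_rest_def by (intro prod.cong) auto
  then show ?thesis unfolding wt_row_def by (subst prod_split_adj) (simp add: mult_ac)
qed

lemma wt_row_Suc_a:
  "wt_row n (Suc a) w lam u z y = wt_rest u z y * ((u - z a + y) * (lam + u - z (Suc a) - of_int w * y))"
proof -
  have "(\<Prod>b\<in>{1..n} - {a, Suc a}. if b < Suc a then u - z b + y
     else if b = Suc a then lam + u - z b - of_int w * y else u - z b) = wt_rest u z y"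
    unfolding wt_rest_def by (intro prod.cong) auto
  then show ?thesis unfolding wt_row_def by (subst prod_split_adj) (simp add: mult_ac)
qed

text \<open>The weight counts positions beyond i, and the exchange preserves this set of positions
  when i \<noteq> a.\<close>

lemma wt_w_adj:
  assumes "i \<noteq> a" shows "wt_w n i (s ` K) = wt_w n i K"
proof -
  have 1: "card {j \<in> {1..n}. j > i \<and> P (s j)} = card {j \<in> {1..n}. j > i \<and> P j}" for P
  proof (rule bij_betw_same_card)
    show "bij_betw s {j \<in> {1..n}. j > i \<and> P (s j)} {j \<in> {1..n}. j > i \<and> P j}"
      by (rule bij_betw_byWitness [where f' = s])
        (simp_all add: image_subset_iff adj_greater_iff [OF assms] permutes_in_image [OF adj_permutes] del: atLeastAtMost_iff One_nat_def)
  qed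
  have mem: "j \<in> s ` K \<longleftrightarrow> s j \<in> K" for j
    by (metis (no_types, lifting) image_iff transpose_involutory)
  show ?thesis unfolding wt_w_def mem
    using 1 [of "\<lambda>j. j \<in> K"] 1 [of "\<lambda>j. j \<notin> K"] by simp
qed

lemma wt_w_step: "wt_w n a K = wt_w n (Suc a) K + (if Suc a \<in> K then 1 else - 1)"
proof -
  have "{j \<in> {1..n}. j > a \<and> j \<in> K} = {j \<in> {1..n}. j > Suc a \<and> j \<in> K} \<union> (if Suc a \<in> K then {Suc a} else {})"
    "{j \<in> {1..n}. j > a \<and> j \<notin> K} = {j \<in> {1..n}. j > Suc a \<and> j \<notin> K} \<union> (if Suc a \<in> K then {} else {Suc a})"
    using an by (auto split: if_splits) (use Suc_lessI in blast)+
  then show ?thesis unfolding wt_w_def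
    by (auto simp: card_insert_if split: if_splits)
qed

text \<open>Only one of a and a + 1 lies in K, so the exchange is increasing on K and preserves the
  numbering of the rows.\<close>

lemma kth_adj:
  assumes K: "K \<subseteq> {1..n}" "(a \<in> K) \<noteq> (Suc a \<in> K)" and r: "r \<in> {1..card K}"
  shows "kth (s ` K) r = s (kth K r)"
proof (rule kth_image [OF _ _ r])
  show "finite K" using K finite_subset by blast
  show "strict_mono_on K s"
    using K by (auto simp: strict_mono_on_def transpose_def)
qed

lemma card_adj: "card (s ` K) = card K"
  by (rule card_image) (rule permutes_inj_on [OF adj_permutes])

text \<open>
  If \<open>K\<close> contains \<open>a\<close> but not \<open>Suc a\<close>, then only one variable \<open>t\<^bsub>\<pi>(r)\<^esub>\<close> per summand of the weight
  function feels the exchange of \<open>a\<close> and \<open>Suc a\<close>; all other factors are collected in \<open>h\<close>.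
\<close>

lemma wt_W_one:
  fixes lam y :: "'f :: field" and t z :: "nat \<Rightarrow> 'f"
  assumes K: "K \<subseteq> {1..n}" "a \<in> K" "Suc a \<notin> K"
  defines "\<Lambda> \<equiv> lam - of_int (wt_w n (Suc a) K) * y"
  obtains h r where
    "wt_W n K lam t z y = (\<Sum>\<pi>\<in>{\<pi>. \<pi> permutes {1..card K}}. h \<pi> * ((\<Lambda> + y + t (\<pi> r) - z a) * (t (\<pi> r) - z (Suc a))))"
    "wt_W n K lam t (z \<circ> s) y = (\<Sum>\<pi>\<in>{\<pi>. \<pi> permutes {1..card K}}. h \<pi> * ((\<Lambda> + y + t (\<pi> r) - z (Suc a)) * (t (\<pi> r) - z a)))"
    "wt_W n (s ` K) lam t z y = (\<Sum>\<pi>\<in>{\<pi>. \<pi> permutes {1..card K}}. h \<pi> * ((t (\<pi> r) - z a + y) * (\<Lambda> + t (\<pi> r) - z (Suc a))))"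
    "wt_W n (s ` K) lam t (z \<circ> s) y = (\<Sum>\<pi>\<in>{\<pi>. \<pi> permutes {1..card K}}. h \<pi> * ((t (\<pi> r) - z (Suc a) + y) * (\<Lambda> + t (\<pi> r) - z a)))"
proof -
  let ?k = "card K"
  have fin: "finite K" using K(1) finite_subset by blast
  obtain r where r: "r \<in> {1..?k}" "kth K r = a"
    using kth_bij [OF fin] K(2) unfolding bij_betw_def by (metis (no_types, lifting) imageE)
  define Q where "Q u = (\<Prod>r'\<in>{1..?k} - {r}. wt_row n (kth K r') (wt_w n (kth K r') K) lam (u r') z y)" for u
  define V where "V u = (\<Prod>(a, b)\<in>wt_pairs ?k. (u a - u b + y) / (u a - u b))" for u :: "nat \<Rightarrow> 'f"
  define h where "h \<pi> = y ^ ?k * Q (t \<circ> \<pi>) * V (t \<circ> \<pi>) * wt_rest (t (\<pi> r)) z y" for \<pi>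
  have other: "kth K r' \<noteq> a" "kth K r' \<noteq> Suc a" if "r' \<in> {1..?k} - {r}" for r'
  proof -
    show "kth K r' \<noteq> a" using that r kth_bij [OF fin] by (auto simp: bij_betw_def dest: inj_onD)
    show "kth K r' \<noteq> Suc a" using that K(3) kth_mem [OF fin, of r'] by auto
  qed
  \<comment> \<open>So row a of K carries the parameter \<Lambda> + y, whereas by \<open>ws\<close>
    row a + 1 of the exchanged set carries \<Lambda>.\<close>
  have w: "wt_w n (Suc a) K = wt_w n a K + 1" using K(3) wt_w_step [of K] by simp
  have ws: "wt_w n (Suc a) (s ` K) = wt_w n (Suc a) K" by (rule wt_w_adj) simp
  have sum1: "wt_summand n K lam z' y u
      = Q u * V u * wt_rest (u r) z' y * ((lam + u r - z' a - of_int (wt_w n a K) * y) * (u r - z' (Suc a)))"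
    if "z' = z \<or> z' = z \<circ> s" for z' u
  proof -
    have "(\<Prod>r'\<in>{1..?k} - {r}. wt_row n (kth K r') (wt_w n (kth K r') K) lam (u r') z' y) = Q u"
      unfolding Q_def using that other by (intro prod.cong refl) (auto simp: wt_row_other)
    moreover have "(\<Prod>r'\<in>{1..?k}. wt_row n (kth K r') (wt_w n (kth K r') K) lam (u r') z' y)
        = wt_row n a (wt_w n a K) lam (u r) z' y
          * (\<Prod>r'\<in>{1..?k} - {r}. wt_row n (kth K r') (wt_w n (kth K r') K) lam (u r') z' y)"
      using prod.remove [OF finite_atLeastAtMost r(1),
          of "\<lambda>r'. wt_row n (kth K r') (wt_w n (kth K r') K) lam (u r') z' y"] by (simp only: r(2))
    ultimately show ?thesis unfolding wt_summand_def by (simp only: wt_row_a V_def mult_ac)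
  qed
  have sum2: "wt_summand n (s ` K) lam z' y u
      = Q u * V u * wt_rest (u r) z' y * ((u r - z' a + y) * (lam + u r - z' (Suc a) - of_int (wt_w n (Suc a) K) * y))"
    if "z' = z \<or> z' = z \<circ> s" for z' u
  proof -
    have kth_s: "kth (s ` K) r' = (if r' = r then Suc a else kth K r')" if "r' \<in> {1..?k}" for r'
    proof -
      have "kth (s ` K) r' = s (kth K r')" using that K by (intro kth_adj) auto
      then show ?thesis using r other [of r'] that by (auto simp: transpose_def)
    qed
    have 1: "(\<Prod>r'\<in>{1..?k} - {r}. wt_row n (kth (s ` K) r') (wt_w n (kth (s ` K) r') (s ` K)) lam (u r') z' y) = Q u"
      unfolding Q_def using that other by (intro prod.cong refl) (auto simp: wt_row_other kth_s wt_w_adj)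
    have "(\<Prod>r'\<in>{1..?k}. wt_row n (kth (s ` K) r') (wt_w n (kth (s ` K) r') (s ` K)) lam (u r') z' y)
        = wt_row n (Suc a) (wt_w n (Suc a) K) lam (u r) z' y * Q u"
      using r by (subst prod.remove [of _ r]) (simp_all only: 1 kth_s ws finite_atLeastAtMost refl if_True)
    then show ?thesis unfolding wt_summand_def card_adj wt_row_Suc_a
      by (simp add: V_def mult_ac)
  qed
  have rest: "wt_rest u (z \<circ> s) y = wt_rest u z y" for u by (rule wt_rest_adj)
  show thesis
  proof (rule that [of h r])
    show "wt_W n K lam t z y = (\<Sum>\<pi>\<in>{\<pi>. \<pi> permutes {1..card K}}. h \<pi> * ((\<Lambda> + y + t (\<pi> r) - z a) * (t (\<pi> r) - z (Suc a))))"
      unfolding wt_W_eq sum_distrib_left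
      by (intro sum.cong refl, subst sum1) (simp_all add: h_def \<Lambda>_def w algebra_simps)
    show "wt_W n K lam t (z \<circ> s) y = (\<Sum>\<pi>\<in>{\<pi>. \<pi> permutes {1..card K}}. h \<pi> * ((\<Lambda> + y + t (\<pi> r) - z (Suc a)) * (t (\<pi> r) - z a)))"
      unfolding wt_W_eq sum_distrib_left
      by (intro sum.cong refl, subst sum1) (simp_all add: rest h_def \<Lambda>_def w algebra_simps)
    show "wt_W n (s ` K) lam t z y = (\<Sum>\<pi>\<in>{\<pi>. \<pi> permutes {1..card K}}. h \<pi> * ((t (\<pi> r) - z a + y) * (\<Lambda> + t (\<pi> r) - z (Suc a))))"
      unfolding wt_W_eq sum_distrib_left card_adj
      by (intro sum.cong refl, subst sum2) (simp_all add: h_def \<Lambda>_def algebra_simps)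
    show "wt_W n (s ` K) lam t (z \<circ> s) y = (\<Sum>\<pi>\<in>{\<pi>. \<pi> permutes {1..card K}}. h \<pi> * ((t (\<pi> r) - z (Suc a) + y) * (\<Lambda> + t (\<pi> r) - z a)))"
      unfolding wt_W_eq sum_distrib_left card_adj
      by (intro sum.cong refl, subst sum2) (simp_all add: rest h_def \<Lambda>_def algebra_simps)
  qed
qed

lemma wt_W_neither:
  assumes K: "K \<subseteq> {1..n}" "a \<notin> K" "Suc a \<notin> K"
  shows "wt_W n K lam t (z \<circ> s) y = wt_W n K lam t z y"
proof -
  have fin: "finite K" using K(1) finite_subset by blast
  have "kth K r \<noteq> a" "kth K r \<noteq> Suc a" if "r \<in> {1..card K}" for r
    using kth_mem [OF fin that] K by auto
  then have "(\<Prod>r\<in>{1..card K}. wt_row n (kth K r) (wt_w n (kth K r) K) lam (u r) (z \<circ> s) y)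
      = (\<Prod>r\<in>{1..card K}. wt_row n (kth K r) (wt_w n (kth K r) K) lam (u r) z y)" for u
    by (intro prod.cong refl wt_row_other)
  then have "wt_summand n K lam (z \<circ> s) y u = wt_summand n K lam z y u" for u
    unfolding wt_summand_def by (simp only:)
  then show ?thesis by (simp add: wt_W_eq)
qed

text \<open>Single summands are not invariant. Pairing \<pi> with \<pi> \<circ> \<tau>, where \<tau>
  exchanges the rows of a and a + 1, symmetrises in the variables of these rows, and
  \<open>two_row_exchange\<close> applies to each pair. This counts the sum twice, hence the
  assumption on 2; injectivity of t keeps x - x' away from 0.\<close>

lemma wt_W_both:
  fixes lam y :: "'f :: field" and t z :: "nat \<Rightarrow> 'f"
  assumes K: "K \<subseteq> {1..n}" "a \<in> K" "Suc a \<in> K"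
    and t: "inj_on t {1..card K}" and two: "(2 :: 'f) \<noteq> 0"
  shows "wt_W n K lam t (z \<circ> s) y = wt_W n K lam t z y"
proof -
  let ?k = "card K"
  define \<Lambda> where "\<Lambda> = lam - of_int (wt_w n (Suc a) K) * y"
  have fin: "finite K" using K(1) finite_subset by blast
  have inj: "inj_on (kth K) {1..?k}" using kth_bij [OF fin] by (simp add: bij_betw_def)
  obtain r where r: "r \<in> {1..?k}" "kth K r = a"
    using kth_bij [OF fin] K(2) unfolding bij_betw_def by (metis (no_types, lifting) imageE)
  obtain r' where r': "r' \<in> {1..?k}" "kth K r' = Suc a"
    using kth_bij [OF fin] K(3) unfolding bij_betw_def by (metis (no_types, lifting) imageE)
  have "r < r'"
    using kth_strict_mono [of r' r K] r r' by (cases r r' rule: linorder_cases) auto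
  \<comment> \<open>No element of K lies between a and a + 1, so their rows are neighbours. Hence
    \<tau> preserves the order in all pairs other than (r, r'), which is behind
    \<open>V_\<tau>\<close>.\<close>
  have "r' = Suc r"
  proof (rule ccontr)
    assume "r' \<noteq> Suc r"
    with \<open>r < r'\<close> have "Suc r < r'" by simp
    then have "a < kth K (Suc r)" "kth K (Suc r) < Suc a"
      using kth_strict_mono [of r "Suc r" K] kth_strict_mono [of "Suc r" r' K] r r' by auto
    then show False by simp
  qed
  define \<tau> where "\<tau> = Transposition.transpose r r'"
  have \<tau>_perm: "\<tau> permutes {1..?k}" unfolding \<tau>_def using r r' by (intro permutes_swap_id) auto
  have \<tau>_simps: "\<tau> r = r'" "\<tau> r' = r" "\<And>i. i \<noteq> r \<Longrightarrow> i \<noteq> r' \<Longrightarrow> \<tau> i = i" "\<And>i. \<tau> (\<tau> i) = i"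
    by (auto simp: \<tau>_def)
  define Q where "Q u = (\<Prod>i\<in>{1..?k} - {r, r'}. wt_row n (kth K i) (wt_w n (kth K i) K) lam (u i) z y)" for u
  define V where "V u = (\<Prod>(a, b)\<in>wt_pairs ?k - {(r, r')}. (u a - u b + y) / (u a - u b))" for u :: "nat \<Rightarrow> 'f"
  define B where "B u = Q u * V u * wt_rest (u r) z y * wt_rest (u r') z y" for u
  define P where "P x x' p q = (\<Lambda> - y + x - p) * (x - q) * ((x' - p + y) * (\<Lambda> + x' - q)) * ((x - x' + y) / (x - x'))"
    for x x' p q :: 'f
  have Q_\<tau>: "Q (u \<circ> \<tau>) = Q u" for u
    unfolding Q_def by (intro prod.cong) (auto simp: \<tau>_simps)
  have V_\<tau>: "V (u \<circ> \<tau>) = V u" for u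
  proof -
    have \<tau>_eq: "\<tau> i = (if i = r then Suc r else if i = Suc r then r else i)" for i
      by (simp add: \<tau>_def \<open>r' = Suc r\<close> transpose_def)
    have sub: "(\<lambda>(i, j). (\<tau> i, \<tau> j)) ` (wt_pairs ?k - {(r, r')}) \<subseteq> wt_pairs ?k - {(r, r')}"
    proof (rule image_subsetI)
      fix p assume "p \<in> wt_pairs ?k - {(r, r')}"
      then obtain i j where p: "p = (i, j)" and ij: "(i, j) \<in> wt_pairs ?k" "(i, j) \<noteq> (r, r')"
        by (cases p) auto
      have "1 \<le> \<tau> i \<and> \<tau> j \<le> ?k"
        using permutes_in_image [OF \<tau>_perm, of i] permutes_in_image [OF \<tau>_perm, of j] ij
        by (auto simp: wt_pairs_def)
      moreover have "i < j" "\<not> (i = r \<and> j = Suc r)"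
        using ij \<open>r' = Suc r\<close> by (auto simp: wt_pairs_def)
      then have "\<tau> i < \<tau> j \<and> \<not> (\<tau> i = r \<and> \<tau> j = Suc r)"
        unfolding \<tau>_eq by presburger
      ultimately show "(case p of (i, j) \<Rightarrow> (\<tau> i, \<tau> j)) \<in> wt_pairs ?k - {(r, r')}"
        using \<open>r' = Suc r\<close> p by (simp add: wt_pairs_def)
    qed
    have "bij_betw (\<lambda>(i, j). (\<tau> i, \<tau> j)) (wt_pairs ?k - {(r, r')}) (wt_pairs ?k - {(r, r')})"
      by (rule bij_betw_byWitness [where f' = "\<lambda>(i, j). (\<tau> i, \<tau> j)", OF _ _ sub sub])
        (auto simp: \<tau>_simps(4))
    from prod.reindex_bij_betw [OF this, of "\<lambda>(i, j). (u i - u j + y) / (u i - u j)"] show ?thesis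
      unfolding V_def by (simp add: split_def)
  qed
  have B_\<tau>: "B (u \<circ> \<tau>) = B u" for u
    unfolding B_def Q_\<tau> V_\<tau> by (simp add: \<tau>_simps mult_ac)
  \<comment> \<open>Now a + 1 counts positively in the weight of a, so row a carries \<Lambda> -
    y.\<close>
  have w: "wt_w n a K = wt_w n (Suc a) K + 1" using K(3) wt_w_step [of K] by simp
  have summand: "wt_summand n K lam z' y u = B u * P (u r) (u r') (z' a) (z' (Suc a))"
    if z': "z' = z \<or> z' = z \<circ> s" for z' u
  proof -
    have other: "kth K i \<noteq> a" "kth K i \<noteq> Suc a" if "i \<in> {1..?k} - {r, r'}" for i
      using that r r' inj_on_eq_iff [OF inj, of i r] inj_on_eq_iff [OF inj, of i r'] by auto
    have Q: "(\<Prod>i\<in>{1..?k} - {r, r'}. wt_row n (kth K i) (wt_w n (kth K i) K) lam (u i) z' y) = Q u"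
      unfolding Q_def using z' other by (intro prod.cong refl) (auto simp: wt_row_other)
    have split: "{1..?k} = insert r (insert r' ({1..?k} - {r, r'}))" using r r' by auto
    have rows: "(\<Prod>i\<in>{1..?k}. wt_row n (kth K i) (wt_w n (kth K i) K) lam (u i) z' y)
        = wt_row n a (wt_w n a K) lam (u r) z' y * (wt_row n (Suc a) (wt_w n (Suc a) K) lam (u r') z' y * Q u)"
      using \<open>r < r'\<close> by (subst split) (simp add: r r' Q del: One_nat_def)
    have "(r, r') \<in> wt_pairs ?k" using r r' \<open>r < r'\<close> by (simp add: wt_pairs_def)
    then have pairs: "(\<Prod>(a, b)\<in>wt_pairs ?k. (u a - u b + y) / (u a - u b)) = (u r - u r' + y) / (u r - u r') * V u"
      unfolding V_def by (simp add: prod.remove)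
    have rest: "wt_rest x z' y = wt_rest x z y" for x using z' wt_rest_adj by blast
    have row1: "wt_row n a (wt_w n a K) lam x z' y = wt_rest x z y * ((\<Lambda> - y + x - z' a) * (x - z' (Suc a)))" for x
      unfolding wt_row_a rest \<Lambda>_def w by (simp add: algebra_simps)
    have row2: "wt_row n (Suc a) (wt_w n (Suc a) K) lam x z' y = wt_rest x z y * ((x - z' a + y) * (\<Lambda> + x - z' (Suc a)))" for x
      unfolding wt_row_Suc_a rest \<Lambda>_def by (simp add: algebra_simps)
    show ?thesis unfolding wt_summand_def rows pairs row1 row2 B_def P_def by (simp only: mult_ac)
  qed
  \<comment> \<open>The denominators x - x' and x' - x differ by a sign, which turns the sum of two
    values of P into the difference in \<open>two_row_exchange\<close>.\<close>
  have P_sym: "P x x' p q + P x' x p q = P x x' q p + P x' x q p" if "x \<noteq> x'" for x x' p q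
  proof -
    define f where "f x x' p q = (\<Lambda> - y + x - p) * (x - q) * ((x' - p + y) * (\<Lambda> + x' - q)) * (x - x' + y)" for x x' p q
    have P: "P x x' p q + P x' x p q = (f x x' p q - f x' x p q) / (x - x')" for p q
    proof -
      have "P x x' p q = f x x' p q / (x - x')" by (simp add: P_def f_def)
      moreover have "P x' x p q = - f x' x p q / (x - x')"
        unfolding P_def f_def by (subst minus_diff_eq [of x' x, symmetric]) (simp only: minus_divide_right [symmetric] times_divide_eq_right minus_divide_left [symmetric] minus_minus)
      ultimately show ?thesis by (simp add: diff_divide_distrib)
    qed
    have "f x x' p q - f x' x p q = f x x' q p - f x' x q p"
      unfolding f_def by (rule two_row_exchange)
    then show ?thesis unfolding P by simp
  qed
  have double: "2 * (\<Sum>\<pi>\<in>{\<pi>. \<pi> permutes {1..?k}}. wt_summand n K lam z' y (t \<circ> \<pi>))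
      = (\<Sum>\<pi>\<in>{\<pi>. \<pi> permutes {1..?k}}. B (t \<circ> \<pi>) *
          (P (t (\<pi> r)) (t (\<pi> r')) (z' a) (z' (Suc a)) + P (t (\<pi> r')) (t (\<pi> r)) (z' a) (z' (Suc a))))"
    if z': "z' = z \<or> z' = z \<circ> s" for z'
  proof -
    let ?S = "\<lambda>\<pi>. wt_summand n K lam z' y (t \<circ> \<pi>)"
    have "bij_betw (\<lambda>\<pi>. \<pi> \<circ> \<tau>) {\<pi>. \<pi> permutes {1..?k}} {\<pi>. \<pi> permutes {1..?k}}"
    proof (rule bij_betw_byWitness [where f' = "\<lambda>\<pi>. \<pi> \<circ> \<tau>"])
      have "\<tau> \<circ> \<tau> = id" by (simp add: fun_eq_iff \<tau>_simps(4))
      then show "\<forall>\<pi>\<in>{\<pi>. \<pi> permutes {1..?k}}. \<pi> \<circ> \<tau> \<circ> \<tau> = \<pi>"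
        "\<forall>\<pi>\<in>{\<pi>. \<pi> permutes {1..?k}}. \<pi> \<circ> \<tau> \<circ> \<tau> = \<pi>"
        by (simp_all add: comp_assoc)
      show "(\<lambda>\<pi>. \<pi> \<circ> \<tau>) ` {\<pi>. \<pi> permutes {1..?k}} \<subseteq> {\<pi>. \<pi> permutes {1..?k}}"
        "(\<lambda>\<pi>. \<pi> \<circ> \<tau>) ` {\<pi>. \<pi> permutes {1..?k}} \<subseteq> {\<pi>. \<pi> permutes {1..?k}}"
        using permutes_compose [OF \<tau>_perm] by blast+
    qed
    from sum.reindex_bij_betw [OF this, of ?S]
    have "2 * sum ?S {\<pi>. \<pi> permutes {1..?k}}
        = (\<Sum>\<pi>\<in>{\<pi>. \<pi> permutes {1..?k}}. ?S \<pi> + ?S (\<pi> \<circ> \<tau>))"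
      unfolding sum.distrib mult_2 by (rule arg_cong [OF sym])
    also have "\<dots> = (\<Sum>\<pi>\<in>{\<pi>. \<pi> permutes {1..?k}}. B (t \<circ> \<pi>) *
          (P (t (\<pi> r)) (t (\<pi> r')) (z' a) (z' (Suc a)) + P (t (\<pi> r')) (t (\<pi> r)) (z' a) (z' (Suc a))))"
    proof (intro sum.cong refl)
      fix \<pi>
      have "?S (\<pi> \<circ> \<tau>) = B (t \<circ> \<pi>) * P (t (\<pi> r')) (t (\<pi> r)) (z' a) (z' (Suc a))"
        unfolding summand [OF z'] comp_assoc [symmetric] B_\<tau> by (simp add: \<tau>_simps(1,2))
      then show "?S \<pi> + ?S (\<pi> \<circ> \<tau>) = B (t \<circ> \<pi>) *
          (P (t (\<pi> r)) (t (\<pi> r')) (z' a) (z' (Suc a)) + P (t (\<pi> r')) (t (\<pi> r)) (z' a) (z' (Suc a)))"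
        by (simp only: summand [OF z'] distrib_left comp_apply)
    qed
    finally show ?thesis .
  qed
  have "2 * (\<Sum>\<pi>\<in>{\<pi>. \<pi> permutes {1..?k}}. wt_summand n K lam (z \<circ> s) y (t \<circ> \<pi>))
      = 2 * (\<Sum>\<pi>\<in>{\<pi>. \<pi> permutes {1..?k}}. wt_summand n K lam z y (t \<circ> \<pi>))"
    unfolding double [OF disjI1 [OF refl]] double [OF disjI2 [OF refl]]
  proof (intro sum.cong refl)
    fix \<pi> assume "\<pi> \<in> {\<pi>. \<pi> permutes {1..?k}}"
    then have \<pi>: "\<pi> permutes {1..?k}" by simp
    have "\<pi> r \<noteq> \<pi> r'" using permutes_inj [OF \<pi>] \<open>r < r'\<close> by (auto dest: injD)
    then have "t (\<pi> r) \<noteq> t (\<pi> r')"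
      using t permutes_in_image [OF \<pi>] r r' by (auto dest: inj_onD)
    from P_sym [OF this] show "B (t \<circ> \<pi>) * (P (t (\<pi> r)) (t (\<pi> r')) ((z \<circ> s) a) ((z \<circ> s) (Suc a)) + P (t (\<pi> r')) (t (\<pi> r)) ((z \<circ> s) a) ((z \<circ> s) (Suc a)))
        = B (t \<circ> \<pi>) * (P (t (\<pi> r)) (t (\<pi> r')) (z a) (z (Suc a)) + P (t (\<pi> r')) (t (\<pi> r)) (z a) (z (Suc a)))"
      by simp
  qed
  then show ?thesis unfolding wt_W_eq using two by simp
qed

end

section \<open>Normalised weight functions and the coefficients of the R-matrix\<close>

definition wt_Cset :: "nat \<Rightarrow> int \<Rightarrow> nat set \<Rightarrow> 'f::field \<Rightarrow> 'f \<Rightarrow> 'f" where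
  "wt_Cset n r K lam y = (\<Prod>i\<in>K. lam - of_int (wt_w n i K + r) * y)"

text \<open>\<open>wt_Wtilde\<close> for the identity permutation. A general \<sigma> enters through
  K, the preimage of I, and through the order of the z's (\<open>wt_Wtilde_eq\<close>); changing
  \<sigma> thus becomes an exchange of positions.\<close>

definition wt_normalized :: "nat \<Rightarrow> nat set \<Rightarrow> 'f::field \<Rightarrow> (nat \<Rightarrow> 'f) \<Rightarrow> (nat \<Rightarrow> 'f) \<Rightarrow> 'f \<Rightarrow> 'f" where
  "wt_normalized n K lam t z y =
     wt_W n K lam t z y / (wt_Cset n 0 K lam y * wt_Cset n 1 K lam y * wt_e (card K) t y)"

lemma wt_Wtilde_eq:
  assumes "bij \<sigma>"
  shows "wt_Wtilde n \<sigma> I lam t z y = wt_normalized n (inv_into UNIV \<sigma> ` I) lam t (z \<circ> \<sigma>) y"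
proof -
  have inj: "inj_on (inv_into UNIV \<sigma>) I"
    using assms by (meson bij_imp_bij_inv bij_is_inj inj_on_subset subset_UNIV)
  have "wt_C n r \<sigma> I lam y = wt_Cset n r (inv_into UNIV \<sigma> ` I) lam y" for r
    by (simp add: wt_C_def wt_Cset_def prod.reindex [OF inj])
  then show ?thesis
    by (simp add: wt_Wtilde_def wt_Wsig_def wt_normalized_def card_image [OF inj])
qed

context adjacent_positions
begin

text \<open>Only the factors of a, which becomes a + 1, change. For r = 0 and r = 1 they are
  \<Lambda> + y and \<Lambda> before the exchange, \<Lambda> and \<Lambda> - y after it; c collects
  the others.\<close>

lemma wt_Cset_adj:
  fixes lam y :: "'f :: field"
  assumes K: "K \<subseteq> {1..n}" "a \<in> K" "Suc a \<notin> K"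
  defines "\<Lambda> \<equiv> lam - of_int (wt_w n (Suc a) K) * y"
  obtains c where
    "wt_Cset n 0 K lam y * wt_Cset n 1 K lam y = (\<Lambda> + y) * \<Lambda> * c"
    "wt_Cset n 0 (s ` K) lam y * wt_Cset n 1 (s ` K) lam y = \<Lambda> * (\<Lambda> - y) * c"
proof -
  have fin: "finite K" using K(1) finite_subset by blast
  define c where "c r = (\<Prod>i\<in>K - {a}. lam - of_int (wt_w n i K + r) * y)" for r
  have w: "wt_w n (Suc a) K = wt_w n a K + 1" using K(3) wt_w_step [of K] by simp
  have 1: "wt_Cset n r K lam y = (lam - of_int (wt_w n a K + r) * y) * c r" for r
    unfolding wt_Cset_def c_def using K fin by (simp add: prod.remove)
  have sK: "s ` K = insert (Suc a) (K - {a})"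
  proof -
    have "s ` (K - {a}) = K - {a}" using K(3) by (force simp: transpose_def image_iff)
    moreover have "K = insert a (K - {a})" using K(2) by blast
    ultimately show ?thesis by (metis image_insert transpose_apply_first)
  qed
  have 2: "wt_Cset n r (s ` K) lam y = (lam - of_int (wt_w n (Suc a) K + r) * y) * c r" for r
  proof -
    have "(\<Prod>i\<in>K - {a}. lam - of_int (wt_w n i (s ` K) + r) * y) = c r"
      unfolding c_def by (intro prod.cong refl) (simp add: wt_w_adj)
    moreover have "wt_w n (Suc a) (s ` K) = wt_w n (Suc a) K" by (rule wt_w_adj) simp
    moreover have "wt_Cset n r (s ` K) lam y = (lam - of_int (wt_w n (Suc a) (s ` K) + r) * y) *
        (\<Prod>i\<in>K - {a}. lam - of_int (wt_w n i (s ` K) + r) * y)"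
      unfolding wt_Cset_def by (subst (2) sK) (use K fin in simp)
    ultimately show ?thesis by simp
  qed
  show thesis
  proof (rule that [of "c 0 * c 1"])
    show "wt_Cset n 0 K lam y * wt_Cset n 1 K lam y = (\<Lambda> + y) * \<Lambda> * (c 0 * c 1)"
      unfolding 1 \<Lambda>_def w by (simp add: algebra_simps)
    show "wt_Cset n 0 (s ` K) lam y * wt_Cset n 1 (s ` K) lam y = \<Lambda> * (\<Lambda> - y) * (c 0 * c 1)"
      unfolding 2 \<Lambda>_def by (simp add: algebra_simps)
  qed
qed

text \<open>Here v = t - z_a and \<zeta> = z_(a+1) - z_a. The coefficients of this relation between
  quadratic polynomials in v are forced: v = 0 kills the second product on the right, v = -\<Lambda>
  the first. In \<open>exchange_term2\<close> the roles are reversed.\<close>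

lemma exchange_term1:
  fixes \<Lambda> :: "'f :: field"
  assumes "\<Lambda> \<noteq> 0" "\<zeta> \<noteq> y"
  shows "(\<Lambda> + y + v) * (v - \<zeta>) = (\<Lambda> + y) * \<zeta> / (\<Lambda> * (\<zeta> - y)) * ((v - \<zeta> + y) * (\<Lambda> + v))
    - (\<Lambda> + \<zeta>) * y / (\<Lambda> * (\<zeta> - y)) * ((\<Lambda> + y + v - \<zeta>) * v)"
  using assms by (simp add: divide_simps) (simp add: algebra_simps)

lemma exchange_term2:
  fixes \<Lambda> :: "'f :: field"
  assumes "\<Lambda> \<noteq> 0" "\<zeta> \<noteq> y"
  shows "(v + y) * (\<Lambda> + v - \<zeta>) = (\<Lambda> - y) * \<zeta> / (\<Lambda> * (\<zeta> - y)) * ((\<Lambda> + y + v - \<zeta>) * v)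
    - (\<Lambda> - \<zeta>) * y / (\<Lambda> * (\<zeta> - y)) * ((v - \<zeta> + y) * (\<Lambda> + v))"
  using assms by (simp add: divide_simps) (simp add: algebra_simps)

text \<open>In the relations \<open>1\<close> and \<open>2\<close> between unnormalised functions,
  \<Lambda> + y and \<Lambda> - y stand the other way round than in R. The quotient (\<Lambda> + y)
  / (\<Lambda> - y) of the normalising factors of K and of the exchanged set interchanges
  them.\<close>

lemma wt_normalized_one:
  fixes lam y :: "'f :: field" and t z :: "nat \<Rightarrow> 'f"
  assumes K: "K \<subseteq> {1..n}" "a \<in> K" "Suc a \<notin> K"
  defines "\<Lambda> \<equiv> lam - of_int (wt_w n (Suc a) K) * y" and "\<zeta> \<equiv> z (Suc a) - z a"
  assumes nz: "\<Lambda> \<noteq> 0" "\<Lambda> + y \<noteq> 0" "\<Lambda> - y \<noteq> 0" "\<zeta> \<noteq> y"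
  shows "wt_normalized n K lam t z y =
      (\<Lambda> - y) * \<zeta> / (\<Lambda> * (\<zeta> - y)) * wt_normalized n (s ` K) lam t (z \<circ> s) y
      - (\<Lambda> + \<zeta>) * y / (\<Lambda> * (\<zeta> - y)) * wt_normalized n K lam t (z \<circ> s) y"
    and "wt_normalized n (s ` K) lam t z y =
      (\<Lambda> + y) * \<zeta> / (\<Lambda> * (\<zeta> - y)) * wt_normalized n K lam t (z \<circ> s) y
      - (\<Lambda> - \<zeta>) * y / (\<Lambda> * (\<zeta> - y)) * wt_normalized n (s ` K) lam t (z \<circ> s) y"
proof -
  obtain h r where W:
    "wt_W n K lam t z y = (\<Sum>\<pi>\<in>{\<pi>. \<pi> permutes {1..card K}}. h \<pi> * ((\<Lambda> + y + t (\<pi> r) - z a) * (t (\<pi> r) - z (Suc a))))"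
    "wt_W n K lam t (z \<circ> s) y = (\<Sum>\<pi>\<in>{\<pi>. \<pi> permutes {1..card K}}. h \<pi> * ((\<Lambda> + y + t (\<pi> r) - z (Suc a)) * (t (\<pi> r) - z a)))"
    "wt_W n (s ` K) lam t z y = (\<Sum>\<pi>\<in>{\<pi>. \<pi> permutes {1..card K}}. h \<pi> * ((t (\<pi> r) - z a + y) * (\<Lambda> + t (\<pi> r) - z (Suc a))))"
    "wt_W n (s ` K) lam t (z \<circ> s) y = (\<Sum>\<pi>\<in>{\<pi>. \<pi> permutes {1..card K}}. h \<pi> * ((t (\<pi> r) - z (Suc a) + y) * (\<Lambda> + t (\<pi> r) - z a)))"
    using wt_W_one [OF K, of lam t z y] unfolding \<Lambda>_def by blast
  obtain c where c: "wt_Cset n 0 K lam y * wt_Cset n 1 K lam y = (\<Lambda> + y) * \<Lambda> * c"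
    "wt_Cset n 0 (s ` K) lam y * wt_Cset n 1 (s ` K) lam y = \<Lambda> * (\<Lambda> - y) * c"
    using wt_Cset_adj [OF K, of lam y] unfolding \<Lambda>_def by blast
  have 1: "wt_W n K lam t z y = (\<Lambda> + y) * \<zeta> / (\<Lambda> * (\<zeta> - y)) * wt_W n (s ` K) lam t (z \<circ> s) y
      - (\<Lambda> + \<zeta>) * y / (\<Lambda> * (\<zeta> - y)) * wt_W n K lam t (z \<circ> s) y"
    unfolding W sum_distrib_left sum_subtractf [symmetric]
  proof (intro sum.cong refl)
    fix \<pi>
    have "(\<Lambda> + y + (t (\<pi> r) - z a)) * (t (\<pi> r) - z a - \<zeta>)
      = (\<Lambda> + y) * \<zeta> / (\<Lambda> * (\<zeta> - y)) * ((t (\<pi> r) - z a - \<zeta> + y) * (\<Lambda> + (t (\<pi> r) - z a)))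
    - (\<Lambda> + \<zeta>) * y / (\<Lambda> * (\<zeta> - y)) * ((\<Lambda> + y + (t (\<pi> r) - z a) - \<zeta>) * (t (\<pi> r) - z a))"
      by (rule exchange_term1 [OF nz(1,4)])
    moreover have "t (\<pi> r) - z a - \<zeta> = t (\<pi> r) - z (Suc a)" "\<Lambda> + y + (t (\<pi> r) - z a) - \<zeta> = \<Lambda> + y + t (\<pi> r) - z (Suc a)"
      "\<Lambda> + y + (t (\<pi> r) - z a) = \<Lambda> + y + t (\<pi> r) - z a" "\<Lambda> + (t (\<pi> r) - z a) = \<Lambda> + t (\<pi> r) - z a"
      by (simp_all add: \<zeta>_def)
    ultimately have "(\<Lambda> + y + t (\<pi> r) - z a) * (t (\<pi> r) - z (Suc a))
      = (\<Lambda> + y) * \<zeta> / (\<Lambda> * (\<zeta> - y)) * ((t (\<pi> r) - z (Suc a) + y) * (\<Lambda> + t (\<pi> r) - z a))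
    - (\<Lambda> + \<zeta>) * y / (\<Lambda> * (\<zeta> - y)) * ((\<Lambda> + y + t (\<pi> r) - z (Suc a)) * (t (\<pi> r) - z a))"
      by (simp only:)
    then show "h \<pi> * ((\<Lambda> + y + t (\<pi> r) - z a) * (t (\<pi> r) - z (Suc a)))
      = (\<Lambda> + y) * \<zeta> / (\<Lambda> * (\<zeta> - y)) * (h \<pi> * ((t (\<pi> r) - z (Suc a) + y) * (\<Lambda> + t (\<pi> r) - z a)))
    - (\<Lambda> + \<zeta>) * y / (\<Lambda> * (\<zeta> - y)) * (h \<pi> * ((\<Lambda> + y + t (\<pi> r) - z (Suc a)) * (t (\<pi> r) - z a)))"
      by (simp only: right_diff_distrib mult.left_commute [of "h \<pi>"])
  qed
  have 2: "wt_W n (s ` K) lam t z y = (\<Lambda> - y) * \<zeta> / (\<Lambda> * (\<zeta> - y)) * wt_W n K lam t (z \<circ> s) y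
      - (\<Lambda> - \<zeta>) * y / (\<Lambda> * (\<zeta> - y)) * wt_W n (s ` K) lam t (z \<circ> s) y"
    unfolding W sum_distrib_left sum_subtractf [symmetric]
  proof (intro sum.cong refl)
    fix \<pi>
    have "(t (\<pi> r) - z a + y) * (\<Lambda> + (t (\<pi> r) - z a) - \<zeta>)
      = (\<Lambda> - y) * \<zeta> / (\<Lambda> * (\<zeta> - y)) * ((\<Lambda> + y + (t (\<pi> r) - z a) - \<zeta>) * (t (\<pi> r) - z a))
    - (\<Lambda> - \<zeta>) * y / (\<Lambda> * (\<zeta> - y)) * ((t (\<pi> r) - z a - \<zeta> + y) * (\<Lambda> + (t (\<pi> r) - z a)))"
      by (rule exchange_term2 [OF nz(1,4)])
    moreover have "t (\<pi> r) - z a - \<zeta> = t (\<pi> r) - z (Suc a)" "\<Lambda> + y + (t (\<pi> r) - z a) - \<zeta> = \<Lambda> + y + t (\<pi> r) - z (Suc a)"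
      "\<Lambda> + (t (\<pi> r) - z a) - \<zeta> = \<Lambda> + t (\<pi> r) - z (Suc a)" "\<Lambda> + (t (\<pi> r) - z a) = \<Lambda> + t (\<pi> r) - z a"
      by (simp_all add: \<zeta>_def)
    ultimately have "(t (\<pi> r) - z a + y) * (\<Lambda> + t (\<pi> r) - z (Suc a))
      = (\<Lambda> - y) * \<zeta> / (\<Lambda> * (\<zeta> - y)) * ((\<Lambda> + y + t (\<pi> r) - z (Suc a)) * (t (\<pi> r) - z a))
    - (\<Lambda> - \<zeta>) * y / (\<Lambda> * (\<zeta> - y)) * ((t (\<pi> r) - z (Suc a) + y) * (\<Lambda> + t (\<pi> r) - z a))"
      by (simp only:)
    then show "h \<pi> * ((t (\<pi> r) - z a + y) * (\<Lambda> + t (\<pi> r) - z (Suc a)))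
      = (\<Lambda> - y) * \<zeta> / (\<Lambda> * (\<zeta> - y)) * (h \<pi> * ((\<Lambda> + y + t (\<pi> r) - z (Suc a)) * (t (\<pi> r) - z a)))
    - (\<Lambda> - \<zeta>) * y / (\<Lambda> * (\<zeta> - y)) * (h \<pi> * ((t (\<pi> r) - z (Suc a) + y) * (\<Lambda> + t (\<pi> r) - z a)))"
      by (simp only: right_diff_distrib mult.left_commute [of "h \<pi>"])
  qed
  let ?e = "c * wt_e (card K) t y"
  have N: "wt_normalized n K lam t z' y = wt_W n K lam t z' y / ((\<Lambda> + y) * \<Lambda> * ?e)"
    "wt_normalized n (s ` K) lam t z' y = wt_W n (s ` K) lam t z' y / (\<Lambda> * (\<Lambda> - y) * ?e)" for z'
    unfolding wt_normalized_def c card_adj by (simp_all only: mult.assoc)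
  \<comment> \<open>E stands for the common factor of both denominators. It may be 0, in which case
    all quotients are 0 by convention.\<close>
  have key1: "(((\<Lambda> + y) * p) * A - q * B) / ((\<Lambda> + y) * \<Lambda> * E) = ((\<Lambda> - y) * p) * (A / (\<Lambda> * (\<Lambda> - y) * E)) - q * (B / ((\<Lambda> + y) * \<Lambda> * E))"
    and key2: "(((\<Lambda> - y) * p) * B - q * A) / (\<Lambda> * (\<Lambda> - y) * E) = ((\<Lambda> + y) * p) * (B / ((\<Lambda> + y) * \<Lambda> * E)) - q * (A / (\<Lambda> * (\<Lambda> - y) * E))"
    for p q A B E
    using nz by (cases "E = 0"; simp add: diff_divide_distrib)+
  show "wt_normalized n K lam t z y =
      (\<Lambda> - y) * \<zeta> / (\<Lambda> * (\<zeta> - y)) * wt_normalized n (s ` K) lam t (z \<circ> s) y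
      - (\<Lambda> + \<zeta>) * y / (\<Lambda> * (\<zeta> - y)) * wt_normalized n K lam t (z \<circ> s) y"
    unfolding N 1 using key1 [of "\<zeta> / (\<Lambda> * (\<zeta> - y))"] by (simp only: times_divide_eq_right)
  show "wt_normalized n (s ` K) lam t z y =
      (\<Lambda> + y) * \<zeta> / (\<Lambda> * (\<zeta> - y)) * wt_normalized n K lam t (z \<circ> s) y
      - (\<Lambda> - \<zeta>) * y / (\<Lambda> * (\<zeta> - y)) * wt_normalized n (s ` K) lam t (z \<circ> s) y"
    unfolding N 2 using key2 [of "\<zeta> / (\<Lambda> * (\<zeta> - y))"] by (simp only: times_divide_eq_right)
qed

lemma wt_normalized_same:
  fixes lam y :: "'f :: field" and t z :: "nat \<Rightarrow> 'f"
  assumes K: "K \<subseteq> {1..n}" "a \<in> K \<longleftrightarrow> Suc a \<in> K"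
    and t: "inj_on t {1..card K}" and two: "(2 :: 'f) \<noteq> 0"
  shows "wt_normalized n (s ` K) lam t (z \<circ> s) y = wt_normalized n K lam t z y"
proof -
  have "s ` K = K" using K(2) by (rule transpose_image_eq)
  moreover have "wt_W n K lam t (z \<circ> s) y = wt_W n K lam t z y"
    using wt_W_both [OF K(1) _ _ t two] wt_W_neither [OF K(1)] K(2) by (cases "a \<in> K") auto
  ultimately show ?thesis by (simp add: wt_normalized_def)
qed

end

section \<open>Triangularity\<close>

lemma wt_Cset_inverse_Llzy: "inverse (wt_Cset n r K rf_lam rf_y) \<in> Llzy n"
  unfolding wt_Cset_def by (intro Llzy_inverse_prod Llzy_inverse_lam)

lemma ksubsets_image:
  assumes "\<sigma> permutes {1..n}" "I \<in> ksubsets n k" shows "\<sigma> ` I \<in> ksubsets n k"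
  using assms permutes_in_image [OF assms(1)] card_image [OF permutes_inj_on [OF assms(1), of I]]
  by (auto simp: ksubsets_def simp del: atLeastAtMost_iff)

text \<open>The denominators are admissible: differences of distinct z's from the pairs of
  variables, z_i - z_j + y from \<open>wt_e\<close>, and \<lambda> - m y from
  \<open>wt_Cset\<close>. The existence of \<open>kappa\<close> rests on this.\<close>

lemma wt_normalized_Llzy:
  assumes \<sigma>: "\<sigma> permutes {1..n}" and K: "K \<in> ksubsets n k" and J: "J \<in> ksubsets n k"
  shows "wt_normalized n K rf_lam (\<lambda>r. rf_z (kth J r)) (rf_z \<circ> \<sigma>) rf_y \<in> Llzy n"
proof -
  note J' = ksubsetsD [OF J] and K' = ksubsetsD [OF K]
  have kth_in: "kth J r \<in> {1..n}" if "r \<in> {1..k}" for r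
    using kth_mem [OF J'(3), of r] J' that by auto
  have z: "rf_z (\<sigma> b) \<in> Llzy n" if "b \<in> {1..n}" for b
    using that permutes_in_image [OF \<sigma>, of b] by (intro Llzy_z) simp
  have "wt_W n K rf_lam (\<lambda>r. rf_z (kth J r)) (rf_z \<circ> \<sigma>) rf_y \<in> Llzy n"
    unfolding wt_W_eq
  proof (intro Llzy_mult Llzy_power Llzy_y Llzy_sum)
    fix \<pi> assume "\<pi> \<in> {\<pi>. \<pi> permutes {1..card K}}"
    then have \<pi>: "\<pi> permutes {1..k}" using K' by simp
    have \<pi>_in: "\<pi> r \<in> {1..k}" if "r \<in> {1..k}" for r
      using that permutes_in_image [OF \<pi>] by blast
    have t: "rf_z (kth J (\<pi> r)) \<in> Llzy n" if "r \<in> {1..k}" for r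
      by (intro Llzy_z kth_in \<pi>_in that)
    show "wt_summand n K rf_lam (rf_z \<circ> \<sigma>) rf_y ((\<lambda>r. rf_z (kth J r)) \<circ> \<pi>) \<in> Llzy n"
      unfolding wt_summand_def
    proof (intro Llzy_mult Llzy_prod)
      fix r assume r: "r \<in> {1..card K}"
      show "wt_row n (kth K r) (wt_w n (kth K r) K) rf_lam (((\<lambda>r. rf_z (kth J r)) \<circ> \<pi>) r) (rf_z \<circ> \<sigma>) rf_y \<in> Llzy n"
        unfolding wt_row_def
      proof (rule Llzy_prod)
        fix b assume b: "b \<in> {1..n}"
        have "rf_z (kth J (\<pi> r)) \<in> Llzy n" using r K' by (intro t) simp
        with z [OF b] show "(if b < kth K r then ((\<lambda>r. rf_z (kth J r)) \<circ> \<pi>) r - (rf_z \<circ> \<sigma>) b + rf_y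
          else if b = kth K r then rf_lam + ((\<lambda>r. rf_z (kth J r)) \<circ> \<pi>) r - (rf_z \<circ> \<sigma>) b - of_int (wt_w n (kth K r) K) * rf_y
          else ((\<lambda>r. rf_z (kth J r)) \<circ> \<pi>) r - (rf_z \<circ> \<sigma>) b) \<in> Llzy n"
          by (auto intro!: Llzy_add Llzy_diff Llzy_mult Llzy_of_int Llzy_lam Llzy_y)
      qed
    next
      fix p assume p: "p \<in> wt_pairs (card K)"
      then obtain c d where cd: "p = (c, d)" "c \<in> {1..k}" "d \<in> {1..k}" "c \<noteq> d"
        using K' by (auto simp: wt_pairs_def)
      have "\<pi> c \<noteq> \<pi> d" using permutes_inj [OF \<pi>] cd by (auto dest: injD)
      then have "kth J (\<pi> c) \<noteq> kth J (\<pi> d)"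
        using kth_bij [OF J'(3)] \<pi>_in cd J' by (auto simp: bij_betw_def dest: inj_onD)
      then have "inverse (rf_z (kth J (\<pi> c)) - rf_z (kth J (\<pi> d))) \<in> Llzy n"
        by (intro Llzy_inverse_z kth_in \<pi>_in cd)
      then have "(rf_z (kth J (\<pi> c)) - rf_z (kth J (\<pi> d)) + rf_y) / (rf_z (kth J (\<pi> c)) - rf_z (kth J (\<pi> d))) \<in> Llzy n"
        by (intro Llzy_divide Llzy_add Llzy_diff Llzy_y t cd)
      then show "(case p of (a, b) \<Rightarrow> (((\<lambda>r. rf_z (kth J r)) \<circ> \<pi>) a - ((\<lambda>r. rf_z (kth J r)) \<circ> \<pi>) b + rf_y)
          / (((\<lambda>r. rf_z (kth J r)) \<circ> \<pi>) a - ((\<lambda>r. rf_z (kth J r)) \<circ> \<pi>) b)) \<in> Llzy n"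
        by (simp add: cd)
    qed
  qed
  moreover have "inverse (wt_e (card K) (\<lambda>r. rf_z (kth J r)) rf_y) \<in> Llzy n"
    unfolding wt_e_def using K' by (intro Llzy_inverse_prod Llzy_inverse_z_plus_y kth_in) auto
  ultimately show ?thesis unfolding wt_normalized_def
    by (intro Llzy_divide Llzy_inverse_mult wt_Cset_inverse_Llzy)
qed

lemma wt_e_nonzero: "wt_e k (\<lambda>r. rf_z (f r)) rf_y \<noteq> 0"
  unfolding wt_e_def using rf_z_diff_plus_y_nonzero [where k = 1] by (auto simp: prod_zero_iff)

lemma wt_Cset_nonzero: "finite K \<Longrightarrow> wt_Cset n r K rf_lam rf_y \<noteq> 0"
  unfolding wt_Cset_def using rf_lam_plus_y_nonzero [of "- k" for k]
  by (auto simp: prod_zero_iff simp del: of_int_add)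

text \<open>
  A summand survives at \<open>z\<^sub>J\<close> only if \<open>\<pi>\<close> matches every element of \<open>L\<close> with an element of \<open>K\<close>
  that is at least as large.
\<close>

lemma wt_summand_nonzero_le:
  assumes \<sigma>: "\<sigma> permutes {1..n}" and L: "L \<in> ksubsets n k" and K: "K \<in> ksubsets n k"
    and t: "\<And>r. r \<in> {1..k} \<Longrightarrow> t r = rf_z (\<sigma> (l r))" and l: "bij_betw l {1..k} L"
    and nz: "wt_summand n K rf_lam (rf_z \<circ> \<sigma>) rf_y t \<noteq> 0" and r: "r \<in> {1..k}"
  shows "l r \<le> kth K r"
proof (rule ccontr)
  assume "\<not> l r \<le> kth K r"
  moreover have "l r \<in> {1..n}" using bij_betwE [OF l] ksubsetsD [OF L] r by blast
  ultimately have "wt_row n (kth K r) (wt_w n (kth K r) K) rf_lam (t r) (rf_z \<circ> \<sigma>) rf_y = 0"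
    unfolding wt_row_def by (intro prod_zero) (auto intro!: bexI [of _ "l r"] simp: t [OF r])
  then have "(\<Prod>r\<in>{1..k}. wt_row n (kth K r) (wt_w n (kth K r) K) rf_lam (t r) (rf_z \<circ> \<sigma>) rf_y) = 0"
    using r by (intro prod_zero) auto
  then show False using nz ksubsetsD [OF K] by (simp add: wt_summand_def)
qed

lemma sum_kth: "finite K \<Longrightarrow> (\<Sum>r\<in>{1..card K}. kth K r) = \<Sum>K"
  using sum.reindex_bij_betw [OF kth_bij, of K "\<lambda>x. x"] by simp

text \<open>In the row of i, the factor for b = i reduces to \<lambda> - w y, for b < i it is a
  difference plus y, and for b > i a difference of distinct z's; none of these vanishes.\<close>

lemma wt_summand_diagonal_nonzero:
  assumes \<sigma>: "\<sigma> permutes {1..n}" and K: "K \<in> ksubsets n k"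
    and t: "\<And>r. r \<in> {1..k} \<Longrightarrow> t r = rf_z (\<sigma> (kth K r))"
  shows "wt_summand n K rf_lam (rf_z \<circ> \<sigma>) rf_y t \<noteq> 0"
proof -
  note K' = ksubsetsD [OF K]
  have \<sigma>_eq: "\<sigma> i = \<sigma> j \<longleftrightarrow> i = j" for i j using permutes_inj [OF \<sigma>] by (auto dest: injD)
  have plus_y: "rf_z i - rf_z j + rf_y \<noteq> 0" for i j using rf_z_diff_plus_y_nonzero [of 1] by simp
  have lam: "rf_lam \<noteq> of_int m * rf_y" for m using rf_lam_plus_y_nonzero [of "- m"] by simp
  have "wt_row n (kth K r) (wt_w n (kth K r) K) rf_lam (t r) (rf_z \<circ> \<sigma>) rf_y \<noteq> 0" if "r \<in> {1..k}" for r
    unfolding wt_row_def t [OF that]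
    by (auto simp: prod_zero_iff plus_y lam rf_z_eq_iff \<sigma>_eq)
  moreover have "(t c - t d + rf_y) / (t c - t d) \<noteq> 0" if "(c, d) \<in> wt_pairs k" for c d
  proof -
    have cd: "c \<in> {1..k}" "d \<in> {1..k}" "c \<noteq> d" using that by (auto simp: wt_pairs_def)
    then have "kth K c \<noteq> kth K d" using kth_bij [OF K'(3)] K' by (auto simp: bij_betw_def dest: inj_onD)
    then have "t c - t d \<noteq> 0" using cd by (simp add: t rf_z_eq_iff \<sigma>_eq)
    moreover have "t c - t d + rf_y \<noteq> 0" using cd plus_y by (simp add: t)
    ultimately show ?thesis by simp
  qed
  ultimately show ?thesis unfolding wt_summand_def K'(2) by (auto simp: prod_zero_iff)
qed

text \<open>A surviving summand matches each element of L with one of K at least as large. Adding up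
  gives \<Sum>L \<le> \<Sum>K, and equality forces matched elements to coincide. For K = L exactly
  one permutation survives, so its nonzero summand cannot cancel.\<close>

lemma wt_normalized_triangular:
  assumes \<sigma>: "\<sigma> permutes {1..n}" and L: "L \<in> ksubsets n k" and K: "K \<in> ksubsets n k"
  shows "wt_normalized n K rf_lam (\<lambda>r. rf_z (kth (\<sigma> ` L) r)) (rf_z \<circ> \<sigma>) rf_y \<noteq> 0 \<Longrightarrow> K \<noteq> L \<Longrightarrow> \<Sum>L < \<Sum>K"
    and "K = L \<Longrightarrow> wt_normalized n K rf_lam (\<lambda>r. rf_z (kth (\<sigma> ` L) r)) (rf_z \<circ> \<sigma>) rf_y \<noteq> 0"
proof -
  note L' = ksubsetsD [OF L] and K' = ksubsetsD [OF K]
  note J' = ksubsetsD [OF ksubsets_image [OF \<sigma> L]]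
  let ?t = "\<lambda>r. rf_z (kth (\<sigma> ` L) r)"
  let ?S = "\<lambda>\<pi>. wt_summand n K rf_lam (rf_z \<circ> \<sigma>) rf_y (?t \<circ> \<pi>)"
  \<comment> \<open>The element of L whose variable enters row r in the summand of \<pi>.\<close>
  define l where "l \<pi> r = inv_into UNIV \<sigma> (kth (\<sigma> ` L) (\<pi> r))" for \<pi> :: "nat \<Rightarrow> nat" and r
  have bij0: "bij_betw (inv_into UNIV \<sigma> \<circ> kth (\<sigma> ` L)) {1..k} L"
  proof (rule bij_betw_trans)
    show "bij_betw (kth (\<sigma> ` L)) {1..k} (\<sigma> ` L)" using kth_bij [OF J'(3)] J' by simp
    show "bij_betw (inv_into UNIV \<sigma>) (\<sigma> ` L) L"
      using permutes_inj [OF \<sigma>] by (intro bij_betw_byWitness [where f' = \<sigma>]) (auto simp: permutes_inverses [OF \<sigma>])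
  qed
  have bij: "bij_betw (l \<pi>) {1..k} L" if "\<pi> permutes {1..k}" for \<pi>
    using bij_betw_trans [OF permutes_imp_bij [OF that] bij0] by (simp add: l_def [abs_def] comp_def)
  have t: "(?t \<circ> \<pi>) r = rf_z (\<sigma> (l \<pi> r))" for \<pi> r
    by (simp add: l_def permutes_inverses [OF \<sigma>])
  have le: "l \<pi> r \<le> kth K r" if "\<pi> permutes {1..k}" "?S \<pi> \<noteq> 0" "r \<in> {1..k}" for \<pi> r
    by (rule wt_summand_nonzero_le [OF \<sigma> L K t bij [OF that(1)] that(2,3)])
  have sum_l: "(\<Sum>r\<in>{1..k}. l \<pi> r) = \<Sum>L" if "\<pi> permutes {1..k}" for \<pi>
    using sum.reindex_bij_betw [OF bij [OF that], of "\<lambda>x. x"] by simp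
  have sum_K: "(\<Sum>r\<in>{1..k}. kth K r) = \<Sum>K" using sum_kth K' by blast
  have denom: "wt_Cset n 0 K rf_lam rf_y * wt_Cset n 1 K rf_lam rf_y * wt_e (card K) ?t rf_y \<noteq> 0"
    using wt_Cset_nonzero [OF K'(3)] wt_e_nonzero by simp
  \<comment> \<open>One strict inequality among the termwise bounds would already give \<Sum>L <
    \<Sum>K.\<close>
  have eq_l: "l \<pi> r = kth K r" if "\<pi> permutes {1..k}" "?S \<pi> \<noteq> 0" "\<Sum>K \<le> \<Sum>L" "r \<in> {1..k}" for \<pi> r
  proof (rule ccontr)
    assume "l \<pi> r \<noteq> kth K r"
    then have "l \<pi> r < kth K r" using le [OF that(1,2,4)] by simp
    then have "(\<Sum>r\<in>{1..k}. l \<pi> r) < (\<Sum>r\<in>{1..k}. kth K r)"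
      using le [OF that(1,2)] that(4) by (intro sum_strict_mono_ex1) auto
    then show False using that(3) unfolding sum_l [OF that(1)] sum_K by simp
  qed
  show "\<Sum>L < \<Sum>K" if nz: "wt_normalized n K rf_lam ?t (rf_z \<circ> \<sigma>) rf_y \<noteq> 0" and "K \<noteq> L"
  proof (rule ccontr)
    assume "\<not> \<Sum>L < \<Sum>K"
    then have "\<Sum>K \<le> \<Sum>L" by simp
    from nz have "(\<Sum>\<pi>\<in>{\<pi>. \<pi> permutes {1..k}}. ?S \<pi>) \<noteq> 0"
      unfolding wt_normalized_def wt_W_eq K'(2) by auto
    then obtain \<pi> where \<pi>: "\<pi> permutes {1..k}" "?S \<pi> \<noteq> 0"
      by (auto dest: sum.not_neutral_contains_not_neutral)
    have "L = l \<pi> ` {1..k}" using bij [OF \<pi>(1)] by (simp add: bij_betw_def)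
    also have "\<dots> = kth K ` {1..k}" using eq_l [OF \<pi> \<open>\<Sum>K \<le> \<Sum>L\<close>] by (intro image_cong) auto
    also have "\<dots> = K" using kth_bij [OF K'(3)] K' by (simp add: bij_betw_def)
    finally show False using \<open>K \<noteq> L\<close> by simp
  qed
  show "wt_normalized n K rf_lam ?t (rf_z \<circ> \<sigma>) rf_y \<noteq> 0" if "K = L"
  proof -
    have "bij_betw (kth K) {1..k} L" using kth_bij [OF K'(3)] K' that by simp
    then obtain \<pi>0 where \<pi>0: "\<pi>0 permutes {1..k}" "\<And>r. r \<in> {1..k} \<Longrightarrow> l \<pi>0 r = kth K r"
      using bij_betw_permutesE [OF bij0, of "kth K"] by (auto simp: l_def)
    have uniq: "\<pi> = \<pi>0" if \<pi>: "\<pi> permutes {1..k}" "?S \<pi> \<noteq> 0" for \<pi>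
    proof
      fix r
      show "\<pi> r = \<pi>0 r"
      proof (cases "r \<in> {1..k}")
        case True
        then have "l \<pi> r = l \<pi>0 r" using eq_l [OF \<pi>] \<open>K = L\<close> \<pi>0 by simp
        moreover have "\<pi> r \<in> {1..k}" "\<pi>0 r \<in> {1..k}"
          using True permutes_in_image [OF \<pi>(1)] permutes_in_image [OF \<pi>0(1)] by blast+
        ultimately show ?thesis
          using inj_on_eq_iff [OF bij_betw_imp_inj_on [OF bij0], of "\<pi> r" "\<pi>0 r"] by (simp add: l_def)
      next
        case False
        then show ?thesis using permutes_not_in [OF \<pi>(1)] permutes_not_in [OF \<pi>0(1)] by metis
      qed
    qed
    have "(\<Sum>\<pi>\<in>{\<pi>. \<pi> permutes {1..k}}. ?S \<pi>) = (\<Sum>\<pi>\<in>{\<pi>0}. ?S \<pi>)"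
      using \<pi>0 uniq by (intro sum.mono_neutral_right finite_permutations) auto
    also have "\<dots> \<noteq> 0"
      using wt_summand_diagonal_nonzero [OF \<sigma> K, of "?t \<circ> \<pi>0"] t [of \<pi>0] \<pi>0(2) by simp
    finally have "wt_W n K rf_lam ?t (rf_z \<circ> \<sigma>) rf_y \<noteq> 0"
      unfolding wt_W_eq K'(2) using rf_y_nonzero by simp
    with denom show ?thesis unfolding wt_normalized_def by simp
  qed
qed

section \<open>Stable envelopes\<close>

text \<open>The matrix of \<open>Stab\<close> in fixed-point coordinates.\<close>

definition stab_entry :: "nat \<Rightarrow> (nat \<Rightarrow> nat) \<Rightarrow> nat set \<Rightarrow> nat set \<Rightarrow> ratfun" where
  "stab_entry n \<sigma> I J = wt_Wtilde n \<sigma> I rf_lam (\<lambda>r. rf_z (kth J r)) rf_z rf_y"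

lemma stab_entry_eq:
  assumes "\<sigma> permutes {1..n}"
  shows "stab_entry n \<sigma> I J =
    wt_normalized n (inv_into UNIV \<sigma> ` I) rf_lam (\<lambda>r. rf_z (kth J r)) (rf_z \<circ> \<sigma>) rf_y"
  unfolding stab_entry_def by (rule wt_Wtilde_eq [OF permutes_bij [OF assms]])

text \<open>\<open>restr_HTL_surj\<close> and \<open>restr_HTL_inj\<close> justify the definite
  description.\<close>

lemma kappa_props:
  assumes \<sigma>: "\<sigma> permutes {1..n}" and I: "I \<in> ksubsets n k"
  shows "kappa n \<sigma> I \<in> carrier (HTL n k)"
    and "J \<in> ksubsets n k \<Longrightarrow> restr_HTL n J (kappa n \<sigma> I) = stab_entry n \<sigma> I J"
proof -
  note I' = ksubsetsD [OF I]
  have K: "inv_into UNIV \<sigma> ` I \<in> ksubsets n k"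
    by (rule ksubsets_image [OF permutes_inv [OF \<sigma>] I])
  obtain x where x: "x \<in> carrier (HTL n k)" "\<forall>J\<in>ksubsets n k. restr_HTL n J x = stab_entry n \<sigma> I J"
    using restr_HTL_surj [of n k "stab_entry n \<sigma> I"] wt_normalized_Llzy [OF \<sigma> K]
    by (auto simp: stab_entry_eq [OF \<sigma>])
  have "kappa n \<sigma> I \<in> carrier (HTL n k) \<and> (\<forall>J\<in>ksubsets n k. restr_HTL n J (kappa n \<sigma> I) = stab_entry n \<sigma> I J)"
    unfolding kappa_def I'(2) stab_entry_def [symmetric]
  proof (rule theI [where a = x])
    fix x' assume "x' \<in> carrier (HTL n k) \<and> (\<forall>J\<in>ksubsets n k. restr_HTL n J x' = stab_entry n \<sigma> I J)"
    with x show "x' = x" by (intro restr_HTL_inj [OF I'(4)]) auto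
  qed (use x in auto)
  then show "kappa n \<sigma> I \<in> carrier (HTL n k)"
    and "J \<in> ksubsets n k \<Longrightarrow> restr_HTL n J (kappa n \<sigma> I) = stab_entry n \<sigma> I J" by auto
qed

lemma Stab_props:
  assumes \<sigma>: "\<sigma> permutes {1..n}" and f: "f \<in> tensor_space n" and k: "k \<le> n"
  shows "Stab n \<sigma> f k \<in> carrier (HTL n k)"
    and "J \<in> ksubsets n k \<Longrightarrow> restr_HTL n J (Stab n \<sigma> f k) = (\<Sum>I\<in>ksubsets n k. f I * stab_entry n \<sigma> I J)"
proof -
  interpret abelian_group "HTL n k" by (rule abelian_group_HTL)
  have fL: "f I \<in> Llzy n" for I using f by (simp add: tensor_space_def)
  have cl: "f I \<odot>\<^bsub>HTL n k\<^esub> kappa n \<sigma> I \<in> carrier (HTL n k)" if "I \<in> ksubsets n k" for I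
    by (intro HTL_smult_closed fL kappa_props [OF \<sigma> that])
  have eq: "Stab n \<sigma> f k = finsum (HTL n k) (\<lambda>I. f I \<odot>\<^bsub>HTL n k\<^esub> kappa n \<sigma> I) (ksubsets n k)"
    using k by (simp add: Stab_def)
  show "Stab n \<sigma> f k \<in> carrier (HTL n k)"
    unfolding eq using cl by (intro finsum_closed) auto
  show "restr_HTL n J (Stab n \<sigma> f k) = (\<Sum>I\<in>ksubsets n k. f I * stab_entry n \<sigma> I J)"
    if J: "J \<in> ksubsets n k"
  proof -
    have "restr_HTL n J (Stab n \<sigma> f k) = (\<Sum>I\<in>ksubsets n k. restr_HTL n J (f I \<odot>\<^bsub>HTL n k\<^esub> kappa n \<sigma> I))"
      unfolding eq by (rule restr_HTL_finsum [OF J finite_ksubsets cl])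
    also have "\<dots> = (\<Sum>I\<in>ksubsets n k. f I * stab_entry n \<sigma> I J)"
      by (intro sum.cong refl) (simp add: restr_HTL_smult [OF J fL] kappa_props [OF \<sigma>] J)
    finally show ?thesis .
  qed
qed

text \<open>Each component is compared at its fixed points; components beyond n are
  \<open>undefined\<close> on both sides.\<close>

lemma Stab_eqI:
  assumes \<sigma>: "\<sigma> permutes {1..n}" and \<sigma>': "\<sigma>' permutes {1..n}"
    and f: "f \<in> tensor_space n" and g: "g \<in> tensor_space n"
    and eq: "\<And>k J. k \<le> n \<Longrightarrow> J \<in> ksubsets n k \<Longrightarrow>
      (\<Sum>I\<in>ksubsets n k. f I * stab_entry n \<sigma> I J) = (\<Sum>I\<in>ksubsets n k. g I * stab_entry n \<sigma>' I J)"
  shows "Stab n \<sigma> f = Stab n \<sigma>' g"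
proof
  fix k
  show "Stab n \<sigma> f k = Stab n \<sigma>' g k"
  proof (cases "k \<le> n")
    case True
    show ?thesis
      using Stab_props [OF \<sigma> f True] Stab_props [OF \<sigma>' g True] eq [OF True]
      by (intro restr_HTL_inj [OF True]) auto
  qed (simp add: Stab_def)
qed

text \<open>Among the sets where f and g differ, J is one whose preimage under \<sigma> has maximal
  sum. At x_J, triangularity then leaves only the term of J, whose entry is nonzero.\<close>

lemma inj_on_Stab:
  assumes \<sigma>: "\<sigma> permutes {1..n}"
  shows "inj_on (Stab n \<sigma>) (tensor_space n)"
proof (rule inj_onI, rule ccontr)
  fix f g assume f: "f \<in> tensor_space n" and g: "g \<in> tensor_space n"
    and eq: "Stab n \<sigma> f = Stab n \<sigma> g" and "f \<noteq> g"
  let ?inv = "inv_into UNIV \<sigma>"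
  define D where "D = {I. I \<subseteq> {1..n} \<and> f I \<noteq> g I}"
  have "finite D" by (rule finite_subset [of _ "Pow {1..n}"]) (auto simp: D_def)
  have "D \<noteq> {}"
  proof -
    obtain I where "f I \<noteq> g I" using \<open>f \<noteq> g\<close> by blast
    then have "I \<in> D" using f g by (cases "I \<subseteq> {1..n}") (auto simp: D_def tensor_space_def)
    then show ?thesis by blast
  qed
  with \<open>finite D\<close> have "Max ((\<lambda>I. \<Sum>(?inv ` I)) ` D) \<in> (\<lambda>I. \<Sum>(?inv ` I)) ` D"
    by (intro Max_in) auto
  then obtain J where J: "J \<in> D" "Max ((\<lambda>I. \<Sum>(?inv ` I)) ` D) = \<Sum>(?inv ` J)" by (rule imageE)
  have max: "\<Sum>(?inv ` I) \<le> \<Sum>(?inv ` J)" if "I \<in> D" for I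
    using \<open>finite D\<close> that unfolding J(2) [symmetric] by (intro Max_ge) auto
  define k where "k = card J"
  have Jk: "J \<in> ksubsets n k" using J by (auto simp: D_def ksubsets_def k_def)
  note J' = ksubsetsD [OF Jk]
  have L: "?inv ` I \<in> ksubsets n k" if "I \<in> ksubsets n k" for I
    by (rule ksubsets_image [OF permutes_inv [OF \<sigma>] that])
  have \<sigma>inv: "\<sigma> ` ?inv ` I = I" for I by (simp add: image_image permutes_inverses [OF \<sigma>])
  have entry: "stab_entry n \<sigma> I J
      = wt_normalized n (?inv ` I) rf_lam (\<lambda>r. rf_z (kth (\<sigma> ` ?inv ` J) r)) (rf_z \<circ> \<sigma>) rf_y" for I
    by (simp add: stab_entry_eq [OF \<sigma>] \<sigma>inv)
  have "(\<Sum>I\<in>ksubsets n k. f I * stab_entry n \<sigma> I J) = (\<Sum>I\<in>ksubsets n k. g I * stab_entry n \<sigma> I J)"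
    using Stab_props(2) [OF \<sigma> f J'(4) Jk] Stab_props(2) [OF \<sigma> g J'(4) Jk] eq by simp
  then have "0 = (\<Sum>I\<in>ksubsets n k. (f I - g I) * stab_entry n \<sigma> I J)"
    by (simp add: left_diff_distrib sum_subtractf)
  also have "\<dots> = (\<Sum>I\<in>{J}. (f I - g I) * stab_entry n \<sigma> I J)"
  proof (intro sum.mono_neutral_right ballI finite_ksubsets)
    fix I assume I: "I \<in> ksubsets n k - {J}"
    show "(f I - g I) * stab_entry n \<sigma> I J = 0"
    proof (cases "I \<in> D")
      case True
      have Ik: "I \<in> ksubsets n k" and "I \<noteq> J" using I by auto
      then have "?inv ` I \<noteq> ?inv ` J" using \<sigma>inv by metis
      moreover have "\<not> \<Sum>(?inv ` J) < \<Sum>(?inv ` I)" using max [OF True] by (rule leD)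
      ultimately have "stab_entry n \<sigma> I J = 0"
        unfolding entry using wt_normalized_triangular(1) [OF \<sigma> L [OF Jk] L [OF Ik]] by blast
      then show ?thesis by simp
    next
      case False
      then show ?thesis using I ksubsetsD(1) [of I n k] by (auto simp: D_def)
    qed
  qed (use Jk in auto)
  finally have "stab_entry n \<sigma> J J = 0" using J by (auto simp: D_def)
  with wt_normalized_triangular(2) [OF \<sigma> L [OF Jk] L [OF Jk] refl] show False
    unfolding entry by blast
qed

lemma geom_R_eqI:
  assumes \<sigma>': "\<sigma>' permutes {1..n}" and g: "g \<in> tensor_space n" and eq: "Stab n \<sigma>' g = Stab n \<sigma> f"
  shows "geom_R n \<sigma>' \<sigma> f = g"
  using inv_into_f_f [OF inj_on_Stab [OF \<sigma>'] g] by (simp add: geom_R_def eq)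

section \<open>Comparison with the dynamical R-matrix\<close>

lemma Rmat_Llzy:
  assumes "inverse l \<in> Llzy n" "inverse (\<zeta> - rf_y) \<in> Llzy n" "l \<in> Llzy n" "\<zeta> \<in> Llzy n"
  shows "Rmat l \<zeta> rf_y ! basis_pos i j I ! basis_pos i j I' \<in> Llzy n"
proof -
  have "(l + rf_y) * \<zeta> / (l * (\<zeta> - rf_y)) \<in> Llzy n" "(l - rf_y) * \<zeta> / (l * (\<zeta> - rf_y)) \<in> Llzy n"
    "- ((l + \<zeta>) * rf_y / (l * (\<zeta> - rf_y))) \<in> Llzy n" "- ((l - \<zeta>) * rf_y / (l * (\<zeta> - rf_y))) \<in> Llzy n"
    by (intro Llzy_intros assms)+
  then show ?thesis
    by (simp add: Rmat_def basis_pos_def Llzy_zero Llzy_one numeral_2_eq_2 numeral_3_eq_3)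
qed

text \<open>The denominators \<lambda> - m y and z_i - z_j - y of R are units of
  \<open>Llzy\<close>; so \<open>Stab\<close> may be applied to the image of R.\<close>

lemma dyn_R_in_tensor_space:
  assumes ij: "i \<in> {1..n}" "j \<in> {1..n}" "i \<noteq> j" and f: "f \<in> tensor_space n"
  shows "dyn_R n i j \<mu> (rf_z i - rf_z j) f \<in> tensor_space n"
  unfolding tensor_space_def
proof (intro CollectI conjI allI impI)
  have fL: "f I \<in> Llzy n" for I using f by (simp add: tensor_space_def)
  show "dyn_R n i j \<mu> (rf_z i - rf_z j) f I \<in> Llzy n" for I
    unfolding dyn_R_def using ij
    by (intro Llzy_sum Llzy_mult fL Rmat_Llzy Llzy_inverse_z_y Llzy_diff Llzy_lam Llzy_y Llzy_z Llzy_of_int)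
      (simp_all add: mult.commute [of rf_y] Llzy_inverse_lam)
  fix I assume "\<not> I \<subseteq> {1..n}"
  then have empty: "{I'. I' \<subseteq> {1..n} \<and> I' - {i, j} = I - {i, j}} = {}" using ij by blast
  show "dyn_R n i j \<mu> (rf_z i - rf_z j) f I = 0" unfolding dyn_R_def empty by simp
qed

lemma Rmat_entries:
  "Rmat l \<zeta> y ! 1 ! 1 = (l + y) * \<zeta> / (l * (\<zeta> - y))"
  "Rmat l \<zeta> y ! 1 ! 2 = - ((l + \<zeta>) * y / (l * (\<zeta> - y)))"
  "Rmat l \<zeta> y ! 2 ! 1 = - ((l - \<zeta>) * y / (l * (\<zeta> - y)))"
  "Rmat l \<zeta> y ! 2 ! 2 = (l - y) * \<zeta> / (l * (\<zeta> - y))"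
  by (simp_all add: Rmat_def numeral_2_eq_2)

text \<open>The weight-zero property: R fixes v_1 \<otimes> v_1 and v_2 \<otimes> v_2 and preserves
  the span of v_1 \<otimes> v_2 and v_2 \<otimes> v_1.\<close>

lemma Rmat_basis_pos:
  "(i \<in> I \<longleftrightarrow> j \<in> I) \<Longrightarrow> Rmat l \<zeta> y ! basis_pos i j I ! basis_pos i j I = 1"
  "(i \<in> I \<longleftrightarrow> j \<in> I) \<Longrightarrow> basis_pos i j I' \<noteq> basis_pos i j I \<Longrightarrow> Rmat l \<zeta> y ! basis_pos i j I ! basis_pos i j I' = 0"
  "(i \<in> I \<longleftrightarrow> j \<notin> I) \<Longrightarrow> (i \<in> I' \<longleftrightarrow> j \<in> I') \<Longrightarrow> Rmat l \<zeta> y ! basis_pos i j I ! basis_pos i j I' = 0"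
  by (cases "i \<in> I"; cases "j \<in> I"; cases "i \<in> I'"; cases "j \<in> I'";
      simp add: Rmat_def basis_pos_def numeral_2_eq_2 numeral_3_eq_3)+

lemma basis_pos_eq_iff: "basis_pos i j I = basis_pos i j I' \<longleftrightarrow> (i \<in> I \<longleftrightarrow> i \<in> I') \<and> (j \<in> I \<longleftrightarrow> j \<in> I')"
  by (auto simp: basis_pos_def)

text \<open>Four sets agree with I off i and j. By the weight-zero property only I contributes or,
  if I contains exactly one of i and j, I and its transposed set. The dynamical parameter is that of
  the source, the second argument of R.\<close>

lemma dyn_R_eq:
  fixes \<mu> :: "nat set \<Rightarrow> int" and \<zeta> :: ratfun
  assumes ij: "i \<in> {1..n}" "j \<in> {1..n}" "i \<noteq> j" and I: "I \<subseteq> {1..n}"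
  defines "R \<equiv> \<lambda>I I'. Rmat (rf_lam - rf_y * of_int (\<mu> I')) \<zeta> rf_y ! basis_pos i j I ! basis_pos i j I'"
  shows "dyn_R n i j \<mu> \<zeta> f I = (if i \<in> I \<longleftrightarrow> j \<in> I then f I
    else R I I * f I + R I (Transposition.transpose i j ` I) * f (Transposition.transpose i j ` I))"
proof -
  let ?S = "{I'. I' \<subseteq> {1..n} \<and> I' - {i, j} = I - {i, j}}" and ?\<tau>I = "Transposition.transpose i j ` I"
  have fin: "finite ?S" by (rule finite_subset [of _ "Pow {1..n}"]) auto
  have dyn: "dyn_R n i j \<mu> \<zeta> f I = (\<Sum>I'\<in>?S. R I I' * f I')" by (simp add: dyn_R_def R_def)
  show ?thesis
  proof (cases "i \<in> I \<longleftrightarrow> j \<in> I")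
    case True
    have "(\<Sum>I'\<in>?S. R I I' * f I') = (\<Sum>I'\<in>{I}. R I I' * f I')"
    proof (intro sum.mono_neutral_right ballI fin)
      fix I' assume "I' \<in> ?S - {I}"
      then have "basis_pos i j I' \<noteq> basis_pos i j I" unfolding basis_pos_eq_iff by blast
      then show "R I I' * f I' = 0" unfolding R_def by (simp add: Rmat_basis_pos(2) [OF True])
    qed (use I in auto)
    then show ?thesis unfolding dyn using True by (simp add: R_def Rmat_basis_pos(1))
  next
    case False
    define T where "T = ?\<tau>I"
    have T: "T - {i, j} = I - {i, j}" "T \<subseteq> {1..n}" "i \<in> T \<longleftrightarrow> i \<notin> I" "j \<in> T \<longleftrightarrow> j \<notin> I"
      unfolding T_def using False I ij by (auto simp: transpose_def image_iff split: if_splits)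
    have "I \<noteq> T" using T(3) by blast
    have determined: "A = B"
      if "A - {i, j} = B - {i, j}" "i \<in> A \<longleftrightarrow> i \<in> B" "j \<in> A \<longleftrightarrow> j \<in> B" for A B
    proof (rule Set.set_eqI)
      fix x
      have "x \<in> A - {i, j} \<longleftrightarrow> x \<in> B - {i, j}" using that(1) by simp
      with that(2,3) show "x \<in> A \<longleftrightarrow> x \<in> B" by (cases "x = i \<or> x = j") auto
    qed
    have "(\<Sum>I'\<in>?S. R I I' * f I') = (\<Sum>I'\<in>{I, T}. R I I' * f I')"
    proof (intro sum.mono_neutral_right ballI fin)
      show "{I, T} \<subseteq> ?S" using I T(1,2) by simp
      fix I' assume I': "I' \<in> ?S - {I, T}"
      have I'_diff: "I' - {i, j} = I - {i, j}" "I' \<noteq> I" "I' \<noteq> T" using I' by auto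
      have "\<not> ((i \<in> I' \<longleftrightarrow> i \<in> I) \<and> (j \<in> I' \<longleftrightarrow> j \<in> I))"
        using determined [OF I'_diff(1)] I'_diff(2) by blast
      moreover have "\<not> ((i \<in> I' \<longleftrightarrow> i \<in> T) \<and> (j \<in> I' \<longleftrightarrow> j \<in> T))"
        using determined [OF trans [OF I'_diff(1) T(1) [symmetric]]] I'_diff(3) by blast
      ultimately have I'_eq: "i \<in> I' \<longleftrightarrow> j \<in> I'" using False T(3,4) by argo
      have I_neq: "i \<in> I \<longleftrightarrow> j \<notin> I" using False by argo
      show "R I I' * f I' = 0" by (simp add: R_def Rmat_basis_pos(3) [OF I_neq I'_eq])
    qed
    also have "\<dots> = R I I * f I + R I T * f T" using \<open>I \<noteq> T\<close> by simp
    finally show ?thesis unfolding dyn T_def using False by (simp only: if_False)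
  qed
qed

text \<open>This identifies \<lambda> - y \<mu> with the parameter \<Lambda> of the exchange
  relations. The sum starts at a + 2 because \<open>wt_w\<close> counts only positions strictly
  beyond a + 1.\<close>

lemma sum_h_eigenval:
  assumes \<sigma>: "\<sigma> permutes {1..n}"
  shows "(\<Sum>i\<in>{a+2..n}. h_eigenval (\<sigma> i) I) = wt_w n (Suc a) (inv_into UNIV \<sigma> ` I)"
proof -
  have mem: "\<sigma> i \<in> I \<longleftrightarrow> i \<in> inv_into UNIV \<sigma> ` I" for i
    using permutes_inverses [OF \<sigma>] by (metis (no_types, lifting) image_iff)
  let ?K = "inv_into UNIV \<sigma> ` I"
  have "(\<Sum>i\<in>{a+2..n}. h_eigenval (\<sigma> i) I) = (\<Sum>i\<in>{a+2..n}. (if i \<in> ?K then 1 else 0) - (if i \<notin> ?K then 1 else 0))"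
    unfolding h_eigenval_def mem by (intro sum.cong) auto
  also have "\<dots> = int (card ({a+2..n} \<inter> {i. i \<in> ?K})) - int (card ({a+2..n} \<inter> {i. i \<notin> ?K}))"
    unfolding sum_subtractf by (simp add: sum.If_cases Collect_neg_eq [symmetric])
  also have "{a+2..n} \<inter> {i. i \<in> ?K} = {j \<in> {1..n}. j > Suc a \<and> j \<in> ?K}" by auto
  also have "{a+2..n} \<inter> {i. i \<notin> ?K} = {j \<in> {1..n}. j > Suc a \<and> j \<notin> ?K}" by auto
  finally show ?thesis by (simp add: wt_w_def)
qed

text \<open>The restriction to x_J of Stab_\<sigma>(v_I) = Stab_\<sigma>'(R v_I). As I is the
  source, its column of R occurs. Passing from \<sigma> to \<sigma>' exchanges a and a + 1 both in
  the index set and in the order of the z's.\<close>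

lemma stab_entry_exchange:
  assumes \<sigma>: "\<sigma> permutes {1..n}" and a: "1 \<le> a" "Suc a \<le> n"
    and I: "I \<in> ksubsets n k" and J: "J \<in> ksubsets n k"
  defines "\<sigma>' \<equiv> \<sigma> \<circ> Transposition.transpose a (Suc a)" and "i \<equiv> \<sigma> (Suc a)" and "j \<equiv> \<sigma> a"
  defines "\<tau>I \<equiv> Transposition.transpose i j ` I"
  defines "R \<equiv> Rmat (rf_lam - rf_y * of_int (wt_w n (Suc a) (inv_into UNIV \<sigma> ` I))) (rf_z i - rf_z j) rf_y"
  shows "(i \<in> I \<longleftrightarrow> j \<in> I) \<Longrightarrow> stab_entry n \<sigma>' I J = stab_entry n \<sigma> I J"
    and "\<not> (i \<in> I \<longleftrightarrow> j \<in> I) \<Longrightarrow>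
      R ! basis_pos i j I ! basis_pos i j I * stab_entry n \<sigma>' I J
      + R ! basis_pos i j \<tau>I ! basis_pos i j I * stab_entry n \<sigma>' \<tau>I J = stab_entry n \<sigma> I J"
proof -
  interpret adjacent_positions n a using a by unfold_locales
  let ?inv = "inv_into UNIV \<sigma>" and ?t = "\<lambda>r. rf_z (kth J r)"
  define K where "K = ?inv ` I"
  define z where "z = rf_z \<circ> \<sigma>"
  have \<sigma>'_perm: "\<sigma>' permutes {1..n}" unfolding \<sigma>'_def by (rule permutes_compose [OF adj_permutes \<sigma>])
  have inv_\<sigma>': "inv_into UNIV \<sigma>' ` M = Transposition.transpose a (Suc a) ` ?inv ` M" for M
    unfolding \<sigma>'_def by (simp add: o_inv_distrib [OF permutes_bij [OF \<sigma>]] image_comp)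
  have Kk: "K \<in> ksubsets n k" unfolding K_def by (rule ksubsets_image [OF permutes_inv [OF \<sigma>] I])
  note K' = ksubsetsD [OF Kk] and J' = ksubsetsD [OF J]
  have mem: "\<sigma> b \<in> I \<longleftrightarrow> b \<in> K" for b
    unfolding K_def using permutes_inverses [OF \<sigma>] by (metis (no_types, lifting) image_iff)
  have e\<sigma>: "stab_entry n \<sigma> I J = wt_normalized n K rf_lam ?t z rf_y"
    by (simp add: stab_entry_eq [OF \<sigma>] K_def z_def)
  have e\<sigma>': "stab_entry n \<sigma>' M J = wt_normalized n (Transposition.transpose a (Suc a) ` ?inv ` M) rf_lam ?t
      (z \<circ> Transposition.transpose a (Suc a)) rf_y" for M
    unfolding stab_entry_eq [OF \<sigma>'_perm] inv_\<sigma>' by (simp add: z_def \<sigma>'_def comp_assoc)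
  \<comment> \<open>Conjugation by \<sigma> turns the transposition of i and j into that of a and a
    + 1.\<close>
  have inv_\<tau>I: "?inv ` \<tau>I = Transposition.transpose a (Suc a) ` K"
  proof -
    have "?inv (Transposition.transpose i j x) = Transposition.transpose a (Suc a) (?inv x)" for x
    proof -
      have "Transposition.transpose i j (\<sigma> (?inv x)) = \<sigma> (Transposition.transpose a (Suc a) (?inv x))"
        unfolding i_def j_def transpose_def inj_eq [OF permutes_inj [OF \<sigma>]] by simp
      then show ?thesis by (simp add: permutes_inverses [OF \<sigma>])
    qed
    then show ?thesis by (simp add: \<tau>I_def K_def image_image)
  qed
  show "stab_entry n \<sigma>' I J = stab_entry n \<sigma> I J" if "i \<in> I \<longleftrightarrow> j \<in> I"
  proof -
    have t: "inj_on ?t {1..card K}"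
    proof (rule inj_onI)
      fix r r' assume "r \<in> {1..card K}" "r' \<in> {1..card K}" "?t r = ?t r'"
      then show "r = r'"
        using inj_on_eq_iff [OF bij_betw_imp_inj_on [OF kth_bij [OF J'(3)]], of r r']
        unfolding J'(2) K'(2) rf_z_eq_iff by blast
    qed
    have "a \<in> K \<longleftrightarrow> Suc a \<in> K" using that unfolding i_def j_def mem by blast
    then show ?thesis
      unfolding e\<sigma> e\<sigma>' K_def [symmetric] by (intro wt_normalized_same K'(1) t rf_two_nonzero)
  qed
  assume ne: "\<not> (i \<in> I \<longleftrightarrow> j \<in> I)"
  let ?\<Lambda> = "rf_lam - of_int (wt_w n (Suc a) K) * rf_y"
  have nz: "?\<Lambda> \<noteq> 0" "?\<Lambda> + rf_y \<noteq> 0" "?\<Lambda> - rf_y \<noteq> 0"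
    using rf_lam_plus_y_nonzero [of "- wt_w n (Suc a) K"] rf_lam_plus_y_nonzero [of "1 - wt_w n (Suc a) K"]
      rf_lam_plus_y_nonzero [of "- 1 - wt_w n (Suc a) K"]
    by (simp_all add: algebra_simps)
  have nz4: "z (Suc a) - z a \<noteq> rf_y"
    using rf_z_diff_plus_y_nonzero [of "-1" "\<sigma> (Suc a)" "\<sigma> a"] by (simp add: z_def)
  have R_eq: "R = Rmat ?\<Lambda> (z (Suc a) - z a) rf_y"
    by (simp add: R_def K_def z_def i_def j_def mult.commute)
  have ij: "i \<noteq> j" unfolding i_def j_def inj_eq [OF permutes_inj [OF \<sigma>]] by simp
  have \<tau>I: "i \<in> \<tau>I \<longleftrightarrow> j \<in> I" "j \<in> \<tau>I \<longleftrightarrow> i \<in> I"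
    using ij by (auto simp: \<tau>I_def transpose_def image_iff split: if_splits)
  have ss: "Transposition.transpose a (Suc a) ` Transposition.transpose a (Suc a) ` M = M" for M
    by (simp add: image_image)
  show "R ! basis_pos i j I ! basis_pos i j I * stab_entry n \<sigma>' I J
      + R ! basis_pos i j \<tau>I ! basis_pos i j I * stab_entry n \<sigma>' \<tau>I J = stab_entry n \<sigma> I J"
  proof (cases "j \<in> I")
    case True
    then have aK: "a \<in> K" "Suc a \<notin> K" using ne mem by (auto simp: i_def j_def)
    \<comment> \<open>I contains j but not i, so its tensor factors i and j form v_2 \<otimes> v_1,
      at position 2 when counting from 0.\<close>
    have pos: "basis_pos i j I = 2" "basis_pos i j \<tau>I = 1"
      using True ne \<tau>I by (auto simp: basis_pos_def)
    show ?thesis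
      unfolding pos R_eq Rmat_entries e\<sigma> e\<sigma>' inv_\<tau>I ss K_def [symmetric]
        wt_normalized_one(1) [OF K'(1) aK, of rf_lam rf_y z ?t, OF nz nz4]
      by (simp only: mult_minus_left add_uminus_conv_diff)
  next
    \<comment> \<open>Now K contains a + 1 and not a, so \<open>wt_normalized_one\<close> is applied
      to the exchanged set; its second relation concerns the image of that set, which is K again. By
      \<open>w\<close> the parameter \<Lambda> is the same.\<close>
    case False
    let ?K = "Transposition.transpose a (Suc a) ` K"
    have "Suc a \<in> K" "a \<notin> K" using ne False mem by (auto simp: i_def j_def)
    moreover have "x \<in> ?K \<longleftrightarrow> Transposition.transpose a (Suc a) x \<in> K" for x
      by (metis (no_types, lifting) image_iff transpose_involutory)
    ultimately have aK: "a \<in> ?K" "Suc a \<notin> ?K" by auto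
    have K1: "?K \<subseteq> {1..n}" using ksubsetsD(1) [OF ksubsets_image [OF adj_permutes Kk]] .
    have w: "wt_w n (Suc a) ?K = wt_w n (Suc a) K" by (rule wt_w_adj) simp
    have pos: "basis_pos i j I = 1" "basis_pos i j \<tau>I = 2"
      using False ne \<tau>I by (auto simp: basis_pos_def)
    show ?thesis
      unfolding pos R_eq Rmat_entries e\<sigma> e\<sigma>' inv_\<tau>I K_def [symmetric]
      using wt_normalized_one(2) [OF K1 aK, of rf_lam rf_y z ?t, unfolded w ss, OF nz nz4]
      by (simp only: ss mult_minus_left add_uminus_conv_diff)
  qed
qed

theorem proposition6p2:
  fixes n a :: nat and \<sigma> :: "nat \<Rightarrow> nat"
  assumes "n \<ge> 2" and "\<sigma> permutes {1..n}" and "1 \<le> a" and "a \<le> n - 1"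
  shows "\<forall>v \<in> tensor_space n.
           geom_R n (\<sigma> \<circ> Transposition.transpose a (a + 1)) \<sigma> v =
           dyn_R n (\<sigma> (a + 1)) (\<sigma> a)
             (\<lambda>I. \<Sum>i\<in>{a+2..n}. h_eigenval (\<sigma> i) I)
             (rf_z (\<sigma> (a + 1)) - rf_z (\<sigma> a)) v"
proof
  fix v assume v: "v \<in> tensor_space n"
  note \<sigma> = assms(2)
  have an: "Suc a \<le> n" using assms by simp
  interpret adjacent_positions n a using assms an by unfold_locales auto
  define i where "i = \<sigma> (Suc a)"
  define j where "j = \<sigma> a"
  define \<sigma>' where "\<sigma>' = \<sigma> \<circ> Transposition.transpose a (Suc a)"
  define \<mu> where "\<mu> I = (\<Sum>i\<in>{a+2..n}. h_eigenval (\<sigma> i) I)" for I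
  define g where "g = dyn_R n i j \<mu> (rf_z i - rf_z j) v"
  define R where "R I I' = Rmat (rf_lam - rf_y * of_int (\<mu> I')) (rf_z i - rf_z j) rf_y
      ! basis_pos i j I ! basis_pos i j I'" for I I'
  define \<tau> where "\<tau> I = Transposition.transpose i j ` I" for I
  have \<mu>: "\<mu> I = wt_w n (Suc a) (inv_into UNIV \<sigma> ` I)" for I
    unfolding \<mu>_def by (rule sum_h_eigenval [OF \<sigma>])
  have \<sigma>'_perm: "\<sigma>' permutes {1..n}" unfolding \<sigma>'_def by (rule permutes_compose [OF adj_permutes \<sigma>])
  have ij: "i \<in> {1..n}" "j \<in> {1..n}" "i \<noteq> j"
    unfolding i_def j_def permutes_in_image [OF \<sigma>] inj_eq [OF permutes_inj [OF \<sigma>]]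
    using assms(3) an by auto
  have g: "g \<in> tensor_space n" unfolding g_def by (rule dyn_R_in_tensor_space [OF ij v])
  have "Stab n \<sigma>' g = Stab n \<sigma> v"
  proof (rule Stab_eqI [OF \<sigma>'_perm \<sigma> g v])
    fix k J assume J: "J \<in> ksubsets n k"
    let ?X = "\<lambda>I. stab_entry n \<sigma>' I J" and ?Y = "\<lambda>I. stab_entry n \<sigma> I J"
    let ?E = "{I \<in> ksubsets n k. i \<in> I \<longleftrightarrow> j \<in> I}" and ?O = "{I \<in> ksubsets n k. \<not> (i \<in> I \<longleftrightarrow> j \<in> I)}"
    have split: "(\<Sum>I\<in>ksubsets n k. F I) = (\<Sum>I\<in>?E. F I) + (\<Sum>I\<in>?O. F I)" for F :: "nat set \<Rightarrow> ratfun"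
      by (subst sum.union_disjoint [symmetric]) (auto intro: sum.cong finite_subset [OF _ finite_ksubsets])
    have g_E: "g I = v I" if "I \<in> ?E" for I
      using that dyn_R_eq [OF ij ksubsetsD(1)] unfolding g_def by auto
    have g_O: "g I = R I I * v I + R I (\<tau> I) * v (\<tau> I)" if "I \<in> ?O" for I
      using that dyn_R_eq [OF ij ksubsetsD(1)] unfolding g_def R_def \<tau>_def by auto
    have \<tau>_inv: "\<tau> (\<tau> I) = I" for I by (simp add: \<tau>_def image_image)
    have \<tau>_O: "\<tau> I \<in> ?O" if "I \<in> ?O" for I
    proof -
      have "\<tau> I \<in> ksubsets n k"
        unfolding \<tau>_def using that by (intro ksubsets_image permutes_swap_id ij) auto
      moreover have "i \<in> \<tau> I \<longleftrightarrow> j \<in> I" "j \<in> \<tau> I \<longleftrightarrow> i \<in> I"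
        using ij(3) by (auto simp: \<tau>_def transpose_def image_iff split: if_splits)
      ultimately show ?thesis using that by auto
    qed
    have bij: "bij_betw \<tau> ?O ?O"
      by (rule bij_betw_byWitness [where f' = \<tau>]) (use \<tau>_O in \<open>auto simp: \<tau>_inv\<close>)
    have "(\<Sum>I\<in>?O. g I * ?X I) = (\<Sum>I\<in>?O. R I I * v I * ?X I) + (\<Sum>I\<in>?O. R I (\<tau> I) * v (\<tau> I) * ?X I)"
      by (simp add: g_O distrib_right sum.distrib)
    \<comment> \<open>\<open>g_O\<close> collects contributions by their target; reindexing by
      \<tau> collects them by source, as \<open>stab_entry_exchange\<close> requires.\<close>
    also have "(\<Sum>I\<in>?O. R I (\<tau> I) * v (\<tau> I) * ?X I) = (\<Sum>I\<in>?O. R (\<tau> I) I * v I * ?X (\<tau> I))"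
      using sum.reindex_bij_betw [OF bij, of "\<lambda>I. R I (\<tau> I) * v (\<tau> I) * ?X I"] by (simp add: \<tau>_inv)
    also have "(\<Sum>I\<in>?O. R I I * v I * ?X I) + \<dots> = (\<Sum>I\<in>?O. v I * ?Y I)"
      unfolding sum.distrib [symmetric]
    proof (intro sum.cong refl)
      fix I assume "I \<in> ?O"
      then have "R I I * ?X I + R (\<tau> I) I * ?X (\<tau> I) = ?Y I"
        using stab_entry_exchange(2) [OF \<sigma> a an _ J, of I]
        unfolding R_def \<tau>_def \<mu> \<sigma>'_def i_def j_def by blast
      then show "R I I * v I * ?X I + R (\<tau> I) I * v I * ?X (\<tau> I) = v I * ?Y I"
        by (metis (no_types, lifting) distrib_left mult.assoc mult.commute)
    qed
    finally have O: "(\<Sum>I\<in>?O. g I * ?X I) = (\<Sum>I\<in>?O. v I * ?Y I)" .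
    have E: "(\<Sum>I\<in>?E. g I * ?X I) = (\<Sum>I\<in>?E. v I * ?Y I)"
    proof (intro sum.cong refl)
      fix I assume I: "I \<in> ?E"
      then have "?X I = ?Y I"
        using stab_entry_exchange(1) [OF \<sigma> a an _ J, of I] unfolding \<sigma>'_def i_def j_def by blast
      then show "g I * ?X I = v I * ?Y I" by (simp add: g_E [OF I])
    qed
    show "(\<Sum>I\<in>ksubsets n k. g I * ?X I) = (\<Sum>I\<in>ksubsets n k. v I * ?Y I)"
      unfolding split [of "\<lambda>I. g I * ?X I"] split [of "\<lambda>I. v I * ?Y I"] E O ..
  qed
  from geom_R_eqI [OF \<sigma>'_perm g this]
  show "geom_R n (\<sigma> \<circ> Transposition.transpose a (a + 1)) \<sigma> v =
           dyn_R n (\<sigma> (a + 1)) (\<sigma> a)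
             (\<lambda>I. \<Sum>i\<in>{a+2..n}. h_eigenval (\<sigma> i) I)
             (rf_z (\<sigma> (a + 1)) - rf_z (\<sigma> a)) v"
    unfolding g_def \<mu>_def [abs_def] \<sigma>'_def i_def j_def by simp
qed

end
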